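(* Let $N$ be an oriented lattice of rank $2$, let $P\subset N_{\mathbb{Q}}$ be a Fano polygon, and let $m$ be a vertex of the polygonal quiver $Q=\mathbf{quiv}(N,P)$. The decorated quiver $\mathrm{mut}_m(Q)$ is polygonal if and only if $m$ is a primitive $T$-vertex, and in this case there is an isomorphism of decorated quivers $$\mathrm{mut}_m(Q)\cong \mathbf{quiv}(N,\mathrm{mut}_m(P)),$$ where $\mathrm{mut}_m(P)$ is the combinatorial mutation of $P$ with respect to the width vector $m$ and a factor of unit length.
   Context: Let $N$ be an oriented lattice of rank $2$, $N_{\mathbb{Q}}=N\otimes_{\mathbb{Z}}\mathbb{Q}$, $M=\mathrm{Hom}(N,\mathbb{Z})$. Using an orientation-preserving isomorphism $N\cong\mathbb{Z}^2$ and dual coordinates on $M$, put $\det((a,b)^t,(c,d)^t)=ad-bc$ on $M$ (independent of the isomorphism). A Fano polygon $P\subset N_{\mathbb{Q}}$ is a $2$-dimensional lattice polytope containing the origin in its strict interior, all of whose vertices are primitive lattice vectors. Its spanning fan $\Sigma_P$ is the complete fan whose cones are the cones over the proper faces of $P$. For a $2$-dimensional strictly convex rational cone $\sigma\subset N_{\mathbb{Q}}$ with primitive generators $u,v$: the inner normal vector $m_\sigma\in M$ is the unique primitive vector with $\langle m_\sigma,u\rangle=\langle m_\sigma,v\rangle<0$; the local index is $\ell_\sigma=-\langle m_\sigma,u\rangle$; the width is $w_\sigma=|\mathrm{conv}\{u,v\}\cap N|-1$. Write $w_\sigma=\alpha\ell_\sigma+\rho$ with $0\le\rho<\ell_\sigma$.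 A standard refinement of $\sigma$ is a subdivision of $\sigma$ by rays through primitive lattice points in the strict interior of $\mathrm{conv}\{u,v\}$ into $\alpha$ subcones with width and local index both $\ell_\sigma$ (primitive $T$-cones) and, if $\rho>0$, one further subcone of width $\rho$ and local index $\ell_\sigma$ (an $R$-cone). A standard refinement $\Sigma$ of $\Sigma_P$ is a choice of standard refinement of each maximal cone of $\Sigma_P$. The polygonal quiver $\mathbf{quiv}(N,P)$ has as vertices the multiset $\{m_\sigma\mid\sigma\text{ a maximal cone of }\Sigma\}$ (one vertex per maximal cone of $\Sigma$), where $m_\sigma$ is labelled by $(w_\sigma,\ell_\sigma)$. Between $m_\sigma$ and $m_\tau$ there are $|\det(m_\sigma,m_\tau)|$ arrows, pointing from $m_\sigma$ to $m_\tau$ if $\det(m_\sigma,m_\tau)>0$ and from $m_\tau$ to $m_\sigma$ if it is negative. This is independent of the choice of $\Sigma$. A decorated quiver is polygonal if it is (isomorphic to) $\mathbf{quiv}(N,P)$ for some oriented rank $2$ lattice $N$ and Fano polygon $P$. An isomorphism of decorated quivers is a bijection of vertices preserving the signed number of arrows between any two vertices and preserving labels. A vertex of a polygonal quiver with label $(w,\ell)$ is a primitive $T$-vertex if $w=\ell$ (equivalently, it is the inner normal vector of a primitive $T$-cone of $\Sigma$); otherwise $w<\ell$ and it is an $R$-vertex. Quiver mutation: a decorated quiver is a quiver with no self-loops or $2$-cycles whose vertices $v$ carry labels $(w_v,\ell_v)\in\mathbb{Z}^2$. It is balanced if for each vertex $m$ the sum over vertices $h$ receiving arrows from $m$ of $w_h$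 times the number of arrows $m\to h$ equals the sum over vertices $t$ sending arrows to $m$ of $w_t$ times the number of arrows $t\to m$; the common value is the diameter $D(m)$. Polygonal quivers are balanced. For a balanced quiver $Q$ and a vertex $m$ with label $(w,\ell)$, the underlying quiver of $\mathrm{mut}_m(Q)$ is the usual mutation at $m$ (for every path $t\to m\to h$ add an arrow $t\to h$; reverse all arrows incident at $m$; cancel all $2$-cycles); vertices $v\neq m$ keep their labels, and $m$ gets the label $(D(m)-w,D(m)-\ell)$. Combinatorial mutation: let $m\in M$ be primitive, and for $h\in\mathbb{Z}$ let $H_h=\{x\in N_{\mathbb{Q}}\mid\langle m,x\rangle=h\}$ and $P_h=\mathrm{conv}(H_h\cap P\cap N)$. A factor of $P$ with respect to $m$ is a lattice polytope $F\subset m^\perp\subset N_{\mathbb{Q}}$ such that for every integer $h<0$ there is a (possibly empty) lattice polytope $G_h\subset N_{\mathbb{Q}}$ with $H_h\cap\mathrm{verts}(P)\subseteq G_h+|h|F\subseteq P_h$ (with $\emptyset+|h|F=\emptyset$). The combinatorial mutation of $P$ with width vector $m$ and factor $F$ is the polytope $\mathrm{conv}\big(\bigcup_{h<0}G_h\cup\bigcup_{h\ge0}(P_h+hF)\big)$; it is independent of the choice of the $G_h$. A factor of unit length is $F=\mathrm{conv}\{\mathbf{0},f\}$ with $f$ a primitive generator of $m^\perp\cap N$ (the two choices of $f$ give polygons equivalent under an orientation-preserving automorphism of $N$). *)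

theory Defs
  imports "HOL-Analysis.Analysis"
begin

section \<open>Oriented lattices of rank 2\<close>

text \<open>
  A lattice \<open>N\<close> of rank 2 is given inside the plane \<open>N\<^sub>\<real> = \<real>\<^sup>2\<close>, as the integer span of an
  arbitrary basis of the plane. Every polytope below has its vertices in \<open>N\<close> and every cone is
  generated by elements of \<open>N\<close>, so passing from rational to real coefficients changes neither
  the faces, nor the lattice points, nor the interiors.
\<close>

definition lattice_basis :: "(real^2) set \<Rightarrow> real^2 \<Rightarrow> real^2 \<Rightarrow> bool" where
  "lattice_basis N b1 b2 \<longleftrightarrow>
     b1 \<noteq> b2 \<and> independent {b1, b2} \<and>
     N = {of_int i *\<^sub>R b1 + of_int j *\<^sub>R b2 | i j. True}"

text \<open>
  An orientation of \<open>N\<close> is recorded as the set \<open>B\<close> of its positively oriented bases, that is,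
  as an orbit of \<open>SL\<^sub>2(\<int>)\<close> on the bases of \<open>N\<close>.
\<close>

definition oriented_lattice :: "(real^2) set \<Rightarrow> ((real^2) \<times> (real^2)) set \<Rightarrow> bool" where
  "oriented_lattice N B \<longleftrightarrow>
     (\<exists>b1 b2. lattice_basis N b1 b2 \<and>
        B = {(of_int p *\<^sub>R b1 + of_int q *\<^sub>R b2, of_int r *\<^sub>R b1 + of_int s *\<^sub>R b2) | p q r s :: int.
               p * s - q * r = 1})"

text \<open>
  \<open>M = Hom(N, \<int>)\<close> is realised as the dual lattice, an element \<open>m\<close> being the functional
  \<open>x \<mapsto> m \<bullet> x\<close>.
\<close>

definition dual_lattice :: "(real^2) set \<Rightarrow> (real^2) set" where
  "dual_lattice N = {m. \<forall>x\<in>N. m \<bullet> x \<in> \<int>}"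

definition primitive :: "(real^2) set \<Rightarrow> real^2 \<Rightarrow> bool" where
  "primitive L x \<longleftrightarrow> x \<in> L \<and> (\<forall>y\<in>L. \<forall>k::int. x = of_int k *\<^sub>R y \<longrightarrow> \<bar>k\<bar> = 1)"

text \<open>
  In the coordinates on \<open>M\<close> dual to a basis \<open>(b1, b2)\<close>, the functional \<open>m\<close> is
  \<open>(m \<bullet> b1, m \<bullet> b2)\<close>.
\<close>

definition dual_det :: "((real^2) \<times> (real^2)) set \<Rightarrow> real^2 \<Rightarrow> real^2 \<Rightarrow> int" where
  "dual_det B m m' = (THE d. \<forall>(b1, b2)\<in>B.
     of_int d = (m \<bullet> b1) * (m' \<bullet> b2) - (m \<bullet> b2) * (m' \<bullet> b1))"


section \<open>Fano polygons and spanning fans\<close>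

definition lattice_polytope :: "(real^2) set \<Rightarrow> (real^2) set \<Rightarrow> bool" where
  "lattice_polytope N P \<longleftrightarrow> (\<exists>V. finite V \<and> V \<subseteq> N \<and> P = convex hull V)"

definition verts :: "(real^2) set \<Rightarrow> (real^2) set" where
  "verts P = {v. v extreme_point_of P}"

definition fano_polygon :: "(real^2) set \<Rightarrow> (real^2) set \<Rightarrow> bool" where
  "fano_polygon N P \<longleftrightarrow>
     lattice_polytope N P \<and> aff_dim P = 2 \<and> 0 \<in> interior P \<and> (\<forall>v\<in>verts P. primitive N v)"

definition spanning_fan :: "(real^2) set \<Rightarrow> (real^2) set set" where
  "spanning_fan P = {convex_cone hull F | F. F face_of P \<and> F \<noteq> P}"

definition maximal_cones :: "(real^2) set set \<Rightarrow> (real^2) set set" where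
  "maximal_cones \<F> = {\<sigma>\<in>\<F>. \<forall>\<tau>\<in>\<F>. \<sigma> \<subseteq> \<tau> \<longrightarrow> \<sigma> = \<tau>}"


section \<open>Two-dimensional cones\<close>

definition cone_gens :: "(real^2) set \<Rightarrow> (real^2) set \<Rightarrow> real^2 \<Rightarrow> real^2 \<Rightarrow> bool" where
  "cone_gens N \<sigma> u v \<longleftrightarrow>
     primitive N u \<and> primitive N v \<and> u \<noteq> v \<and> independent {u, v} \<and> \<sigma> = convex_cone hull {u, v}"

definition inner_normal :: "(real^2) set \<Rightarrow> (real^2) set \<Rightarrow> real^2" where
  "inner_normal N \<sigma> = (THE m. primitive (dual_lattice N) m \<and>
     (\<exists>u v. cone_gens N \<sigma> u v \<and> m \<bullet> u = m \<bullet> v \<and> m \<bullet> u < 0))"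

definition local_index :: "(real^2) set \<Rightarrow> (real^2) set \<Rightarrow> int" where
  "local_index N \<sigma> = (THE l. \<exists>u v. cone_gens N \<sigma> u v \<and> of_int l = - (inner_normal N \<sigma> \<bullet> u))"

definition width :: "(real^2) set \<Rightarrow> (real^2) set \<Rightarrow> int" where
  "width N \<sigma> = (THE w. \<exists>u v. cone_gens N \<sigma> u v \<and> w = int (card (convex hull {u, v} \<inter> N)) - 1)"

text \<open>
  A subdivision is given by its set \<open>S\<close> of maximal cones. The last three conjuncts say that
  \<open>S\<close> consists of \<open>w div l\<close> primitive T-cones and, if \<open>w mod l > 0\<close>, one R-cone.
\<close>

definition standard_refinement_of_cone ::
    "(real^2) set \<Rightarrow> (real^2) set \<Rightarrow> (real^2) set set \<Rightarrow> bool" where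
  "standard_refinement_of_cone N \<sigma> S \<longleftrightarrow>
     (\<exists>u v. cone_gens N \<sigma> u v \<and>
        (\<forall>\<tau>\<in>S. \<exists>p q. {p, q} \<subseteq> {u, v} \<union> {x \<in> open_segment u v. primitive N x} \<and>
                     p \<noteq> q \<and> \<tau> = convex_cone hull {p, q})) \<and>
     finite S \<and> \<Union>S = \<sigma> \<and> pairwise (\<lambda>\<tau> \<tau>'. interior \<tau> \<inter> interior \<tau>' = {}) S \<and>
     (let w = width N \<sigma>; l = local_index N \<sigma>; \<alpha> = w div l; \<rho> = w mod l in
        int (card {\<tau>\<in>S. width N \<tau> = l \<and> local_index N \<tau> = l}) = \<alpha> \<and>
        card {\<tau>\<in>S. width N \<tau> = \<rho> \<and> local_index N \<tau> = l} = (if \<rho> > 0 then 1 else 0) \<and>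
        int (card S) = \<alpha> + (if \<rho> > 0 then 1 else 0))"

text \<open>A standard refinement of the spanning fan, again given by its set of maximal cones.\<close>

definition standard_refinement :: "(real^2) set \<Rightarrow> (real^2) set \<Rightarrow> (real^2) set set \<Rightarrow> bool" where
  "standard_refinement N P \<Sigma> \<longleftrightarrow>
     (\<exists>S. (\<forall>\<sigma>\<in>maximal_cones (spanning_fan P). standard_refinement_of_cone N \<sigma> (S \<sigma>)) \<and>
          \<Sigma> = (\<Union>\<sigma>\<in>maximal_cones (spanning_fan P). S \<sigma>))"


section \<open>Decorated quivers and their mutations\<close>

text \<open>\<open>arrows Q a b\<close> is the number of arrows from \<open>a\<close> to \<open>b\<close>; labels are pairs \<open>(w, l)\<close>.\<close>

record 'a dquiver =
  vertices :: "'a set"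
  arrows :: "'a \<Rightarrow> 'a \<Rightarrow> nat"
  label :: "'a \<Rightarrow> int \<times> int"

definition signed_arrows :: "'a dquiver \<Rightarrow> 'a \<Rightarrow> 'a \<Rightarrow> int" where
  "signed_arrows Q a b = int (arrows Q a b) - int (arrows Q b a)"

definition dquiver_iso :: "'a dquiver \<Rightarrow> 'b dquiver \<Rightarrow> bool" where
  "dquiver_iso Q Q' \<longleftrightarrow>
     (\<exists>\<phi>. bij_betw \<phi> (vertices Q) (vertices Q') \<and>
        (\<forall>a\<in>vertices Q. \<forall>b\<in>vertices Q. signed_arrows Q' (\<phi> a) (\<phi> b) = signed_arrows Q a b) \<and>
        (\<forall>a\<in>vertices Q. label Q' (\<phi> a) = label Q a))"

definition out_weight :: "'a dquiver \<Rightarrow> 'a \<Rightarrow> int" where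
  "out_weight Q m = (\<Sum>h\<in>vertices Q. fst (label Q h) * int (arrows Q m h))"

definition in_weight :: "'a dquiver \<Rightarrow> 'a \<Rightarrow> int" where
  "in_weight Q m = (\<Sum>t\<in>vertices Q. fst (label Q t) * int (arrows Q t m))"

text \<open>
  The quiver is balanced if \<open>out_weight Q m = in_weight Q m\<close> at every vertex \<open>m\<close>; the diameter
  is the common value, and unspecified where the two weights differ.
\<close>

definition diameter :: "'a dquiver \<Rightarrow> 'a \<Rightarrow> int" where
  "diameter Q m = (THE d. out_weight Q m = d \<and> in_weight Q m = d)"

text \<open>
  \<open>premutation_arrows\<close> adds an arrow \<open>t \<rightarrow> h\<close> for every path \<open>t \<rightarrow> m \<rightarrow> h\<close> and reverses the arrows
  at \<open>m\<close>; the truncated subtraction in \<open>dquiver_mut\<close> cancels the 2-cycles.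
\<close>

definition premutation_arrows :: "'a \<Rightarrow> 'a dquiver \<Rightarrow> 'a \<Rightarrow> 'a \<Rightarrow> nat" where
  "premutation_arrows m Q t h =
     (if t = m \<or> h = m then arrows Q h t else arrows Q t h + arrows Q t m * arrows Q m h)"

definition dquiver_mut :: "'a \<Rightarrow> 'a dquiver \<Rightarrow> 'a dquiver" where
  "dquiver_mut m Q =
     \<lparr> vertices = vertices Q,
       arrows = (\<lambda>t h. premutation_arrows m Q t h - premutation_arrows m Q h t),
       label = (label Q)(m := (diameter Q m - fst (label Q m), diameter Q m - snd (label Q m))) \<rparr>"


section \<open>Polygonal quivers\<close>

text \<open>
  The vertices are the maximal cones \<open>\<sigma>\<close> themselves, standing for the \<open>m\<^sub>\<sigma>\<close> with multiplicity.
\<close>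

definition fan_quiver ::
    "(real^2) set \<Rightarrow> ((real^2) \<times> (real^2)) set \<Rightarrow> (real^2) set set \<Rightarrow> (real^2) set dquiver" where
  "fan_quiver N B \<Sigma> =
     \<lparr> vertices = \<Sigma>,
       arrows = (\<lambda>\<sigma> \<tau>. nat (dual_det B (inner_normal N \<sigma>) (inner_normal N \<tau>))),
       label = (\<lambda>\<sigma>. (width N \<sigma>, local_index N \<sigma>)) \<rparr>"

text \<open>Up to isomorphism this does not depend on the standard refinement that is chosen.\<close>

definition quiv ::
    "(real^2) set \<Rightarrow> ((real^2) \<times> (real^2)) set \<Rightarrow> (real^2) set \<Rightarrow> (real^2) set dquiver" where
  "quiv N B P = fan_quiver N B (SOME \<Sigma>. standard_refinement N P \<Sigma>)"

definition polygonal :: "'a dquiver \<Rightarrow> bool" where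
  "polygonal Q \<longleftrightarrow> (\<exists>N B P. oriented_lattice N B \<and> fano_polygon N P \<and> dquiver_iso Q (quiv N B P))"

definition primitive_T_vertex :: "'a dquiver \<Rightarrow> 'a \<Rightarrow> bool" where
  "primitive_T_vertex Q m \<longleftrightarrow> m \<in> vertices Q \<and> fst (label Q m) = snd (label Q m)"


section \<open>Combinatorial mutations of polygons\<close>

definition slice :: "(real^2) set \<Rightarrow> (real^2) set \<Rightarrow> real^2 \<Rightarrow> int \<Rightarrow> (real^2) set" where
  "slice N P m h = convex hull ({x. m \<bullet> x = of_int h} \<inter> P \<inter> N)"

definition dilate :: "int \<Rightarrow> (real^2) set \<Rightarrow> (real^2) set" where
  "dilate k F = (\<lambda>x. of_int k *\<^sub>R x) ` F"

text \<open>The sum of two sets is the Minkowski sum; in particular \<open>{} + F = {}\<close>.\<close>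

definition admissible_remainder ::
    "(real^2) set \<Rightarrow> (real^2) set \<Rightarrow> real^2 \<Rightarrow> (real^2) set \<Rightarrow> int \<Rightarrow> (real^2) set \<Rightarrow> bool" where
  "admissible_remainder N P m F h G \<longleftrightarrow>
     lattice_polytope N G \<and>
     {x. m \<bullet> x = of_int h} \<inter> verts P \<subseteq> G + dilate \<bar>h\<bar> F \<and>
     G + dilate \<bar>h\<bar> F \<subseteq> slice N P m h"

definition is_factor :: "(real^2) set \<Rightarrow> (real^2) set \<Rightarrow> real^2 \<Rightarrow> (real^2) set \<Rightarrow> bool" where
  "is_factor N P m F \<longleftrightarrow>
     lattice_polytope N F \<and> F \<subseteq> {x. m \<bullet> x = 0} \<and>
     (\<forall>h<0. \<exists>G. admissible_remainder N P m F h G)"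

text \<open>The polytope obtained does not depend on the choice of the \<open>G h\<close>.\<close>

definition polygon_mut :: "(real^2) set \<Rightarrow> real^2 \<Rightarrow> (real^2) set \<Rightarrow> (real^2) set \<Rightarrow> (real^2) set" where
  "polygon_mut N m F P =
     (let G = (SOME G. \<forall>h<0. admissible_remainder N P m F h (G h)) in
        convex hull ((\<Union>h\<in>{..<0}. G h) \<union> (\<Union>h\<in>{0..}. slice N P m h + dilate h F)))"

definition unit_length_segment :: "(real^2) set \<Rightarrow> real^2 \<Rightarrow> (real^2) set \<Rightarrow> bool" where
  "unit_length_segment N m F \<longleftrightarrow> (\<exists>f. primitive N f \<and> m \<bullet> f = 0 \<and> F = convex hull {0, f})"

end

(*
  For a Fano polygon, the cones of a standard refinement are counted by the support function: a
  primitive n occurs as an inner normal exactly according to the lattice length W of the face of P in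
  direction n and its height l = - min n, namely with W div l T-cones and an R-cone of width W mod l.
  The mutation of P at m with factor [0, f] has support function h o phi^-1, where h is that of P and
  phi is the piecewise linear map n |-> n - min (n.f) 0 * m. So heights and face lengths are
  transported by phi, except at m, where the length drops by l(m), and at -m, where it grows by l(-m).
  In the quiver this replaces one T-cone with normal m by one with normal -m and label
  (l(-m), l(-m)); the diameter of m is the lattice width l(m) + l(-m) of P, and the dets of
  phi-images are given by the arrow rule of quiver mutation.
  Conversely, at an R-vertex (w, l) the label becomes (D - w, D - l) with D - w > D - l, whereas
  w <= l holds for every label of a polygonal quiver.
*)
theory Submission
  imports Defs
begin

section \<open>Planar lattices and their duals\<close>

text \<open>\<open>quiv\<close> and \<open>polygon_mut\<close> both contain a choice, of a standard
  refinement and of the remainders \<open>G h\<close>. The proof therefore follows no individual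
  cone through the mutation. It compares how many cones have a given pair (inner normal, width),
  which no choice affects, and lifts equal counts to a bijection. Counts are taken at every
  primitive n, since an edge may vanish at m or appear at -m; a vertex face has length 0. The map
  phi arises as follows. P is the hull of a finite set Y and a copy of Y moved along f below level
  0; the mutation is the hull of Y and a copy moved above level 0. The moved copies differ by the
  linear shear x |-> x + (m.x) f. If n.f >= 0, both polygons attain their minimum on Y; if n.f <= 0,
  on the moved copies, and n must be corrected by the inverse transpose of the shear. Only for n.f =
  0 do Y and its copy tie, and there the lengths change. A T-cone is as wide as it is high, so
  changing a length by the height adds or removes exactly one T-cone and keeps the residue, hence
  the R-cone. The diameter is found by counting how the edges on one side of P cross the
  half-integral levels of m.\<close>

locale planar_lattice =
  fixes N :: "(real^2) set" and b1 b2 c1 c2 :: "real^2"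
  assumes c1_b1: "c1 \<bullet> b1 = 1" and c1_b2: "c1 \<bullet> b2 = 0" and c2_b1: "c2 \<bullet> b1 = 0" and c2_b2: "c2 \<bullet> b2 = 1"
    and expand: "x = (c1 \<bullet> x) *\<^sub>R b1 + (c2 \<bullet> x) *\<^sub>R b2"
    and lattice_eq: "N = {x. c1 \<bullet> x \<in> \<int> \<and> c2 \<bullet> x \<in> \<int>}"

lemma lattice_basis_imp_planar_lattice:
  assumes "lattice_basis N b1 b2"
  shows "\<exists>c1 c2. planar_lattice N b1 b2 c1 c2"
proof -
  define D where "D = b1$1 * b2$2 - b1$2 * b2$1"
  have ind: "independent {b1, b2}" "b1 \<noteq> b2" and N: "N = {of_int i *\<^sub>R b1 + of_int j *\<^sub>R b2 | i j. True}"
    using assms by (auto simp: lattice_basis_def)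
  have D: "D \<noteq> 0"
  proof
    assume "D = 0"
    then have z: "b1$1 * b2$2 = b1$2 * b2$1" by (simp add: D_def)
    have "b1 \<noteq> 0" "b2 \<noteq> 0" using ind(1) dependent_zero by blast+
    have lin: "p = 0 \<and> q = 0" if "p *\<^sub>R b1 + q *\<^sub>R b2 = 0" for p q
    proof -
      have "dependent {b1, b2}" if "p \<noteq> 0 \<or> q \<noteq> 0"
        using \<open>p *\<^sub>R b1 + q *\<^sub>R b2 = 0\<close> that ind(2)
        by (subst dependent_finite) (auto intro!: exI[of _ "\<lambda>v. if v = b1 then p else q"])
      then show ?thesis using ind(1) by blast
    qed
    \<comment> \<open>Two linear relations valid when the determinant vanishes; independence kills
      their coefficients, among them both coordinates of \<open>b1\<close>.\<close>
    have "(b2$1) *\<^sub>R b1 + (- b1$1) *\<^sub>R b2 = 0" "(b2$2) *\<^sub>R b1 + (- b1$2) *\<^sub>R b2 = 0"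
      using z by (auto simp: vec_eq_iff forall_2 algebra_simps)
    then have "b1$1 = 0" "b1$2 = 0" using lin by fastforce+
    then show False using \<open>b1 \<noteq> 0\<close> by (simp add: vec_eq_iff forall_2)
  qed
  \<comment> \<open>\<open>c1\<close> and \<open>c2\<close> are the rows of the inverse of the
    matrix with columns \<open>b1\<close>, \<open>b2\<close>.\<close>
  define c1 :: "real^2" where "c1 = vector [b2$2 / D, - b2$1 / D]"
  define c2 :: "real^2" where "c2 = vector [- b1$2 / D, b1$1 / D]"
  have ip: "x \<bullet> y = x$1 * y$1 + x$2 * y$2" for x y :: "real^2"
    by (simp add: inner_vec_def sum_2)
  have d: "c1 \<bullet> b1 = 1" "c1 \<bullet> b2 = 0" "c2 \<bullet> b1 = 0" "c2 \<bullet> b2 = 1"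
    using D by (simp_all add: c1_def c2_def ip, simp_all add: divide_simps, simp_all add: D_def algebra_simps)
  have e: "x = (c1 \<bullet> x) *\<^sub>R b1 + (c2 \<bullet> x) *\<^sub>R b2" for x
  proof -
    define p q where "p = b2$2 * x$1 - b2$1 * x$2" and "q = b1$1 * x$2 - b1$2 * x$1"
    have "D * x$1 = p * b1$1 + q * b2$1" "D * x$2 = p * b1$2 + q * b2$2"
      by (simp_all add: D_def p_def q_def algebra_simps)
    then have "x$1 = p / D * b1$1 + q / D * b2$1" "x$2 = p / D * b1$2 + q / D * b2$2"
      using D by (simp_all add: field_simps)
    moreover have "c1 \<bullet> x = p / D" "c2 \<bullet> x = q / D"
      by (simp_all add: ip c1_def c2_def p_def q_def diff_divide_distrib)
    ultimately show ?thesis by (simp add: vec_eq_iff forall_2)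
  qed
  have "N = {x. c1 \<bullet> x \<in> \<int> \<and> c2 \<bullet> x \<in> \<int>}"
  proof (intro equalityI subsetI)
    fix x assume "x \<in> N"
    then show "x \<in> {x. c1 \<bullet> x \<in> \<int> \<and> c2 \<bullet> x \<in> \<int>}"
      using d by (auto simp: N inner_add_right)
  next
    fix x assume "x \<in> {x. c1 \<bullet> x \<in> \<int> \<and> c2 \<bullet> x \<in> \<int>}"
    then obtain i j where "c1 \<bullet> x = of_int i" "c2 \<bullet> x = of_int j" by (auto elim!: Ints_cases)
    then show "x \<in> N" using e[of x] by (auto simp: N)
  qed
  with d e show ?thesis by (intro exI) (unfold_locales; blast)
qed

section \<open>Primitive vectors, the rotation between a lattice and its dual, lattice
  segments\<close>

context planar_lattice
begin

lemma pairing [simp]: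
  "c1 \<bullet> b1 = 1" "c1 \<bullet> b2 = 0" "c2 \<bullet> b1 = 0" "c2 \<bullet> b2 = 1"
  "b1 \<bullet> c1 = 1" "b2 \<bullet> c1 = 0" "b1 \<bullet> c2 = 0" "b2 \<bullet> c2 = 1"
  using c1_b1 c1_b2 c2_b1 c2_b2 by (simp_all add: inner_commute)

abbreviation M :: "(real^2) set" where "M \<equiv> dual_lattice N"

lemma expand_dual: "m = (m \<bullet> b1) *\<^sub>R c1 + (m \<bullet> b2) *\<^sub>R c2"
proof -
  have "m \<bullet> x = ((m \<bullet> b1) *\<^sub>R c1 + (m \<bullet> b2) *\<^sub>R c2) \<bullet> x" for x
    by (subst (1) expand[of x]) (simp add: inner_add_left inner_add_right algebra_simps)
  then show ?thesis by (metis vector_eq_rdot)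
qed

lemma inner_coords: "m \<bullet> x = (m \<bullet> b1) * (c1 \<bullet> x) + (m \<bullet> b2) * (c2 \<bullet> x)"
  by (subst (1) expand[of x]) (simp add: inner_add_right algebra_simps)

lemma dual_lattice_eq: "M = {m. b1 \<bullet> m \<in> \<int> \<and> b2 \<bullet> m \<in> \<int>}"
proof (intro equalityI subsetI)
  fix m assume "m \<in> M"
  moreover have "b1 \<in> N" "b2 \<in> N" by (simp_all add: lattice_eq)
  ultimately show "m \<in> {m. b1 \<bullet> m \<in> \<int> \<and> b2 \<bullet> m \<in> \<int>}" by (auto simp: dual_lattice_def inner_commute)
next
  fix m assume "m \<in> {m. b1 \<bullet> m \<in> \<int> \<and> b2 \<bullet> m \<in> \<int>}"
  then have "m \<bullet> x \<in> \<int>" if "x \<in> N" for x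
    using that by (subst inner_coords) (auto simp: lattice_eq inner_commute)
  then show "m \<in> M" by (simp add: dual_lattice_def)
qed

text \<open>The conditions are symmetric under exchanging a basis with its dual basis. Each fact
  about \<open>N\<close> yields its counterpart for \<open>M\<close> through \<open>OF dual\<close>,
  and \<open>dual_dual\<close> leads back.\<close>

lemma dual: "planar_lattice M c1 c2 b1 b2"
proof
  show "m = (b1 \<bullet> m) *\<^sub>R c1 + (b2 \<bullet> m) *\<^sub>R c2" for m
    using expand_dual[of m] by (simp add: inner_commute)
qed (auto simp: dual_lattice_eq)

lemma dual_dual: "dual_lattice M = N"
  using planar_lattice.dual_lattice_eq[OF dual] by (simp add: lattice_eq)

lemma lattice_simps [simp]:
  "0 \<in> N" "b1 \<in> N" "b2 \<in> N" "c1 \<in> M" "c2 \<in> M"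
  by (simp_all add: dual_lattice_eq) (simp_all add: lattice_eq)

lemma lattice_add: "x \<in> N \<Longrightarrow> y \<in> N \<Longrightarrow> x + y \<in> N"
  and lattice_diff: "x \<in> N \<Longrightarrow> y \<in> N \<Longrightarrow> x - y \<in> N"
  and lattice_minus: "x \<in> N \<Longrightarrow> - x \<in> N"
  and lattice_scale: "x \<in> N \<Longrightarrow> k \<in> \<int> \<Longrightarrow> k *\<^sub>R x \<in> N"
  by (auto simp: lattice_eq inner_add_right inner_diff_right)

lemmas dual_add = planar_lattice.lattice_add[OF dual]
  and dual_diff = planar_lattice.lattice_diff[OF dual]
  and dual_minus = planar_lattice.lattice_minus[OF dual]
  and dual_scale = planar_lattice.lattice_scale[OF dual]

lemma inner_Ints: "m \<in> M \<Longrightarrow> x \<in> N \<Longrightarrow> m \<bullet> x \<in> \<int>"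
  by (auto simp: dual_lattice_def)

text \<open>Dividing the coordinates by their gcd leaves a coprime pair, whose Bezout coefficients
  are the coordinates of a functional with value 1 on \<open>d\<close>.\<close>

lemma lattice_multiple_primitive:
  assumes "x \<in> N" "x \<noteq> 0"
  obtains d w where "primitive N d" "w > 0" "x = of_nat w *\<^sub>R d" "\<exists>c\<in>M. c \<bullet> d = 1"
proof -
  obtain i j where ij: "c1 \<bullet> x = of_int i" "c2 \<bullet> x = of_int j"
    using assms(1) by (auto simp: lattice_eq elim!: Ints_cases)
  have x: "x = of_int i *\<^sub>R b1 + of_int j *\<^sub>R b2" using expand[of x] ij by simp
  define g where "g = gcd i j"
  have "g > 0" using x assms(2) by (auto simp: g_def)
  obtain i' j' where gi: "i = g * i'" "j = g * j'" using g_def by (metis dvdE gcd_dvd1 gcd_dvd2)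
  obtain s t where "s * i + t * j = g" using bezout_int[of i j] by (auto simp: g_def)
  then have "g * (s * i' + t * j') = g * 1" by (simp add: gi algebra_simps)
  then have st: "s * i' + t * j' = 1" using \<open>g > 0\<close> by (simp only: mult_cancel_left) simp
  define d where "d = of_int i' *\<^sub>R b1 + of_int j' *\<^sub>R b2"
  define c where "c = of_int s *\<^sub>R c1 + of_int t *\<^sub>R c2"
  have dN: "d \<in> N" by (auto simp: d_def intro!: lattice_add lattice_scale)
  have cM: "c \<in> M" by (auto simp: c_def intro!: dual_add dual_scale)
  have "c \<bullet> d = of_int (s * i' + t * j')"
    by (simp add: c_def d_def inner_add_left inner_add_right)
  then have cd: "c \<bullet> d = 1" by (simp add: st)
  have "\<bar>k\<bar> = 1" if y: "y \<in> N" "d = of_int k *\<^sub>R y" for y and k :: int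
  proof -
    obtain l :: int where "c \<bullet> y = of_int l" using inner_Ints[OF cM y(1)] by (auto elim: Ints_cases)
    then have "of_int (k * l) = (1 :: real)" using cd y(2) by simp
    then have "k * l = 1" by linarith
    then show ?thesis by (metis abs_of_pos abs_minus_cancel zmult_eq_1_iff zero_less_one)
  qed
  then have "primitive N d" using dN by (auto simp: primitive_def)
  moreover have "x = of_nat (nat g) *\<^sub>R d"
    using \<open>g > 0\<close> by (simp add: x gi d_def scaleR_add_right)
  ultimately show ?thesis using that[of d "nat g"] \<open>g > 0\<close> cM cd by auto
qed

text \<open>Replaces indivisibility by a certificate: a functional with value 1 can be carried along
  by rotations and shears, as in \<open>perp_primitive\<close> and
  \<open>primitive_shift\<close>.\<close>

lemma primitive_iff: "primitive N x \<longleftrightarrow> x \<in> N \<and> (\<exists>c\<in>M. c \<bullet> x = 1)"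
proof
  assume p: "primitive N x"
  then have "x \<in> N" by (simp add: primitive_def)
  have "x \<noteq> 0"
  proof
    assume "x = 0"
    then have "x = of_int 0 *\<^sub>R x" by simp
    then show False using p by (force simp: primitive_def simp del: of_int_0)
  qed
  obtain d w where dw: "primitive N d" "w > 0" "x = of_nat w *\<^sub>R d" "\<exists>c\<in>M. c \<bullet> d = 1"
    using lattice_multiple_primitive[OF \<open>x \<in> N\<close> \<open>x \<noteq> 0\<close>] .
  have "x = of_int (int w) *\<^sub>R d" "d \<in> N" using dw by (auto simp: primitive_def)
  then have "\<bar>int w\<bar> = 1" using p unfolding primitive_def by blast
  then have "w = 1" by simp
  then show "x \<in> N \<and> (\<exists>c\<in>M. c \<bullet> x = 1)" using dw \<open>x \<in> N\<close> by auto
next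
  assume x: "x \<in> N \<and> (\<exists>c\<in>M. c \<bullet> x = 1)"
  then obtain c where c: "c \<in> M" "c \<bullet> x = 1" by blast
  show "primitive N x" unfolding primitive_def
  proof (intro conjI ballI allI impI)
    fix y :: "real^2" and k :: int assume y: "y \<in> N" "x = of_int k *\<^sub>R y"
    obtain l :: int where "c \<bullet> y = of_int l" using inner_Ints[OF c(1) y(1)] by (auto elim: Ints_cases)
    then have "of_int (k * l) = (1 :: real)" using c(2) y(2) by simp
    then have "k * l = 1" by linarith
    then show "\<bar>k\<bar> = 1" by (metis abs_of_pos abs_minus_cancel zmult_eq_1_iff zero_less_one)
  qed (use x in simp)
qed

lemma dual_primitive_iff: "primitive M m \<longleftrightarrow> m \<in> M \<and> (\<exists>x\<in>N. m \<bullet> x = 1)"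
  using planar_lattice.primitive_iff[OF dual] by (simp add: dual_dual inner_commute)

lemma primitive_in: "primitive N x \<Longrightarrow> x \<in> N" "primitive M m \<Longrightarrow> m \<in> M"
  by (simp_all add: primitive_def)

lemma primitive_nz: "primitive N x \<Longrightarrow> x \<noteq> 0" "primitive M m \<Longrightarrow> m \<noteq> 0"
  by (auto simp: primitive_iff dual_primitive_iff)

lemma primitive_minus: "primitive N x \<Longrightarrow> primitive N (- x)"
  by (force simp: primitive_iff intro: lattice_minus bexI[of _ "- c" for c] dual_minus)

lemma primitive_multiple_Ints:
  assumes "primitive N x" "a *\<^sub>R x \<in> N" shows "a \<in> \<int>"
proof -
  obtain c where "c \<in> M" "c \<bullet> x = 1" using assms(1) by (auto simp: primitive_iff)
  then show ?thesis using inner_Ints[of c "a *\<^sub>R x"] assms(2) by simp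
qed

lemma primitive_parallel:
  assumes "primitive N x" "primitive N y" "y = a *\<^sub>R x"
  shows "a = 1 \<or> a = -1"
proof -
  have "y \<in> N" "x \<in> N" "y \<noteq> 0" using assms(1,2) primitive_in(1) primitive_nz(1) by blast+
  then have a: "a \<in> \<int>" "a \<noteq> 0" using primitive_multiple_Ints assms by auto
  then have "x = (1/a) *\<^sub>R y" using assms by simp
  then have "1/a \<in> \<int>" using primitive_multiple_Ints assms(2) \<open>x \<in> N\<close> by metis
  with a obtain i j :: int where "a = of_int i" "1/a = of_int j" by (auto elim!: Ints_cases)
  then have "of_int (i * j) = (1::real)" using a by (metis of_int_mult nonzero_divide_eq_eq mult.commute)
  then have "i * j = 1" by linarith
  then show ?thesis using \<open>a = of_int i\<close> by (auto simp: zmult_eq_1_iff)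
qed

lemmas dual_primitive_minus = planar_lattice.primitive_minus[OF dual]

text \<open>The identification of \<open>M\<close> with \<open>N\<close> by the area form:
  \<open>n \<bullet> perp m\<close> is the determinant of \<open>m\<close>, \<open>n\<close> in the
  coordinates dual to \<open>b1\<close>, \<open>b2\<close>. Numbers of arrows thus become
  pairings.\<close>

definition perp :: "real^2 \<Rightarrow> real^2" where
  "perp m = (m \<bullet> b1) *\<^sub>R b2 - (m \<bullet> b2) *\<^sub>R b1"

definition perp' :: "real^2 \<Rightarrow> real^2" where
  "perp' x = (c1 \<bullet> x) *\<^sub>R c2 - (c2 \<bullet> x) *\<^sub>R c1"

lemma inner_perp: "n \<bullet> perp m = (m \<bullet> b1) * (n \<bullet> b2) - (m \<bullet> b2) * (n \<bullet> b1)"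
  by (simp add: perp_def inner_diff_right)

lemma inner_perp_self [simp]: "m \<bullet> perp m = 0"
  by (simp add: inner_perp)

lemma inner_perp_swap: "n \<bullet> perp m = - (m \<bullet> perp n)"
  by (simp add: inner_perp)

lemma inner_perp': "perp' x \<bullet> y = (c1 \<bullet> x) * (c2 \<bullet> y) - (c2 \<bullet> x) * (c1 \<bullet> y)"
  by (simp add: perp'_def inner_diff_left)

lemma perp'_self [simp]: "perp' x \<bullet> x = 0"
  by (simp add: inner_perp')

lemma perp_primitive:
  assumes "primitive M m" shows "primitive N (perp m)"
proof -
  obtain y where y: "y \<in> N" "m \<bullet> y = 1" using assms by (auto simp: dual_primitive_iff)
  have m: "m \<in> M" using assms primitive_in by blast
  define c where "c = (c1 \<bullet> y) *\<^sub>R c2 - (c2 \<bullet> y) *\<^sub>R c1"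
  have "c \<in> M" using y inner_Ints[of _ y] by (auto simp: c_def intro!: dual_diff dual_scale)
  moreover have "c \<bullet> perp m = 1"
    using y(2) inner_coords[of m y]
    by (simp add: c_def inner_perp inner_diff_left algebra_simps)
  moreover have "perp m \<in> N"
    using inner_Ints[OF m] by (auto simp: perp_def intro!: lattice_diff lattice_scale)
  ultimately show ?thesis by (auto simp: primitive_iff)
qed

lemma perp'_eq: "planar_lattice.perp c1 c2 = perp'"
  by (rule ext) (simp add: planar_lattice.perp_def[OF dual] perp'_def inner_commute)

lemma perp'_primitive: "primitive N x \<Longrightarrow> primitive M (perp' x)"
  using planar_lattice.perp_primitive[OF dual] by (simp add: dual_dual perp'_eq)

text \<open>A planar triple product identity, checked by pairing both sides with every
  \<open>c\<close>. Its instance \<open>y = m\<close> shows in \<open>orthogonal_multiple\<close>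
  that \<open>perp m\<close> spans the kernel of \<open>m\<close>.\<close>

lemma plane_identity: "(m \<bullet> y) *\<^sub>R x - (m \<bullet> x) *\<^sub>R y = (perp' y \<bullet> x) *\<^sub>R perp m"
proof -
  have "(m \<bullet> y) * (c \<bullet> x) - (m \<bullet> x) * (c \<bullet> y) = (perp' y \<bullet> x) * (c \<bullet> perp m)" for c
    unfolding inner_perp inner_perp' inner_coords[of m x] inner_coords[of m y] inner_coords[of c x] inner_coords[of c y]
    by (simp add: algebra_simps)
  then have "c \<bullet> ((m \<bullet> y) *\<^sub>R x - (m \<bullet> x) *\<^sub>R y) = c \<bullet> ((perp' y \<bullet> x) *\<^sub>R perp m)" for c
    by (simp add: inner_diff_right)
  then show ?thesis by (metis vector_eq_ldot)
qed

lemma orthogonal_multiple: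
  assumes "m \<noteq> 0" "m \<bullet> x = 0" shows "\<exists>t. x = t *\<^sub>R perp m"
proof -
  have "(m \<bullet> m) *\<^sub>R x = (perp' m \<bullet> x) *\<^sub>R perp m" using plane_identity[of m m x] assms by simp
  then have "x = ((perp' m \<bullet> x) / (m \<bullet> m)) *\<^sub>R perp m" using assms
    by (metis divide_inverse_commute inner_eq_zero_iff left_inverse scaleR_one scaleR_scaleR)
  then show ?thesis by blast
qed

lemma orthogonal_primitive:
  assumes "primitive M m" "primitive N x" "m \<bullet> x = 0" shows "x = perp m \<or> x = - perp m"
proof -
  obtain t where "x = t *\<^sub>R perp m" using orthogonal_multiple assms primitive_nz by metis
  then show ?thesis using primitive_parallel[OF perp_primitive[OF assms(1)] assms(2)] by force
qed

lemma orthogonal_multiple_of_primitive: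
  assumes "primitive M m" "primitive N d" "m \<bullet> d = 0" "m \<bullet> x = 0"
  obtains t where "x = t *\<^sub>R d"
proof -
  obtain s where "x = s *\<^sub>R perp m" using orthogonal_multiple assms primitive_nz by metis
  then show ?thesis using orthogonal_primitive[OF assms(1-3)] that[of s] that[of "-s"] by auto
qed

lemma dual_orthogonal_primitive:
  assumes "primitive M m" "primitive M n" "primitive N x" "m \<bullet> x = 0" "n \<bullet> x = 0"
  shows "n = m \<or> n = - m"
proof -
  have "x = perp m \<or> x = - perp m" "x = perp n \<or> x = - perp n"
    using orthogonal_primitive assms by auto
  then have "perp n = perp m \<or> perp n = - perp m" by auto
  then have "perp (n - m) = 0 \<or> perp (n + m) = 0" by (auto simp: perp_def inner_add_left inner_diff_left algebra_simps)
  moreover have "k = 0" if "perp k = 0" for k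
  proof -
    have "c1 \<bullet> perp k = 0" "c2 \<bullet> perp k = 0" using that by auto
    then have "k \<bullet> b1 = 0" "k \<bullet> b2 = 0"
      by (auto simp: perp_def inner_diff_right)
    then show ?thesis using expand_dual[of k] by simp
  qed
  ultimately have "n - m = 0 \<or> n + m = 0" by blast
  then show ?thesis by (auto simp: add_eq_0_iff2)
qed

text \<open>A lattice point of the segment differs from \<open>u\<close> by a real multiple of
  \<open>d\<close>, and primitivity of \<open>d\<close> makes the multiple integral.\<close>

lemma lattice_segment:
  assumes "u \<in> N" "primitive N d"
  shows "closed_segment u (u + of_nat w *\<^sub>R d) \<inter> N = (\<lambda>k. u + of_nat k *\<^sub>R d) ` {0..w}"
proof (intro equalityI subsetI)
  fix x assume "x \<in> closed_segment u (u + of_nat w *\<^sub>R d) \<inter> N"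
  then obtain s where s: "0 \<le> s" "s \<le> 1" "x = (1 - s) *\<^sub>R u + s *\<^sub>R (u + of_nat w *\<^sub>R d)" "x \<in> N"
    by (auto simp: closed_segment_def)
  then have x: "x = u + (s * w) *\<^sub>R d" by (simp add: algebra_simps)
  then have "(s * w) *\<^sub>R d \<in> N" using lattice_diff[OF s(4) assms(1)] by simp
  then have "s * w \<in> \<int>" using primitive_multiple_Ints assms(2) by blast
  then obtain i :: int where i: "s * w = of_int i" by (auto elim: Ints_cases)
  have "0 \<le> s * w" "s * w \<le> w" using s by (auto intro: mult_left_le_one_le)
  then have "0 \<le> i" "i \<le> int w" using i by auto
  then show "x \<in> (\<lambda>k. u + of_nat k *\<^sub>R d) ` {0..w}"
    using x i by (intro image_eqI[of _ _ "nat i"]) auto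
next
  fix x assume "x \<in> (\<lambda>k. u + of_nat k *\<^sub>R d) ` {0..w}"
  then obtain k where k: "k \<le> w" "x = u + of_nat k *\<^sub>R d" by auto
  have "x \<in> closed_segment u (u + of_nat w *\<^sub>R d)"
  proof (cases "w = 0")
    case False
    then show ?thesis using k unfolding closed_segment_def
      by (auto intro!: exI[of _ "of_nat k / of_nat w"] simp: algebra_simps)
  qed (use k in auto)
  moreover have "x \<in> N" using k assms primitive_in(1) by (auto intro!: lattice_add lattice_scale)
  ultimately show "x \<in> closed_segment u (u + of_nat w *\<^sub>R d) \<inter> N" by simp
qed

lemma card_lattice_segment:
  assumes "u \<in> N" "primitive N d"
  shows "int (card (closed_segment u (u + of_nat w *\<^sub>R d) \<inter> N)) - 1 = int w"
proof -
  have "inj_on (\<lambda>k. u + of_nat k *\<^sub>R d) {0..w}"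
    using primitive_nz(1)[OF assms(2)] by (auto simp: inj_on_def)
  then show ?thesis by (simp add: lattice_segment[OF assms] card_image)
qed

text \<open>Since \<open>n \<bullet> d = 0\<close>, the shear x |-> x + k (n.x) d is unimodular, and
  its inverse transpose moves the certificate \<open>c\<close> to \<open>?c\<close>. Serves for the
  break points of a refinement, for the vertices of the mutated polygon and, dually, for
  \<open>tilt\<close>.\<close>

lemma primitive_shift:
  assumes "primitive N u" "d \<in> N" "n \<in> M" "n \<bullet> d = 0" "k \<in> \<int>"
  shows "primitive N (u + (k * (n \<bullet> u)) *\<^sub>R d)"
proof -
  obtain c where c: "c \<in> M" "c \<bullet> u = 1" using assms by (auto simp: primitive_iff)
  have u: "u \<in> N" using assms primitive_in by blast
  let ?c = "c - (k * (c \<bullet> d)) *\<^sub>R n"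
  have "?c \<in> M" using assms c inner_Ints by (auto intro!: dual_diff dual_scale)
  moreover have "?c \<bullet> (u + (k * (n \<bullet> u)) *\<^sub>R d) = 1"
    using c assms by (simp add: inner_add_right inner_diff_left algebra_simps)
  moreover have "u + (k * (n \<bullet> u)) *\<^sub>R d \<in> N"
    using assms u inner_Ints by (auto intro!: lattice_add lattice_scale)
  ultimately show ?thesis unfolding primitive_iff by blast
qed

end

section \<open>Cones and their standard refinements\<close>

text \<open>The number of cones of width \<open>w\<close> in a standard refinement of a cone of
  width \<open>W\<close> and local index \<open>l\<close>; the guard \<open>0 < w\<close> discards a
  zero residue.\<close>

definition width_multiplicity :: "int \<Rightarrow> int \<Rightarrow> int \<Rightarrow> nat" where
  "width_multiplicity W l w = (if w = l then nat (W div l) else if 0 < w \<and> w = W mod l then 1 else 0)"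

text \<open>Removing \<open>l\<close> lowers the quotient by one and keeps the residue. This is why
  mutation exchanges a single vertex of the quiver.\<close>

lemma width_multiplicity_diff:
  fixes W l w :: int
  assumes "0 < l" "l \<le> W"
  shows "width_multiplicity W l w = width_multiplicity (W - l) l w + (if w = l then 1 else 0)"
proof -
  have "W div l = (W - l) div l + 1" "W mod l = (W - l) mod l"
    by (rule div_pos_geq[OF assms], rule mod_pos_geq[OF assms])
  moreover have "0 \<le> (W - l) div l" using assms by (simp add: pos_imp_zdiv_nonneg_iff)
  ultimately show ?thesis by (simp add: width_multiplicity_def nat_add_distrib)
qed

lemma convex_cone_hull_2: "convex_cone hull {u, v} = {a *\<^sub>R u + b *\<^sub>R v | a b. 0 \<le> a \<and> 0 \<le> b}"
proof
  have "convex_cone {a *\<^sub>R u + b *\<^sub>R v | a b. 0 \<le> a \<and> 0 \<le> b}"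
    unfolding convex_cone_iff
  proof (intro conjI ballI allI impI)
    show "0 \<in> {a *\<^sub>R u + b *\<^sub>R v | a b. 0 \<le> a \<and> 0 \<le> b}" by (auto intro!: exI[of _ 0])
  next
    fix x y assume "x \<in> {a *\<^sub>R u + b *\<^sub>R v | a b. 0 \<le> a \<and> 0 \<le> b}" "y \<in> {a *\<^sub>R u + b *\<^sub>R v | a b. 0 \<le> a \<and> 0 \<le> b}"
    then obtain a b a' b' where "x = a *\<^sub>R u + b *\<^sub>R v" "y = a' *\<^sub>R u + b' *\<^sub>R v" "0 \<le> a" "0 \<le> b" "0 \<le> a'" "0 \<le> b'"
      by auto
    then have "x + y = (a + a') *\<^sub>R u + (b + b') *\<^sub>R v" "0 \<le> a + a'" "0 \<le> b + b'"
      by (auto simp: algebra_simps)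
    then show "x + y \<in> {a *\<^sub>R u + b *\<^sub>R v | a b. 0 \<le> a \<and> 0 \<le> b}" by blast
  next
    fix x and c :: real assume "x \<in> {a *\<^sub>R u + b *\<^sub>R v | a b. 0 \<le> a \<and> 0 \<le> b}" "0 \<le> c"
    then obtain a b where "x = a *\<^sub>R u + b *\<^sub>R v" "0 \<le> a" "0 \<le> b" by auto
    then have "c *\<^sub>R x = (c * a) *\<^sub>R u + (c * b) *\<^sub>R v" "0 \<le> c * a" "0 \<le> c * b"
      using \<open>0 \<le> c\<close> by (auto simp: algebra_simps)
    then show "c *\<^sub>R x \<in> {a *\<^sub>R u + b *\<^sub>R v | a b. 0 \<le> a \<and> 0 \<le> b}" by blast
  qed
  moreover have "{u, v} \<subseteq> {a *\<^sub>R u + b *\<^sub>R v | a b. 0 \<le> a \<and> 0 \<le> b}"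
  proof -
    have "u = 1 *\<^sub>R u + 0 *\<^sub>R v" "v = 0 *\<^sub>R u + 1 *\<^sub>R v" by simp_all
    then show ?thesis using zero_le_one by blast
  qed
  ultimately show "convex_cone hull {u, v} \<subseteq> {a *\<^sub>R u + b *\<^sub>R v | a b. 0 \<le> a \<and> 0 \<le> b}"
    by (simp add: hull_minimal)
  show "{a *\<^sub>R u + b *\<^sub>R v | a b. 0 \<le> a \<and> 0 \<le> b} \<subseteq> convex_cone hull {u, v}"
    by clarify (intro convex_cone_hull_add convex_cone_hull_mul hull_inc; simp)
qed

lemma independent_pair_coeffs:
  fixes u v :: "'a::real_vector"
  assumes "independent {u, v}" "u \<noteq> v" "a *\<^sub>R u + b *\<^sub>R v = a' *\<^sub>R u + b' *\<^sub>R v"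
  shows "a = a' \<and> b = b'"
proof (rule ccontr)
  assume "\<not> ?thesis"
  moreover have "(a - a') *\<^sub>R u + (b - b') *\<^sub>R v = 0" using assms(3) by (simp add: algebra_simps)
  ultimately have "dependent {u, v}"
    using assms(2) by (subst dependent_finite) (auto intro!: exI[of _ "\<lambda>x. if x = u then a - a' else b - b'"])
  then show False using assms(1) by blast
qed

lemma independent_pair_of_level:
  fixes p q n :: "'a::real_inner"
  assumes "p \<noteq> q" "n \<bullet> p = n \<bullet> q" "n \<bullet> p \<noteq> 0"
  shows "independent {p, q}"
proof -
  have "p \<notin> span {q}"
  proof
    assume "p \<in> span {q}"
    then obtain k where k: "p = k *\<^sub>R q" by (auto simp: span_singleton)
    then have "k = 1" using assms by simp
    then show False using k assms by simp
  qed
  moreover have "q \<noteq> 0" using assms by auto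
  ultimately show ?thesis by (simp add: independent_insert)
qed

lemma closed_segment_on_line:
  fixes u d :: "'a::real_vector"
  assumes "a \<le> b"
  shows "closed_segment (u + a *\<^sub>R d) (u + b *\<^sub>R d) = {u + r *\<^sub>R d | r. a \<le> r \<and> r \<le> b}"
proof (intro equalityI subsetI)
  fix x assume "x \<in> closed_segment (u + a *\<^sub>R d) (u + b *\<^sub>R d)"
  then obtain s where s: "0 \<le> s" "s \<le> 1" "x = (1 - s) *\<^sub>R (u + a *\<^sub>R d) + s *\<^sub>R (u + b *\<^sub>R d)"
    by (auto simp: closed_segment_def)
  then have "x = u + (a + s * (b - a)) *\<^sub>R d" by (simp add: algebra_simps)
  moreover have "0 \<le> s * (b - a)" "s * (b - a) \<le> b - a"
    using s assms by (auto intro: mult_left_le_one_le)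
  ultimately show "x \<in> {u + r *\<^sub>R d | r. a \<le> r \<and> r \<le> b}"
    by (auto intro!: exI[of _ "a + s * (b - a)"])
next
  fix x assume "x \<in> {u + r *\<^sub>R d | r. a \<le> r \<and> r \<le> b}"
  then obtain r where r: "x = u + r *\<^sub>R d" "a \<le> r" "r \<le> b" by auto
  show "x \<in> closed_segment (u + a *\<^sub>R d) (u + b *\<^sub>R d)"
  proof (cases "a = b")
    case False
    define s where "s = (r - a) / (b - a)"
    have s: "0 \<le> s" "s \<le> 1" "r = a + s * (b - a)" using r assms False by (auto simp: s_def field_simps)
    have "x = (1 - s) *\<^sub>R (u + a *\<^sub>R d) + s *\<^sub>R (u + b *\<^sub>R d)" unfolding r(1) s(3) by (simp add: algebra_simps)
    then show ?thesis using s by (auto simp: closed_segment_def)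
  qed (use r in auto)
qed

text \<open>In the coordinates (s, r), cones over consecutive pieces of a line become consecutive
  intervals of r.\<close>

lemma cone_hull_on_line:
  assumes "a \<le> b"
  shows "convex_cone hull {u + a *\<^sub>R d, u + b *\<^sub>R d} = {s *\<^sub>R (u + r *\<^sub>R d) | s r. 0 \<le> s \<and> a \<le> r \<and> r \<le> b}"
  by (subst convex_cone_hull_convex_hull_nonempty)
     (auto simp: segment_convex_hull[symmetric] closed_segment_on_line[OF assms])

section \<open>Invariants of a single cone and the counts in its standard refinements\<close>

context planar_lattice
begin

text \<open>The generating rays are extreme: expanding \<open>u\<close> in \<open>u'\<close>,
  \<open>v'\<close> and these in \<open>u\<close>, \<open>v\<close> leaves no
  \<open>v\<close>-component, and as all coefficients are nonnegative, \<open>u'\<close> or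
  \<open>v'\<close> is a positive multiple of \<open>u\<close>.\<close>

lemma cone_gens_mem:
  assumes "cone_gens N \<sigma> u v" "cone_gens N \<sigma> u' v'" shows "u \<in> {u', v'}"
proof -
  have \<sigma>: "\<sigma> = convex_cone hull {u, v}" "\<sigma> = convex_cone hull {u', v'}" and ind: "independent {u, v}" "u \<noteq> v"
    and prim: "primitive N u" "primitive N u'" "primitive N v'"
    using assms by (auto simp: cone_gens_def)
  have "u \<in> convex_cone hull {u, v}" "u' \<in> convex_cone hull {u', v'}" "v' \<in> convex_cone hull {u', v'}"
    by (simp_all add: hull_inc)
  then have "u \<in> convex_cone hull {u', v'}" "u' \<in> convex_cone hull {u, v}" "v' \<in> convex_cone hull {u, v}"
    using \<sigma> by simp_all
  then obtain a b p q r s where e: "u = a *\<^sub>R u' + b *\<^sub>R v'" "u' = p *\<^sub>R u + q *\<^sub>R v" "v' = r *\<^sub>R u + s *\<^sub>R v"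
    and nn: "0 \<le> a" "0 \<le> b" "0 \<le> p" "0 \<le> q" "0 \<le> r" "0 \<le> s"
    unfolding convex_cone_hull_2 by blast
  have "(a * p + b * r) *\<^sub>R u + (a * q + b * s) *\<^sub>R v = a *\<^sub>R (p *\<^sub>R u + q *\<^sub>R v) + b *\<^sub>R (r *\<^sub>R u + s *\<^sub>R v)"
    by (simp add: algebra_simps)
  also have "\<dots> = 1 *\<^sub>R u + 0 *\<^sub>R v" using e by simp
  finally have "a * p + b * r = 1 \<and> a * q + b * s = 0" by (rule independent_pair_coeffs[OF ind])
  then have ab: "a * p + b * r = 1" "a * q = 0" "b * s = 0" using nn
    by (auto simp: add_nonneg_eq_0_iff)
  consider "a > 0" | "b > 0" using ab(1) nn by (cases "a = 0"; cases "b = 0") auto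
  then show ?thesis
  proof cases
    case 1
    then have "u' = p *\<^sub>R u" using e ab by simp
    then show ?thesis using primitive_parallel[OF prim(1,2)] nn by force
  next
    case 2
    then have "v' = r *\<^sub>R u" using e ab by simp
    then show ?thesis using primitive_parallel[OF prim(1,3)] nn by force
  qed
qed

lemma cone_gens_swap: "cone_gens N \<sigma> u v \<Longrightarrow> cone_gens N \<sigma> v u"
  by (auto simp: cone_gens_def insert_commute)

lemma cone_gens_unique:
  assumes "cone_gens N \<sigma> u v" "cone_gens N \<sigma> u' v'" shows "{u', v'} = {u, v}"
  using cone_gens_mem[OF assms] cone_gens_mem[OF cone_gens_swap[OF assms(1)] assms(2)] assms
  by (auto simp: cone_gens_def)

text \<open>Both functionals kill the direction of \<open>u - v\<close>, so primitivity makes them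
  equal up to sign, and the negative level fixes the sign.\<close>

lemma normal_unique:
  assumes "primitive M m" "primitive M n" "u \<in> N" "v \<in> N" "u \<noteq> v"
    "m \<bullet> u = m \<bullet> v" "m \<bullet> u < 0" "n \<bullet> u = n \<bullet> v" "n \<bullet> u < 0"
  shows "m = n"
proof -
  obtain d w where d: "primitive N d" "w > 0" "u - v = of_nat w *\<^sub>R d"
    using lattice_multiple_primitive[of "u - v"] lattice_diff assms by (metis right_minus_eq)
  have "m \<bullet> (u - v) = 0" "n \<bullet> (u - v) = 0" using assms by (simp_all add: inner_diff_right)
  then have "m \<bullet> d = 0" "n \<bullet> d = 0" using d by auto
  then have "n = m \<or> n = - m" using dual_orthogonal_primitive assms d by blast
  then show ?thesis using assms by auto
qed

lemma normal_exists:
  assumes "u \<in> N" "v \<in> N" "u \<noteq> v" "independent {u, v}"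
  obtains n where "primitive M n" "n \<bullet> u = n \<bullet> v" "n \<bullet> u < 0"
proof -
  obtain d w where d: "primitive N d" "w > 0" "u - v = of_nat w *\<^sub>R d"
    using lattice_multiple_primitive[of "u - v"] lattice_diff assms by (metis right_minus_eq)
  define n where "n = perp' d"
  have n: "primitive M n" using perp'_primitive d n_def by simp
  have "n \<bullet> d = 0" by (simp add: n_def)
  then have "n \<bullet> (u - v) = 0" by (simp add: d)
  then have nuv: "n \<bullet> u = n \<bullet> v" by (simp add: inner_diff_right)
  \<comment> \<open>Otherwise \<open>u\<close> and \<open>v\<close> would both be multiples of
    \<open>d\<close>.\<close>
  have "n \<bullet> u \<noteq> 0"
  proof
    assume "n \<bullet> u = 0"
    obtain s where s: "u = s *\<^sub>R d" using orthogonal_multiple_of_primitive[OF n d(1) \<open>n \<bullet> d = 0\<close> \<open>n \<bullet> u = 0\<close>] .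
    have v: "v = (s - of_nat w) *\<^sub>R d" using d(3) s by (simp add: algebra_simps)
    have "(s - of_nat w) *\<^sub>R u + (- s) *\<^sub>R v = 0 *\<^sub>R u + 0 *\<^sub>R v" unfolding s v by (simp add: algebra_simps)
    then have "s - of_nat w = 0 \<and> - s = 0" by (rule independent_pair_coeffs[OF assms(4,3)])
    then show False using d(2) by simp
  qed
  then consider "n \<bullet> u < 0" | "- n \<bullet> u < 0" by force
  then show ?thesis
  proof cases
    case 1 then show ?thesis using that n nuv by blast
  next
    case 2 then show ?thesis using that[of "-n"] dual_primitive_minus[OF n] nuv by simp
  qed
qed

text \<open>Evaluates the three definite descriptions from any one pair of generators;
  \<open>cone_gens_unique\<close> makes every other pair agree with it up to order.\<close>

lemma cone_invariants:
  assumes "cone_gens N \<sigma> u v" "primitive M n" "n \<bullet> u = - of_int l" "n \<bullet> v = - of_int l" "l > 0"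
  shows inner_normal_eq: "inner_normal N \<sigma> = n"
    and local_index_eq: "local_index N \<sigma> = l"
    and width_eq: "width N \<sigma> = int (card (closed_segment u v \<inter> N)) - 1"
proof -
  have uv: "u \<in> N" "v \<in> N" "u \<noteq> v" using assms(1) by (auto simp: cone_gens_def primitive_in)
  show n: "inner_normal N \<sigma> = n" unfolding inner_normal_def
  proof (rule the_equality)
    show "primitive M n \<and> (\<exists>u v. cone_gens N \<sigma> u v \<and> n \<bullet> u = n \<bullet> v \<and> n \<bullet> u < 0)"
      using assms by force
  next
    fix m assume m: "primitive M m \<and> (\<exists>u v. cone_gens N \<sigma> u v \<and> m \<bullet> u = m \<bullet> v \<and> m \<bullet> u < 0)"
    then obtain u' v' where g: "cone_gens N \<sigma> u' v'" "m \<bullet> u' = m \<bullet> v'" "m \<bullet> u' < 0" by blast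
    then have "{u', v'} = {u, v}" using cone_gens_unique assms(1) by blast
    then have "m \<bullet> u = m \<bullet> v" "m \<bullet> u < 0" using g by (auto simp: doubleton_eq_iff)
    then show "m = n" using normal_unique[of m n u v] m assms uv by auto
  qed
  show "local_index N \<sigma> = l" unfolding local_index_def n
  proof (rule the_equality)
    show "\<exists>u v. cone_gens N \<sigma> u v \<and> of_int l = - (n \<bullet> u)" using assms by force
  next
    fix k assume "\<exists>u v. cone_gens N \<sigma> u v \<and> of_int k = - (n \<bullet> u)"
    then obtain u' v' where g: "cone_gens N \<sigma> u' v'" "of_int k = - (n \<bullet> u')" by blast
    then have "{u', v'} = {u, v}" using cone_gens_unique assms(1) by blast
    then have "n \<bullet> u' = - of_int l" using assms by (auto simp: doubleton_eq_iff)
    then show "k = l" using g by simp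
  qed
  show "width N \<sigma> = int (card (closed_segment u v \<inter> N)) - 1" unfolding width_def
  proof (rule the_equality)
    show "\<exists>p q. cone_gens N \<sigma> p q \<and> int (card (closed_segment u v \<inter> N)) - 1 = int (card (convex hull {p, q} \<inter> N)) - 1"
      using assms by (auto simp: segment_convex_hull)
  next
    fix w assume "\<exists>p q. cone_gens N \<sigma> p q \<and> w = int (card (convex hull {p, q} \<inter> N)) - 1"
    then obtain p q where "cone_gens N \<sigma> p q" "w = int (card (convex hull {p, q} \<inter> N)) - 1" by blast
    then show "w = int (card (closed_segment u v \<inter> N)) - 1"
      using cone_gens_unique[OF assms(1)] by (metis segment_convex_hull)
  qed
qed

lemma cone_on_line:
  fixes j k :: nat
  assumes n: "primitive M n" and d: "primitive N d" "n \<bullet> d = 0" and u: "n \<bullet> u = - of_int l" "l > 0"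
    and p: "primitive N (u + of_nat j *\<^sub>R d)" "primitive N (u + of_nat k *\<^sub>R d)" and "j < k"
    and \<tau>: "\<tau> = convex_cone hull {u + of_nat j *\<^sub>R d, u + of_nat k *\<^sub>R d}"
  shows "cone_gens N \<tau> (u + of_nat j *\<^sub>R d) (u + of_nat k *\<^sub>R d)"
    "inner_normal N \<tau> = n" "local_index N \<tau> = l" "width N \<tau> = int (k - j)"
proof -
  let ?p = "u + of_nat j *\<^sub>R d" and ?q = "u + of_nat k *\<^sub>R d"
  have nn: "n \<bullet> ?p = - of_int l" "n \<bullet> ?q = - of_int l" using d u by (simp_all add: inner_add_right)
  have ne: "?p \<noteq> ?q" using primitive_nz(1)[OF d(1)] \<open>j < k\<close> by simp
  then show g: "cone_gens N \<tau> ?p ?q"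
    unfolding cone_gens_def using p \<tau> independent_pair_of_level[OF ne, of n] nn u by simp
  show "inner_normal N \<tau> = n" "local_index N \<tau> = l"
    using cone_invariants[OF g n nn u(2)] by auto
  have "?q = ?p + of_nat (k - j) *\<^sub>R d" using \<open>j < k\<close> by (simp add: of_nat_diff algebra_simps)
  then show "width N \<tau> = int (k - j)"
    using width_eq[OF g n nn u(2)] card_lattice_segment[OF primitive_in(1)[OF p(1)] d(1), of "k - j"] by metis
qed

lemma chain_interval:
  fixes t :: "nat \<Rightarrow> real"
  assumes "t 0 \<le> r" "r \<le> t K" "0 < K" shows "\<exists>k<K. t k \<le> r \<and> r \<le> t (Suc k)"
  using assms
proof (induction K)
  case (Suc K)
  show ?case
  proof (cases "r \<le> t K \<and> 0 < K")
    case True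
    then show ?thesis using Suc by (meson less_SucI)
  next
    case False
    then show ?thesis using Suc.prems by (cases "K = 0") (auto intro!: exI[of _ K])
  qed
qed simp

lemma cone_interiors_disjoint:
  fixes a b a' b' :: real
  assumes d: "primitive N d" "n \<bullet> d = 0" "n \<bullet> u \<noteq> 0" and "a \<le> b" "b \<le> a'" "a' \<le> b'"
  shows "interior (convex_cone hull {u + a *\<^sub>R d, u + b *\<^sub>R d}) \<inter>
    interior (convex_cone hull {u + a' *\<^sub>R d, u + b' *\<^sub>R d}) = {}"
proof -
  obtain c where c: "c \<bullet> d = 1" using d by (auto simp: primitive_iff)
  \<comment> \<open>\<open>c\<close> reads off the parameter r on the line u + r d; the multiple of
    \<open>n\<close> adjusts the constant so that \<open>g\<close> equals r - b there. The zero line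
    of \<open>g\<close> is the ray that separates the two cones.\<close>
  define g where "g = c - ((c \<bullet> u + b) / (n \<bullet> u)) *\<^sub>R n"
  have g: "g \<bullet> (s *\<^sub>R (u + r *\<^sub>R d)) = s * (r - b)" for s r
    using d by (simp add: g_def inner_diff_left inner_add_right c)
  have "g \<bullet> d = 1" using d c by (simp add: g_def inner_diff_left)
  then have "g \<noteq> 0" by auto
  have "convex_cone hull {u + a *\<^sub>R d, u + b *\<^sub>R d} \<subseteq> {x. g \<bullet> x \<le> 0}"
    unfolding cone_hull_on_line[OF assms(4)] using g by (auto simp: mult_nonneg_nonpos simp del: inner_scaleR_right)
  then have 1: "interior (convex_cone hull {u + a *\<^sub>R d, u + b *\<^sub>R d}) \<subseteq> {x. g \<bullet> x < 0}"
    using interior_mono interior_halfspace_le[OF \<open>g \<noteq> 0\<close>] by metis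
  have "convex_cone hull {u + a' *\<^sub>R d, u + b' *\<^sub>R d} \<subseteq> {x. g \<bullet> x \<ge> 0}"
    unfolding cone_hull_on_line[OF assms(6)] using assms g by (auto simp del: inner_scaleR_right)
  then have 2: "interior (convex_cone hull {u + a' *\<^sub>R d, u + b' *\<^sub>R d}) \<subseteq> {x. g \<bullet> x > 0}"
    using interior_mono interior_halfspace_ge[OF \<open>g \<noteq> 0\<close>] by metis
  show ?thesis using 1 2 by force
qed

text \<open>The segment is cut at the multiples of \<open>l\<close> counted from \<open>u\<close>,
  so that a possible R-cone comes last, next to \<open>v\<close>.\<close>

lemma standard_refinement_of_cone_exists:
  assumes g: "cone_gens N \<sigma> u v" and n: "primitive M n" and nuv: "n \<bullet> u = - of_int l" "n \<bullet> v = - of_int l" and l: "l > 0"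
  shows "\<exists>S. standard_refinement_of_cone N \<sigma> S"
proof -
  have u: "primitive N u" and v: "primitive N v" and "u \<noteq> v" and \<sigma>: "\<sigma> = convex_cone hull {u, v}"
    using g by (auto simp: cone_gens_def)
  obtain d W where d: "primitive N d" "W > 0" "v - u = of_nat W *\<^sub>R d"
    using lattice_multiple_primitive[of "v - u"] lattice_diff \<open>u \<noteq> v\<close> u v primitive_in by (metis right_minus_eq)
  have "n \<bullet> (v - u) = 0" using nuv by (simp add: inner_diff_right)
  then have nd: "n \<bullet> d = 0" using d by auto
  have vW: "v = u + of_nat W *\<^sub>R d" using d(3) by (simp add: algebra_simps)
  define L where "L = nat l"
  have L: "L > 0" "l = int L" using l by (auto simp: L_def)
  define \<alpha> \<rho> where "\<alpha> = W div L" and "\<rho> = W mod L"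
  have W: "W = \<alpha> * L + \<rho>" "\<rho> < L" using L by (auto simp: \<alpha>_def \<rho>_def)
  define K where "K = \<alpha> + (if \<rho> > 0 then 1 else 0)"
  have K: "K > 0" using W d(2) by (cases "\<alpha> = 0") (auto simp: K_def)
  \<comment> \<open>Position of the k-th break point in units of \<open>d\<close>. The last one is
    set to \<open>W\<close> separately, because the last step has length \<rho> when \<rho> is
    positive.\<close>
  define t where "t k = (if k < K then k * L else W)" for k
  have t0: "t 0 = 0" "t K = W" using K by (auto simp: t_def)
  have small: "k \<le> \<alpha>" if "k < K" for k using that by (auto simp: K_def split: if_splits)
  have t\<alpha>: "t k = k * L" if "k \<le> \<alpha>" for k
    using that W by (auto simp: t_def K_def split: if_splits)
  have step: "t (Suc k) = t k + (if k < \<alpha> then L else \<rho>)" if "k < K" for k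
  proof (cases "k < \<alpha>")
    case True then show ?thesis using t\<alpha>[of k] t\<alpha>[of "Suc k"] by simp
  next
    case False
    then have "k = \<alpha>" "\<rho> > 0" "K = Suc \<alpha>" using small[OF that] that by (auto simp: K_def split: if_splits)
    then show ?thesis using W by (simp add: t_def)
  qed
  have \<rho>0: "\<rho> > 0" if "k < K" "\<not> k < \<alpha>" for k using that by (auto simp: K_def split: if_splits)
  have stepless: "t k < t (Suc k)" if "k < K" for k using step[OF that] L \<rho>0[OF that] by auto
  have mono: "t j < t k" if "j < k" "k \<le> K" for j k
    using that
  proof (induction k)
    case (Suc k)
    then show ?case using stepless[of k] by (cases "j = k") auto
  qed simp
  define p where "p k = u + of_nat (t k) *\<^sub>R d" for k
  have p0: "p 0 = u" "p K = v" by (auto simp: p_def t0 vW)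
  have prim: "primitive N (p k)" if "k \<le> K" for k
  proof (cases "k = K")
    case False
    \<comment> \<open>As \<open>l\<close> is the negative of \<open>n \<bullet> u\<close>, moving by
      k l along \<open>d\<close> is a unimodular shear of \<open>u\<close>; this is why cuts at
      multiples of the local index pass through primitive points.\<close>
    then have "p k = u + ((- of_nat k) * (n \<bullet> u)) *\<^sub>R d" using that by (simp add: p_def t_def nuv L(2))
    then show ?thesis using primitive_shift[OF u primitive_in(1)[OF d(1)] primitive_in(2)[OF n] nd, of "- of_nat k"] by simp
  qed (use p0 v in simp)
  have pin: "p k \<in> {u, v} \<union> {x \<in> open_segment u v. primitive N x}" if "k \<le> K" for k
  proof (cases "k = 0 \<or> k = K")
    case False
    then have "0 < t k" "t k < W" using mono[of 0 k] mono[of k K] t0 that by auto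
    then have "p k = (1 - of_nat (t k) / of_nat W) *\<^sub>R u + (of_nat (t k) / of_nat W) *\<^sub>R v"
      "0 < real (t k) / real W" "real (t k) / real W < 1"
      by (auto simp: p_def vW algebra_simps)
    then have "p k \<in> open_segment u v" using \<open>u \<noteq> v\<close> unfolding in_segment by blast
    then show ?thesis using prim[OF that] by blast
  qed (use p0 in auto)
  define \<tau> where "\<tau> k = convex_cone hull {p k, p (Suc k)}" for k
  have \<tau>: "cone_gens N (\<tau> k) (p k) (p (Suc k))" "inner_normal N (\<tau> k) = n" "local_index N (\<tau> k) = l"
     "width N (\<tau> k) = (if k < \<alpha> then l else int \<rho>)" if "k < K" for k
  proof -
    have "primitive N (p k)" "primitive N (p (Suc k))" using prim that by auto
    note c = cone_on_line[OF n d(1) nd nuv(1) l this[unfolded p_def] stepless[OF that] \<tau>_def[of k, unfolded p_def]]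
    show "cone_gens N (\<tau> k) (p k) (p (Suc k))" "inner_normal N (\<tau> k) = n" "local_index N (\<tau> k) = l"
      using c by (auto simp: p_def)
    show "width N (\<tau> k) = (if k < \<alpha> then l else int \<rho>)" using c(4) step[OF that] L by auto
  qed
  define S where "S = \<tau> ` {..<K}"
  have pinj: "p j = p k \<longleftrightarrow> j = k" if "j \<le> K" "k \<le> K" for j k
    using mono[of j k] mono[of k j] that primitive_nz(1)[OF d(1)] by (cases j k rule: linorder_cases) (auto simp: p_def)
  have inj: "inj_on \<tau> {..<K}"
  proof (rule inj_onI)
    fix j k assume jk: "j \<in> {..<K}" "k \<in> {..<K}" "\<tau> j = \<tau> k"
    then have "{p j, p (Suc j)} = {p k, p (Suc k)}" using cone_gens_unique \<tau>(1) by (metis lessThan_iff)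
    then show "j = k" using jk pinj by (auto simp: doubleton_eq_iff)
  qed
  have width\<sigma>: "width N \<sigma> = int W"
    using width_eq[OF g n nuv l] card_lattice_segment[OF primitive_in(1)[OF u] d(1), of W] vW by simp
  have index\<sigma>: "local_index N \<sigma> = l" using local_index_eq[OF g n nuv l] .
  have "standard_refinement_of_cone N \<sigma> S"
    unfolding standard_refinement_of_cone_def
  proof (intro conjI)
    have "\<forall>\<tau>'\<in>S. \<exists>p q. {p, q} \<subseteq> {u, v} \<union> {x \<in> open_segment u v. primitive N x} \<and> p \<noteq> q \<and> \<tau>' = convex_cone hull {p, q}"
    proof
      fix \<tau>' assume "\<tau>' \<in> S"
      then obtain k where k: "k < K" "\<tau>' = \<tau> k" by (auto simp: S_def)
      have "p k \<noteq> p (Suc k)" using k pinj by auto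
      then show "\<exists>p q. {p, q} \<subseteq> {u, v} \<union> {x \<in> open_segment u v. primitive N x} \<and> p \<noteq> q \<and> \<tau>' = convex_cone hull {p, q}"
        using pin[of k] pin[of "Suc k"] k by (intro exI[of _ "p k"] exI[of _ "p (Suc k)"]) (auto simp: \<tau>_def)
    qed
    then show "\<exists>u v. cone_gens N \<sigma> u v \<and> (\<forall>\<tau>\<in>S. \<exists>p q. {p, q} \<subseteq> {u, v} \<union> {x \<in> open_segment u v. primitive N x} \<and>
        p \<noteq> q \<and> \<tau> = convex_cone hull {p, q})" using g by blast
    show "finite S" by (simp add: S_def)
    have \<tau>_set: "\<tau> k = {s *\<^sub>R (u + r *\<^sub>R d) | s r. 0 \<le> s \<and> real (t k) \<le> r \<and> r \<le> real (t (Suc k))}" if "k < K" for k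
      unfolding \<tau>_def p_def using stepless[OF that] by (subst cone_hull_on_line) auto
    have \<sigma>_set: "\<sigma> = {s *\<^sub>R (u + r *\<^sub>R d) | s r. 0 \<le> s \<and> 0 \<le> r \<and> r \<le> real W}"
      using cone_hull_on_line[of 0 "real W" u d] by (simp add: \<sigma> vW)
    show "\<Union>S = \<sigma>"
    proof (intro equalityI subsetI)
      fix x assume "x \<in> \<Union>S"
      then obtain k where k: "k < K" "x \<in> \<tau> k" by (auto simp: S_def)
      then obtain s r where "x = s *\<^sub>R (u + r *\<^sub>R d)" "0 \<le> s" "real (t k) \<le> r" "r \<le> real (t (Suc k))"
        using \<tau>_set by auto
      moreover have "t (Suc k) \<le> W" using mono[of "Suc k" K] t0 k by (cases "Suc k = K") auto
      ultimately show "x \<in> \<sigma>" unfolding \<sigma>_set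
        by (intro CollectI exI[of _ s] exI[of _ r]) auto
    next
      fix x assume "x \<in> \<sigma>"
      then obtain s r where x: "x = s *\<^sub>R (u + r *\<^sub>R d)" "0 \<le> s" "0 \<le> r" "r \<le> real W" unfolding \<sigma>_set by auto
      obtain k where "k < K" "real (t k) \<le> r" "r \<le> real (t (Suc k))"
        using chain_interval[of "\<lambda>k. real (t k)" r K] x t0 K by auto
      then show "x \<in> \<Union>S" using x \<tau>_set by (force simp: S_def)
    qed
    have dis: "interior (\<tau> j) \<inter> interior (\<tau> k) = {}" if "j < k" "k < K" for j k
    proof -
      have "t (Suc j) \<le> t k" using mono[of "Suc j" k] that by (cases "Suc j = k") auto
      then show ?thesis unfolding \<tau>_def p_def
        using cone_interiors_disjoint[OF d(1) nd, of u "real (t j)" "real (t (Suc j))" "real (t k)" "real (t (Suc k))"]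
          stepless[of j] stepless[of k] that nuv l by simp
    qed
    show "pairwise (\<lambda>\<tau> \<tau>'. interior \<tau> \<inter> interior \<tau>' = {}) S"
      unfolding pairwise_def S_def
    proof (intro ballI impI)
      fix x y assume "x \<in> \<tau> ` {..<K}" "y \<in> \<tau> ` {..<K}" "x \<noteq> y"
      then obtain j k where "j < K" "k < K" "j \<noteq> k" "x = \<tau> j" "y = \<tau> k" by auto
      then show "interior x \<inter> interior y = {}" using dis[of j k] dis[of k j] by (cases j k rule: linorder_cases) auto
    qed
    have e1: "{\<tau>' \<in> S. width N \<tau>' = l \<and> local_index N \<tau>' = l} = \<tau> ` {..<\<alpha>}"
      using \<tau> L W by (auto simp: S_def K_def split: if_splits)
    have "{\<tau>' \<in> S. width N \<tau>' = int \<rho> \<and> local_index N \<tau>' = l} = \<tau> ` {k. k < K \<and> \<not> k < \<alpha>}"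
      using \<tau>(3,4) L W(2) by (auto simp: S_def)
    moreover have "{k. k < K \<and> \<not> k < \<alpha>} = (if \<rho> > 0 then {\<alpha>} else {})"
      by (auto simp: K_def)
    ultimately have e2: "{\<tau>' \<in> S. width N \<tau>' = int \<rho> \<and> local_index N \<tau>' = l} = (if \<rho> > 0 then \<tau> ` {\<alpha>} else {})"
      by simp
    have sub: "{..<\<alpha>} \<subseteq> {..<K}" by (auto simp: K_def)
    have "card (\<tau> ` {..<\<alpha>}) = \<alpha>" using card_image[OF inj_on_subset[OF inj sub]] by simp
    moreover have "card S = K" using card_image[OF inj] by (simp add: S_def)
    moreover have "int W div l = int \<alpha>" "int W mod l = int \<rho>" by (simp_all add: \<alpha>_def \<rho>_def L(2) zdiv_int zmod_int)
    ultimately show "let w = width N \<sigma>; l = local_index N \<sigma>; \<alpha> = w div l; \<rho> = w mod l in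
        int (card {\<tau> \<in> S. width N \<tau> = l \<and> local_index N \<tau> = l}) = \<alpha> \<and>
        card {\<tau> \<in> S. width N \<tau> = \<rho> \<and> local_index N \<tau> = l} = (if \<rho> > 0 then 1 else 0) \<and>
        int (card S) = \<alpha> + (if \<rho> > 0 then 1 else 0)"
      unfolding width\<sigma> index\<sigma> Let_def by (simp add: e1 e2) (simp add: K_def)
  qed
  then show ?thesis by blast
qed

text \<open>Holds for every standard refinement, not just the one constructed above, as is needed
  for the unspecified refinement inside \<open>quiv\<close>.\<close>

lemma standard_refinement_of_cone_types:
  assumes g: "cone_gens N \<sigma> u v" and n: "primitive M n" and nuv: "n \<bullet> u = - of_int l" "n \<bullet> v = - of_int l" and l: "l > 0"
    and S: "standard_refinement_of_cone N \<sigma> S"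
  shows "finite S"
    "\<And>\<tau>. \<tau> \<in> S \<Longrightarrow> inner_normal N \<tau> = n \<and> local_index N \<tau> = l \<and> 0 < width N \<tau> \<and> width N \<tau> \<le> l"
    "card {\<tau> \<in> S. width N \<tau> = w} = width_multiplicity (width N \<sigma>) l w"
    "(\<Sum>\<tau>\<in>S. width N \<tau>) = width N \<sigma>"
proof -
  obtain u' v' where g': "cone_gens N \<sigma> u' v'"
    and el: "\<forall>\<tau>\<in>S. \<exists>p q. {p, q} \<subseteq> {u', v'} \<union> {x \<in> open_segment u' v'. primitive N x} \<and> p \<noteq> q \<and> \<tau> = convex_cone hull {p, q}"
    and fin: "finite S"
    and let3: "let w = width N \<sigma>; l = local_index N \<sigma>; \<alpha> = w div l; \<rho> = w mod l in
        int (card {\<tau> \<in> S. width N \<tau> = l \<and> local_index N \<tau> = l}) = \<alpha> \<and>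
        card {\<tau> \<in> S. width N \<tau> = \<rho> \<and> local_index N \<tau> = l} = (if \<rho> > 0 then 1 else 0) \<and>
        int (card S) = \<alpha> + (if \<rho> > 0 then 1 else 0)"
    using S unfolding standard_refinement_of_cone_def by blast
  have "{u', v'} = {u, v}" using cone_gens_unique g g' by blast
  then have nuv': "n \<bullet> u' = - of_int l" "n \<bullet> v' = - of_int l" using nuv by (auto simp: doubleton_eq_iff)
  have index\<sigma>: "local_index N \<sigma> = l" using local_index_eq[OF g n nuv l] .
  show "finite S" by fact
  have types: "inner_normal N \<tau> = n \<and> local_index N \<tau> = l \<and> 0 < width N \<tau>" if \<tau>S: "\<tau> \<in> S" for \<tau>
  proof -
    obtain p q where pq: "{p, q} \<subseteq> {u', v'} \<union> {x \<in> open_segment u' v'. primitive N x}" "p \<noteq> q" "\<tau> = convex_cone hull {p, q}"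
      using bspec[OF el \<tau>S] by (elim exE conjE) (rule that; assumption)
    have lev: "primitive N x \<and> n \<bullet> x = - of_int l" if "x \<in> {u', v'} \<union> {x \<in> open_segment u' v'. primitive N x}" for x
      using that
    proof
      assume "x \<in> {u', v'}" then show ?thesis using g' nuv' by (auto simp: cone_gens_def)
    next
      assume "x \<in> {x \<in> open_segment u' v'. primitive N x}"
      then obtain s where s: "x = (1 - s) *\<^sub>R u' + s *\<^sub>R v'" "primitive N x" by (auto simp: in_segment)
      have "n \<bullet> x = (1 - s) * (n \<bullet> u') + s * (n \<bullet> v')" by (simp only: s(1) inner_add_right inner_scaleR_right)
      then show ?thesis using s(2) by (simp add: nuv' algebra_simps)
    qed
    then have p: "primitive N p" "n \<bullet> p = - of_int l" and q: "primitive N q" "n \<bullet> q = - of_int l" using pq by auto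
    then have g\<tau>: "cone_gens N \<tau> p q" unfolding cone_gens_def
      using pq(2,3) independent_pair_of_level[OF pq(2), of n] l by simp
    obtain d W where d: "primitive N d" "W > 0" "q - p = of_nat W *\<^sub>R d"
      using lattice_multiple_primitive[of "q - p"] lattice_diff pq(2) p q primitive_in by (metis right_minus_eq)
    have "q = p + of_nat W *\<^sub>R d" using d(3) by (simp add: algebra_simps)
    then have "width N \<tau> = int W"
      using width_eq[OF g\<tau> n p(2) q(2) l] card_lattice_segment[OF primitive_in(1)[OF p(1)] d(1), of W] by simp
    then show ?thesis using inner_normal_eq[OF g\<tau> n p(2) q(2) l] local_index_eq[OF g\<tau> n p(2) q(2) l] d(2) by simp
  qed
  define A where "A w = {\<tau> \<in> S. width N \<tau> = w}" for w
  define \<alpha> \<rho> where "\<alpha> = width N \<sigma> div l" and "\<rho> = width N \<sigma> mod l"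
  have eqA: "{\<tau> \<in> S. width N \<tau> = w \<and> local_index N \<tau> = l} = A w" for w using types by (auto simp: A_def)
  have c: "int (card (A l)) = \<alpha>" "card (A \<rho>) = (if \<rho> > 0 then 1 else 0)" "int (card S) = \<alpha> + (if \<rho> > 0 then 1 else 0)"
    using let3 unfolding Let_def index\<sigma> eqA \<alpha>_def[symmetric] \<rho>_def[symmetric] by auto
  have \<rho>: "\<rho> < l" "0 \<le> \<rho>" using l by (auto simp: \<rho>_def)
  have disj: "A l \<inter> A \<rho> = {}" using \<rho> by (auto simp: A_def)
  have finA: "finite (A w)" for w using fin by (simp add: A_def)
  have sub: "A l \<union> A \<rho> \<subseteq> S" by (auto simp: A_def)
  \<comment> \<open>The two disjoint families already account for all of \<open>card S\<close>, so
    no cone of a third width exists.\<close>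
  have "int (card (A l \<union> A \<rho>)) = int (card S)"
    using card_Un_disjoint[OF finA finA disj] c by simp
  then have SA: "S = A l \<union> A \<rho>" using card_subset_eq[OF fin sub] by simp
  have ws: "width N \<tau> = l \<or> width N \<tau> = \<rho>" if "\<tau> \<in> S" for \<tau>
  proof -
    have "\<tau> \<in> A l \<union> A \<rho>" using SA that by blast
    then show ?thesis by (auto simp: A_def)
  qed
  show "inner_normal N \<tau> = n \<and> local_index N \<tau> = l \<and> 0 < width N \<tau> \<and> width N \<tau> \<le> l" if "\<tau> \<in> S" for \<tau>
    using types[OF that] ws[OF that] \<rho> by auto
  have A0: "A w = {}" if "w \<noteq> l" "w \<noteq> \<rho>" for w using that ws by (auto simp: A_def)
  have A1: "A w = {}" if "w \<le> 0" for w using that types by (fastforce simp: A_def)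
  have "card (A w) = width_multiplicity (width N \<sigma>) l w"
    unfolding width_multiplicity_def \<alpha>_def[symmetric] \<rho>_def[symmetric]
    using c A0 A1[of w] by (auto)
  then show "card {\<tau> \<in> S. width N \<tau> = w} = width_multiplicity (width N \<sigma>) l w" by (simp add: A_def)
  have "(\<Sum>\<tau>\<in>S. width N \<tau>) = (\<Sum>\<tau>\<in>A l. width N \<tau>) + (\<Sum>\<tau>\<in>A \<rho>. width N \<tau>)"
    by (subst SA) (rule sum.union_disjoint[OF finA finA disj])
  also have "(\<Sum>\<tau>\<in>A l. width N \<tau>) = (\<Sum>\<tau>\<in>A l. l)" by (rule sum.cong) (auto simp: A_def)
  also have "(\<Sum>\<tau>\<in>A \<rho>. width N \<tau>) = (\<Sum>\<tau>\<in>A \<rho>. \<rho>)" by (rule sum.cong) (auto simp: A_def)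
  also have "(\<Sum>\<tau>\<in>A l. l) + (\<Sum>\<tau>\<in>A \<rho>. \<rho>) = \<alpha> * l + \<rho>" using c \<rho> by auto
  finally show "(\<Sum>\<tau>\<in>S. width N \<tau>) = width N \<sigma>" by (simp add: \<alpha>_def \<rho>_def)
qed

end

section \<open>Edges of a Fano polygon\<close>

text \<open>The support function taken with the minimum, to match inner normals; it is negative at
  nonzero functionals when the origin is interior.\<close>

definition support :: "(real^2) set \<Rightarrow> real^2 \<Rightarrow> real" where
  "support P n = Inf ((\<bullet>) n ` P)"

definition support_face :: "(real^2) set \<Rightarrow> real^2 \<Rightarrow> (real^2) set" where
  "support_face P n = {x \<in> P. n \<bullet> x = support P n}"

definition height :: "(real^2) set \<Rightarrow> real^2 \<Rightarrow> int" where
  "height P n = \<lfloor>- support P n\<rfloor>"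

text \<open>The lattice length of the face. It is 0 when the face is a lattice vertex, so formulas
  in \<open>n\<close> need no distinction between edge normals and other functionals.\<close>

definition edge_width :: "(real^2) set \<Rightarrow> (real^2) set \<Rightarrow> real^2 \<Rightarrow> int" where
  "edge_width N P n = int (card (support_face P n \<inter> N)) - 1"

definition edge_normals :: "(real^2) set \<Rightarrow> (real^2) set \<Rightarrow> (real^2) set" where
  "edge_normals N P = {n. primitive (dual_lattice N) n \<and> 0 < edge_width N P n}"

lemma support_eqI:
  assumes "x \<in> P" "\<And>y. y \<in> P \<Longrightarrow> n \<bullet> x \<le> n \<bullet> y"
  shows "support P n = n \<bullet> x"
  unfolding support_def using assms by (intro cInf_eq_minimum) auto

lemma support_attained:
  assumes "compact P" "P \<noteq> {}"
  obtains x where "x \<in> P" "n \<bullet> x = support P n" "\<And>y. y \<in> P \<Longrightarrow> support P n \<le> n \<bullet> y"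
proof -
  have "continuous_on P ((\<bullet>) n)" by (intro continuous_intros)
  then obtain x where x: "x \<in> P" "\<forall>y\<in>P. n \<bullet> x \<le> n \<bullet> y" using continuous_attains_inf[OF assms] by blast
  then show ?thesis using that[of x] support_eqI[of x P n] by auto
qed

text \<open>A face of the hull of a finite set is the hull of some of its points, and those must lie
  on the supporting line.\<close>

lemma support_face_convex_hull:
  assumes "finite V" "\<And>v. v \<in> V \<Longrightarrow> h \<le> n \<bullet> v" "\<exists>v\<in>V. n \<bullet> v = h"
  shows "support (convex hull V) n = h" "support_face (convex hull V) n = convex hull {v \<in> V. n \<bullet> v = h}"
proof -
  have ge: "h \<le> n \<bullet> x" if "x \<in> convex hull V" for x
  proof -
    have "convex hull V \<subseteq> {x. h \<le> n \<bullet> x}"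
      using assms(2) by (intro hull_minimal) (auto simp: convex_halfspace_ge)
    then show ?thesis using that by blast
  qed
  obtain v where "v \<in> V" "n \<bullet> v = h" using assms(3) by blast
  then show s: "support (convex hull V) n = h"
    using support_eqI[of v "convex hull V" n] ge by (auto intro: hull_inc)
  have "(convex hull V \<inter> {x. n \<bullet> x = h}) face_of (convex hull V)"
    using ge by (intro face_of_Int_supporting_hyperplane_ge) auto
  then have "support_face (convex hull V) n face_of (convex hull V)"
    unfolding support_face_def s by (simp add: Int_def)
  then obtain S where S: "S \<subseteq> V" "support_face (convex hull V) n = convex hull S"
    using face_of_convex_hull_subset[OF finite_imp_compact[OF assms(1)]] by metis
  have "S \<subseteq> {v \<in> V. n \<bullet> v = h}"
    using S hull_subset[of S convex] by (auto simp: support_face_def s)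
  then have "convex hull S \<subseteq> convex hull {v \<in> V. n \<bullet> v = h}" by (rule hull_mono)
  moreover have "convex hull {v \<in> V. n \<bullet> v = h} \<subseteq> support_face (convex hull V) n"
  proof (rule hull_minimal)
    show "{v \<in> V. n \<bullet> v = h} \<subseteq> support_face (convex hull V) n"
      by (auto simp: support_face_def s hull_inc)
    show "convex (support_face (convex hull V) n)" by (simp add: S)
  qed
  ultimately show "support_face (convex hull V) n = convex hull {v \<in> V. n \<bullet> v = h}" using S by blast
qed

lemma convex_cone_hull_of_convex_hull: "convex_cone hull (convex hull S) = convex_cone hull S"
  by (intro equalityI hull_minimal convex_cone_convex_cone_hull convex_hull_subset_convex_cone_hull
      subset_trans[OF hull_subset hull_subset] order_trans[OF hull_subset[of S convex] hull_subset])

context planar_lattice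
begin

lemma finite_bounded_lattice:
  assumes "bounded S" shows "finite (S \<inter> N)"
proof -
  obtain R where R: "\<And>x. x \<in> S \<Longrightarrow> norm x \<le> R" using assms by (auto simp: bounded_iff)
  define K where "K = \<lceil>(norm c1 + norm c2) * R\<rceil>"
  have bd: "\<bar>c \<bullet> x\<bar> \<le> of_int K" if "c \<in> {c1, c2}" "x \<in> S" for c x
  proof -
    have "\<bar>c \<bullet> x\<bar> \<le> norm c * norm x" by (rule Cauchy_Schwarz_ineq2)
    also have "\<dots> \<le> (norm c1 + norm c2) * R" using that R[of x] by (intro mult_mono) auto
    also have "\<dots> \<le> of_int K" unfolding K_def by (rule le_of_int_ceiling)
    finally show ?thesis .
  qed
  have "S \<inter> N \<subseteq> (\<lambda>(i, j). of_int i *\<^sub>R b1 + of_int j *\<^sub>R b2) ` ({-K..K} \<times> {-K..K})"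
  proof
    fix x assume x: "x \<in> S \<inter> N"
    then obtain i j where ij: "c1 \<bullet> x = of_int i" "c2 \<bullet> x = of_int j" by (auto simp: lattice_eq elim!: Ints_cases)
    have "\<bar>i\<bar> \<le> K" "\<bar>j\<bar> \<le> K" using bd[of c1 x] bd[of c2 x] x ij by auto
    moreover have "x = of_int i *\<^sub>R b1 + of_int j *\<^sub>R b2" using expand[of x] ij by simp
    ultimately show "x \<in> (\<lambda>(i, j). of_int i *\<^sub>R b1 + of_int j *\<^sub>R b2) ` ({-K..K} \<times> {-K..K})"
      by (intro image_eqI[of _ _ "(i, j)"]) auto
  qed
  then show ?thesis by (rule finite_subset) auto
qed

lemma dual_orthogonal_parallel:
  fixes y n a :: "real^2"
  assumes "y \<noteq> 0" "n \<bullet> y = 0" "a \<bullet> y = 0" "n \<noteq> 0" shows "\<exists>c. a = c *\<^sub>R n"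
proof -
  obtain s where s: "n = s *\<^sub>R perp' y"
    using planar_lattice.orthogonal_multiple[OF dual assms(1), of n] assms by (auto simp: inner_commute perp'_eq)
  obtain t where t: "a = t *\<^sub>R perp' y"
    using planar_lattice.orthogonal_multiple[OF dual assms(1), of a] assms by (auto simp: inner_commute perp'_eq)
  have "s \<noteq> 0" using s assms by auto
  then have "a = (t / s) *\<^sub>R n" using s t by simp
  then show ?thesis by blast
qed

lemma level_collinear:
  fixes n :: "real^2"
  assumes "n \<noteq> 0" "\<And>x. x \<in> S \<Longrightarrow> n \<bullet> x = h" shows "collinear S"
  unfolding collinear_def
proof (intro exI[of _ "perp n"] ballI)
  fix x y assume "x \<in> S" "y \<in> S"
  then have "n \<bullet> (x - y) = 0" using assms by (simp add: inner_diff_right)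
  then show "\<exists>c. x - y = c *\<^sub>R perp n" using orthogonal_multiple assms(1) by blast
qed

end

section \<open>Support data of a Fano polygon and the maximal cones of its spanning fan\<close>

locale fano = planar_lattice +
  fixes P :: "(real^2) set"
  assumes fano: "fano_polygon N P"
begin

lemma polytope_P: "polytope P"
  using fano by (auto simp: fano_polygon_def lattice_polytope_def polytope_def)

lemma zero_interior: "0 \<in> interior P" and zero_in: "0 \<in> P" and aff_dim_P: "aff_dim P = 2"
  using fano interior_subset by (auto simp: fano_polygon_def)

lemma P_facts: "compact P" "convex P" "polyhedron P" "P \<noteq> {}" "bounded P"
  using polytope_P zero_in polytope_imp_compact polytope_imp_convex polytope_imp_polyhedron polytope_imp_bounded by auto

lemma verts_facts: "v \<in> verts P \<Longrightarrow> v \<in> P" "v \<in> verts P \<Longrightarrow> primitive N v" "finite (verts P)" "P = convex hull (verts P)"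
  using fano Krein_Milman_Minkowski[OF P_facts(1,2)] finite_polyhedron_extreme_points[OF P_facts(3)]
  by (auto simp: fano_polygon_def verts_def extreme_point_of_def)

lemma support_le: "x \<in> P \<Longrightarrow> support P n \<le> n \<bullet> x"
  using support_attained[OF P_facts(1,4)] by metis

lemma support_vertex: obtains v where "v \<in> verts P" "n \<bullet> v = support P n"
proof -
  have ne: "verts P \<noteq> {}" using verts_facts(4) P_facts(4) by force
  then have "Min ((\<bullet>) n ` verts P) \<in> (\<bullet>) n ` verts P" using verts_facts(3) by simp
  then obtain v where v: "v \<in> verts P" "n \<bullet> v = Min ((\<bullet>) n ` verts P)" by auto
  then have "support (convex hull verts P) n = n \<bullet> v"
    using verts_facts(3) by (intro support_face_convex_hull(1)) auto
  then show ?thesis using that v verts_facts(4) by metis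
qed

lemma support_face_face_of: "support_face P n face_of P"
proof -
  have "(P \<inter> {x. n \<bullet> x = support P n}) face_of P"
    using support_le by (intro face_of_Int_supporting_hyperplane_ge P_facts) auto
  then show ?thesis by (simp add: support_face_def Int_def)
qed

lemma support_neg:
  assumes "n \<noteq> 0" shows "support P n < 0"
proof -
  obtain e where e: "e > 0" "ball 0 e \<subseteq> P" using zero_interior by (meson mem_interior)
  define x where "x = - (e / (2 * norm n)) *\<^sub>R n"
  have "norm x = e / 2" using assms e by (simp add: x_def)
  then have "x \<in> P" using e by auto
  moreover have "n \<bullet> x < 0" using assms e by (auto simp: x_def intro!: mult_pos_pos divide_pos_pos)
  ultimately show ?thesis using support_le[of x n] by linarith
qed

lemma height_eq: "n \<in> M \<Longrightarrow> of_int (height P n) = - support P n"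
proof -
  assume "n \<in> M"
  obtain v where "v \<in> verts P" "n \<bullet> v = support P n" using support_vertex .
  then have "support P n \<in> \<int>" using inner_Ints[OF \<open>n \<in> M\<close>] verts_facts(2) primitive_in by metis
  then have "- support P n \<in> \<int>" by simp
  then show ?thesis unfolding height_def by (metis Ints_cases floor_of_int)
qed

lemma height_pos: "n \<in> M \<Longrightarrow> n \<noteq> 0 \<Longrightarrow> 0 < height P n"
  using height_eq[of n] support_neg[of n] by linarith

lemma finite_face_lattice: "finite (support_face P n \<inter> N)"
  using finite_bounded_lattice[OF P_facts(5)] by (rule rev_finite_subset) (auto simp: support_face_def)

lemma edge_width_nonneg: "0 \<le> edge_width N P n"
proof -
  obtain v where "v \<in> verts P" "n \<bullet> v = support P n" using support_vertex .
  then have "v \<in> support_face P n \<inter> N" using verts_facts primitive_in by (auto simp: support_face_def)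
  then have "card (support_face P n \<inter> N) \<noteq> 0" using finite_face_lattice by auto
  then show ?thesis by (simp add: edge_width_def)
qed

lemma edge_segment:
  assumes "n \<in> edge_normals N P"
  obtains u v where "support_face P n = closed_segment u v" "u \<noteq> v" "u \<in> verts P" "v \<in> verts P"
    "n \<bullet> u = - of_int (height P n)" "n \<bullet> v = - of_int (height P n)"
    "cone_gens N (convex_cone hull (support_face P n)) u v"
proof -
  have n: "primitive M n" "0 < edge_width N P n" using assms by (auto simp: edge_normals_def)
  then have nM: "n \<in> M" "n \<noteq> 0" using primitive_in primitive_nz by auto
  have pol: "polytope (support_face P n)" using face_of_polytope_polytope[OF polytope_P support_face_face_of] .
  have ne: "support_face P n \<noteq> {}" using n by (auto simp: edge_width_def)
  have "collinear (support_face P n)"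
    by (rule level_collinear[OF nM(2), of _ "support P n"]) (simp add: support_face_def)
  then obtain u v where uv: "support_face P n = closed_segment u v"
    using compact_convex_collinear_segment[OF ne polytope_imp_compact[OF pol] polytope_imp_convex[OF pol]] by blast
  have "u \<noteq> v"
  proof
    assume "u = v"
    then have "support_face P n \<inter> N \<subseteq> {u}" using uv by auto
    then have "card (support_face P n \<inter> N) \<le> 1" using card_mono[of "{u}"] by simp
    then show False using n by (simp add: edge_width_def)
  qed
  have "u extreme_point_of support_face P n" "v extreme_point_of support_face P n"
    unfolding uv by (auto simp: extreme_point_of_segment)
  then have vs: "u \<in> verts P" "v \<in> verts P"
    using extreme_point_of_face[OF support_face_face_of] by (auto simp: verts_def)
  have "u \<in> support_face P n" "v \<in> support_face P n" using uv by auto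
  then have lev: "n \<bullet> u = - of_int (height P n)" "n \<bullet> v = - of_int (height P n)"
    using height_eq[OF nM(1)] by (auto simp: support_face_def)
  have "independent {u, v}"
    using independent_pair_of_level[OF \<open>u \<noteq> v\<close>, of n] lev height_pos[OF nM] by auto
  moreover have "convex_cone hull (support_face P n) = convex_cone hull {u, v}"
    unfolding uv segment_convex_hull by (rule convex_cone_hull_of_convex_hull)
  ultimately have "cone_gens N (convex_cone hull (support_face P n)) u v"
    unfolding cone_gens_def using vs verts_facts(2) \<open>u \<noteq> v\<close> by auto
  with that uv \<open>u \<noteq> v\<close> vs lev show ?thesis by blast
qed

lemma edge_cone_invariants:
  assumes "n \<in> edge_normals N P"
  shows "inner_normal N (convex_cone hull (support_face P n)) = n"
    "local_index N (convex_cone hull (support_face P n)) = height P n"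
    "width N (convex_cone hull (support_face P n)) = edge_width N P n"
proof -
  have n: "primitive M n" using assms by (auto simp: edge_normals_def)
  then have h: "0 < height P n" using height_pos primitive_in primitive_nz by auto
  obtain u v where uv: "support_face P n = closed_segment u v" "u \<noteq> v" "u \<in> verts P" "v \<in> verts P"
    "n \<bullet> u = - of_int (height P n)" "n \<bullet> v = - of_int (height P n)"
    "cone_gens N (convex_cone hull (support_face P n)) u v" using edge_segment[OF assms] .
  show "inner_normal N (convex_cone hull (support_face P n)) = n"
    "local_index N (convex_cone hull (support_face P n)) = height P n"
    "width N (convex_cone hull (support_face P n)) = edge_width N P n"
    using cone_invariants[OF uv(7) n uv(5,6) h] by (auto simp: edge_width_def uv(1))
qed

lemma facet_edge_normal:
  assumes "F facet_of P"
  obtains n where "n \<in> edge_normals N P" "F = support_face P n"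
proof -
  have F: "F face_of P" "F \<noteq> {}" "aff_dim F = 1" using assms aff_dim_P by (auto simp: facet_of_def)
  have pol: "polytope F" using face_of_polytope_polytope[OF polytope_P F(1)] .
  have "collinear F" using F(3) by (simp add: collinear_aff_dim)
  then obtain u v where uv: "F = closed_segment u v"
    using compact_convex_collinear_segment[OF F(2) polytope_imp_compact[OF pol] polytope_imp_convex[OF pol]] by blast
  have "u \<noteq> v" using F(3) uv by auto
  have "u extreme_point_of F" "v extreme_point_of F" unfolding uv by (auto simp: extreme_point_of_segment)
  then have "u \<in> verts P" "v \<in> verts P" using extreme_point_of_face[OF F(1)] by (auto simp: verts_def)
  then have uvN: "u \<in> N" "v \<in> N" using verts_facts(2) primitive_in by auto
  obtain a b where ab: "P \<subseteq> {x. a \<bullet> x \<le> b}" "F = P \<inter> {x. a \<bullet> x = b}"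
    using exposed_face_of_polyhedron[OF P_facts(3), of F] F(1) unfolding exposed_face_of_def by blast
  have "F \<noteq> P" using F(3) aff_dim_P by auto
  then have "a \<noteq> 0" using ab F(2) by (auto simp: Int_absorb2)
  then have "interior P \<subseteq> {x. a \<bullet> x < b}" using interior_mono[OF ab(1)] interior_halfspace_le by metis
  then have b: "0 < b" using zero_interior by auto
  have uF: "u \<in> F" "v \<in> F" using uv by auto
  then have auv: "a \<bullet> u = b" "a \<bullet> v = b" using ab by auto
  then have "independent {u, v}" using independent_pair_of_level[OF \<open>u \<noteq> v\<close>, of a] b by simp
  then obtain n where n: "primitive M n" "n \<bullet> u = n \<bullet> v" "n \<bullet> u < 0"
    using normal_exists[OF uvN \<open>u \<noteq> v\<close>] by blast
  \<comment> \<open>The exposing functional \<open>a\<close> is real and points outwards. Both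
    \<open>a\<close> and \<open>n\<close> vanish on \<open>u - v\<close>, hence are proportional,
    with a negative factor.\<close>
  obtain c where c: "a = c *\<^sub>R n"
    using dual_orthogonal_parallel[of "u - v" n a] \<open>u \<noteq> v\<close> n auv primitive_nz(2)[OF n(1)] by (auto simp: inner_diff_right)
  then have cn: "c * (n \<bullet> u) = b" using auv by simp
  then have "c < 0" using b n(3) by (metis mult_neg_neg mult_nonneg_nonpos not_less less_eq_real_def not_le)
  have ge: "n \<bullet> u \<le> n \<bullet> x" if "x \<in> P" for x
  proof -
    have "c * (n \<bullet> x) \<le> c * (n \<bullet> u)" using ab(1) that c cn by auto
    then show ?thesis using \<open>c < 0\<close> by simp
  qed
  have supp: "support P n = n \<bullet> u" using support_eqI[of u P n] ge uF ab by auto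
  have "F = support_face P n"
    using \<open>c < 0\<close> by (auto simp: ab(2) support_face_def supp c cn[symmetric])
  moreover have "card {u, v} \<le> card (support_face P n \<inter> N)"
    using uF uvN calculation by (intro card_mono finite_face_lattice) auto
  then have "0 < edge_width N P n" using \<open>u \<noteq> v\<close> by (simp add: edge_width_def)
  ultimately show ?thesis using that n(1) by (auto simp: edge_normals_def)
qed

text \<open>A point \<open>x\<close> of the first edge is \<open>c\<close> times a point
  \<open>y\<close> of the second. Minimality of \<open>n\<close> at \<open>x\<close> gives c >= 1,
  minimality of \<open>n'\<close> at \<open>y\<close> gives c <= 1, so the first edge lies in the
  second. The hypothesis is an inclusion because maximality of the cones is derived from it.\<close>

lemma edge_cone_inj:
  assumes n: "n \<in> edge_normals N P" and n': "n' \<in> edge_normals N P"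
    and sub: "convex_cone hull (support_face P n) \<subseteq> convex_cone hull (support_face P n')"
  shows "n = n'"
proof -
  have prim: "primitive M n" "primitive M n'" using assms by (auto simp: edge_normals_def)
  have h: "0 < height P n" "0 < height P n'" using height_pos prim primitive_in primitive_nz by auto
  obtain u v where uv: "support_face P n = closed_segment u v" "u \<noteq> v" "u \<in> verts P" "v \<in> verts P"
    "n \<bullet> u = - of_int (height P n)" "n \<bullet> v = - of_int (height P n)" using edge_segment[OF n] .
  have inF: "x \<in> support_face P n'" if x: "x \<in> support_face P n" for x
  proof -
    have "x \<in> convex_cone hull (support_face P n')" by (rule subsetD[OF sub hull_inc[OF x]])
    moreover have "support_face P n' \<noteq> {}" using n' by (auto simp: edge_normals_def edge_width_def)
    moreover have "convex (support_face P n')" using face_of_imp_convex[OF support_face_face_of] .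
    ultimately obtain y c where yc: "y \<in> support_face P n'" "0 \<le> c" "x = c *\<^sub>R y"
      by (auto simp: convex_cone_hull_convex_hull_nonempty hull_same)
    have yP: "y \<in> P" "n' \<bullet> y = - of_int (height P n')"
      using yc height_eq[OF primitive_in(2)[OF prim(2)]] by (auto simp: support_face_def)
    have xP: "x \<in> P" "n \<bullet> x = - of_int (height P n)"
      using x height_eq[OF primitive_in(2)[OF prim(1)]] by (auto simp: support_face_def)
    have "n \<bullet> x \<le> n \<bullet> y" using support_le[OF yP(1), of n] x by (simp add: support_face_def)
    then have "n \<bullet> y * (c - 1) \<le> 0" using yc by (simp add: algebra_simps)
    moreover have "c * (n \<bullet> y) < 0" using xP h yc by simp
    then have "n \<bullet> y < 0" using yc(2) by (simp add: mult_less_0_iff)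
    ultimately have "1 \<le> c" by (simp add: mult_le_0_iff)
    have "n' \<bullet> y \<le> n' \<bullet> x" using support_le[OF xP(1), of n'] yc by (simp add: support_face_def)
    then have "(1 - c) * (n' \<bullet> y) \<le> 0" using yc by (simp add: algebra_simps)
    moreover have "n' \<bullet> y < 0" using yP h by simp
    ultimately have "c \<le> 1" by (simp add: mult_le_0_iff)
    then show ?thesis using \<open>1 \<le> c\<close> yc by simp
  qed
  have "u \<in> support_face P n'" "v \<in> support_face P n'" using inF uv(1) by auto
  then have "n' \<bullet> u = - of_int (height P n')" "n' \<bullet> v = - of_int (height P n')"
    using height_eq[OF primitive_in(2)[OF prim(2)]] by (auto simp: support_face_def)
  then show ?thesis
    using normal_unique[OF prim, of u v] uv verts_facts(2) primitive_in(1) h by auto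
qed

lemma maximal_cones_eq:
  "maximal_cones (spanning_fan P) = (\<lambda>n. convex_cone hull (support_face P n)) ` edge_normals N P"
proof (intro equalityI subsetI)
  let ?C = "\<lambda>n. convex_cone hull (support_face P n)"
  have fan: "?C n \<in> spanning_fan P" if "n \<in> edge_normals N P" for n
  proof -
    have "n \<noteq> 0" using that primitive_nz by (auto simp: edge_normals_def)
    then have "0 \<notin> support_face P n" using support_neg[of n] by (auto simp: support_face_def)
    then have "support_face P n \<noteq> P" using zero_in by auto
    then show ?thesis using support_face_face_of by (auto simp: spanning_fan_def)
  qed
  have nz: "\<not> ?C n \<subseteq> {0}" if n: "n \<in> edge_normals N P" for n
  proof -
    obtain u v where uv: "support_face P n = closed_segment u v" "u \<in> verts P"
      using edge_segment[OF n] by metis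
    then have "u \<in> ?C n" by (simp add: hull_inc)
    moreover have "u \<noteq> 0" using uv verts_facts(2) primitive_nz(1) by blast
    ultimately show ?thesis by blast
  qed
  have facet: "\<exists>n\<in>edge_normals N P. F \<subseteq> support_face P n" if "F face_of P" "F \<noteq> P" "F \<noteq> {}" for F
    using face_of_polyhedron_subset_facet[OF P_facts(3) that(1,3,2)] facet_edge_normal by metis
  have "\<exists>n. n \<in> edge_normals N P"
  proof -
    obtain v where v: "v \<in> verts P" using support_vertex by blast
    then have "{v} face_of P" by (simp add: verts_def face_of_singleton)
    moreover have "{v} \<noteq> P" using aff_dim_P by (metis aff_dim_sing zero_neq_numeral)
    ultimately show ?thesis using facet[of "{v}"] by blast
  qed
  then obtain n0 where n0: "n0 \<in> edge_normals N P" by blast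
  {
    fix \<sigma> assume "\<sigma> \<in> maximal_cones (spanning_fan P)"
    then obtain F where F: "\<sigma> = convex_cone hull F" "F face_of P" "F \<noteq> P"
      and mx: "\<And>\<tau>. \<tau> \<in> spanning_fan P \<Longrightarrow> \<sigma> \<subseteq> \<tau> \<Longrightarrow> \<sigma> = \<tau>"
      by (auto simp: maximal_cones_def spanning_fan_def)
    \<comment> \<open>The empty face is a proper face and contributes the cone \<open>{0}\<close>,
      which is not maximal.\<close>
    have "F \<noteq> {}"
    proof
      assume "F = {}"
      then have "\<sigma> = {0}" using F by simp
      moreover have "{0} \<subseteq> ?C n0" using convex_cone_hull_contains_0 by blast
      ultimately show False using mx[OF fan[OF n0]] nz[OF n0] by auto
    qed
    then obtain n where n: "n \<in> edge_normals N P" "F \<subseteq> support_face P n" using facet F by blast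
    then have "\<sigma> \<subseteq> ?C n" using F hull_mono by blast
    then show "\<sigma> \<in> ?C ` edge_normals N P" using mx[OF fan[OF n(1)]] n(1) by blast
  }
  {
    fix \<sigma> assume "\<sigma> \<in> ?C ` edge_normals N P"
    then obtain n where n: "n \<in> edge_normals N P" "\<sigma> = ?C n" by blast
    have "\<sigma> = \<tau>" if \<tau>: "\<tau> \<in> spanning_fan P" "\<sigma> \<subseteq> \<tau>" for \<tau>
    proof -
      obtain F where F: "\<tau> = convex_cone hull F" "F face_of P" "F \<noteq> P" using \<tau>(1) by (auto simp: spanning_fan_def)
      have "F \<noteq> {}" using F n nz \<tau>(2) by auto
      then obtain n' where n': "n' \<in> edge_normals N P" "F \<subseteq> support_face P n'" using facet F by blast
      then have sub: "\<tau> \<subseteq> ?C n'" using F hull_mono by blast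
      then have "n = n'" using edge_cone_inj[OF n(1) n'(1)] n(2) \<tau>(2) by blast
      then show ?thesis using sub n \<tau>(2) by blast
    qed
    then show "\<sigma> \<in> maximal_cones (spanning_fan P)" using fan n by (auto simp: maximal_cones_def)
  }
qed

lemma finite_edge_normals: "finite (edge_normals N P)"
proof -
  have "finite ((\<lambda>F. convex_cone hull F) ` {F. F face_of P})"
    using finite_polyhedron_faces[OF P_facts(3)] by blast
  then have "finite (maximal_cones (spanning_fan P))"
    by (rule rev_finite_subset) (auto simp: maximal_cones_def spanning_fan_def)
  moreover have "inj_on (\<lambda>n. convex_cone hull (support_face P n)) (edge_normals N P)"
    using edge_cone_inj by (auto simp: inj_on_def)
  ultimately show ?thesis unfolding maximal_cones_eq using finite_imageD by blast
qed

lemma standard_refinement_exists: "\<exists>\<Sigma>. standard_refinement N P \<Sigma>"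
proof -
  have "\<exists>S. standard_refinement_of_cone N \<sigma> S" if \<sigma>: "\<sigma> \<in> maximal_cones (spanning_fan P)" for \<sigma>
  proof -
    obtain n where n: "n \<in> edge_normals N P" "\<sigma> = convex_cone hull (support_face P n)"
      using \<sigma> unfolding maximal_cones_eq by blast
    then have p: "primitive M n" by (auto simp: edge_normals_def)
    then have h: "0 < height P n" using height_pos primitive_in primitive_nz by auto
    obtain u v where "n \<bullet> u = - of_int (height P n)" "n \<bullet> v = - of_int (height P n)" "cone_gens N \<sigma> u v"
      using edge_segment[OF n(1)] n(2) by metis
    then show ?thesis using standard_refinement_of_cone_exists p h by blast
  qed
  then obtain S where "\<forall>\<sigma>\<in>maximal_cones (spanning_fan P). standard_refinement_of_cone N \<sigma> (S \<sigma>)" by metis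
  then show ?thesis unfolding standard_refinement_def by blast
qed

text \<open>All that is used later about a refinement: the counts and the sums on the right depend
  on \<open>P\<close> alone.\<close>

lemma standard_refinement_types:
  assumes "standard_refinement N P \<Sigma>"
  shows "finite \<Sigma>"
    "\<And>\<tau>. \<tau> \<in> \<Sigma> \<Longrightarrow> inner_normal N \<tau> \<in> edge_normals N P \<and> local_index N \<tau> = height P (inner_normal N \<tau>) \<and>
       0 < width N \<tau> \<and> width N \<tau> \<le> local_index N \<tau>"
    "\<And>n w. primitive M n \<Longrightarrow> card {\<tau> \<in> \<Sigma>. inner_normal N \<tau> = n \<and> width N \<tau> = w} =
       width_multiplicity (edge_width N P n) (height P n) w"
    "\<And>g. (\<Sum>\<tau>\<in>\<Sigma>. width N \<tau> * g (inner_normal N \<tau>)) = (\<Sum>n\<in>edge_normals N P. edge_width N P n * g n)"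
proof -
  obtain S where S: "\<And>\<sigma>. \<sigma> \<in> maximal_cones (spanning_fan P) \<Longrightarrow> standard_refinement_of_cone N \<sigma> (S \<sigma>)"
    and \<Sigma>: "\<Sigma> = (\<Union>\<sigma>\<in>maximal_cones (spanning_fan P). S \<sigma>)"
    using assms unfolding standard_refinement_def by blast
  define T where "T n = S (convex_cone hull (support_face P n))" for n
  have T: "finite (T n) \<and>
    (\<forall>\<tau>\<in>T n. inner_normal N \<tau> = n \<and> local_index N \<tau> = height P n \<and> 0 < width N \<tau> \<and> width N \<tau> \<le> height P n) \<and>
    (\<forall>w. card {\<tau> \<in> T n. width N \<tau> = w} = width_multiplicity (edge_width N P n) (height P n) w) \<and>
    (\<Sum>\<tau>\<in>T n. width N \<tau>) = edge_width N P n" if n: "n \<in> edge_normals N P" for n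
  proof -
    have p: "primitive M n" using n by (auto simp: edge_normals_def)
    then have h: "0 < height P n" using height_pos primitive_in primitive_nz by auto
    obtain u v where uv: "n \<bullet> u = - of_int (height P n)" "n \<bullet> v = - of_int (height P n)"
       "cone_gens N (convex_cone hull (support_face P n)) u v"
      using edge_segment[OF n] by metis
    have "standard_refinement_of_cone N (convex_cone hull (support_face P n)) (T n)"
      unfolding T_def using n by (intro S) (auto simp: maximal_cones_eq)
    note R = standard_refinement_of_cone_types[OF uv(3) p uv(1,2) h this]
    show ?thesis using R edge_cone_invariants(3)[OF n] by auto
  qed
  have \<Sigma>T: "\<Sigma> = (\<Union>n\<in>edge_normals N P. T n)" unfolding \<Sigma> maximal_cones_eq T_def by blast
  show "finite \<Sigma>" unfolding \<Sigma>T using finite_edge_normals T by blast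
  show "inner_normal N \<tau> \<in> edge_normals N P \<and> local_index N \<tau> = height P (inner_normal N \<tau>) \<and>
       0 < width N \<tau> \<and> width N \<tau> \<le> local_index N \<tau>" if "\<tau> \<in> \<Sigma>" for \<tau>
    using that T unfolding \<Sigma>T by force
  show "card {\<tau> \<in> \<Sigma>. inner_normal N \<tau> = n \<and> width N \<tau> = w} =
       width_multiplicity (edge_width N P n) (height P n) w" if n: "primitive M n" for n w
  proof (cases "n \<in> edge_normals N P")
    case True
    then have "{\<tau> \<in> \<Sigma>. inner_normal N \<tau> = n \<and> width N \<tau> = w} = {\<tau> \<in> T n. width N \<tau> = w}"
      using T unfolding \<Sigma>T by fastforce
    then show ?thesis using T[OF True] by simp
  next
    case False
    then have e: "{\<tau> \<in> \<Sigma>. inner_normal N \<tau> = n \<and> width N \<tau> = w} = {}" using T unfolding \<Sigma>T by fastforce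
    \<comment> \<open>At a primitive functional that is no edge normal the count formula reads 0 =
      0, so it may be applied to any image under the tilting map below.\<close>
    have "edge_width N P n = 0" using False n edge_width_nonneg[of n] by (auto simp: edge_normals_def)
    then show ?thesis unfolding e by (simp add: width_multiplicity_def)
  qed
  show "(\<Sum>\<tau>\<in>\<Sigma>. width N \<tau> * g (inner_normal N \<tau>)) = (\<Sum>n\<in>edge_normals N P. edge_width N P n * g n)" for g
  proof -
    have "(\<Sum>\<tau>\<in>\<Sigma>. width N \<tau> * g (inner_normal N \<tau>)) = (\<Sum>n\<in>edge_normals N P. \<Sum>\<tau>\<in>T n. width N \<tau> * g (inner_normal N \<tau>))"
      unfolding \<Sigma>T using T finite_edge_normals by (intro sum.UNION_disjoint) (auto, metis)
    also have "\<dots> = (\<Sum>n\<in>edge_normals N P. edge_width N P n * g n)"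
    proof (rule sum.cong)
      fix n assume n: "n \<in> edge_normals N P"
      have "(\<Sum>\<tau>\<in>T n. width N \<tau> * g (inner_normal N \<tau>)) = (\<Sum>\<tau>\<in>T n. width N \<tau> * g n)"
        using T[OF n] by (intro sum.cong) auto
      also have "\<dots> = (\<Sum>\<tau>\<in>T n. width N \<tau>) * g n" by (simp add: sum_distrib_right)
      finally show "(\<Sum>\<tau>\<in>T n. width N \<tau> * g (inner_normal N \<tau>)) = edge_width N P n * g n" using T[OF n] by simp
    qed simp
    finally show ?thesis .
  qed
qed

end

section \<open>The diameter of a vertex\<close>

context fano
begin

lemma interior_support_less:
  assumes "n \<noteq> 0" "y \<in> interior P" shows "support P n < n \<bullet> y"
proof -
  have "P \<subseteq> {x. n \<bullet> x \<ge> support P n}" using support_le by auto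
  then have "interior P \<subseteq> {x. n \<bullet> x > support P n}" using interior_mono interior_halfspace_ge[OF assms(1)] by metis
  then show ?thesis using assms(2) by blast
qed

text \<open>A lowest vertex, scaled towards the interior point 0 by a factor strictly between 0 and
  1, becomes interior.\<close>

lemma interior_point_at_level:
  assumes "- of_int (height P m) < t" "t < 0" "m \<in> M"
  obtains y where "y \<in> interior P" "m \<bullet> y = t"
proof -
  obtain x where x: "x \<in> verts P" "m \<bullet> x = support P m" using support_vertex .
  define s where "s = - t / of_int (height P m)"
  have s: "0 < s" "s < 1" "s * (m \<bullet> x) = t"
    using assms x height_eq[OF assms(3)] by (auto simp: s_def field_simps)
  have "x \<in> closure P" using x verts_facts(1) closure_subset by blast
  then have "x - (1 - s) *\<^sub>R (x - 0) \<in> interior P"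
    using s by (intro mem_interior_closure_convex_shrink P_facts zero_interior) auto
  moreover have "m \<bullet> (x - (1 - s) *\<^sub>R (x - 0)) = t" using s(3) by (simp add: inner_diff_right algebra_simps)
  ultimately show ?thesis using that by blast
qed

text \<open>Half-integral levels contain no lattice point, so they miss the vertices and the edges
  parallel to the level.\<close>

lemma interior_point_at_half_level:
  assumes "m \<in> M" "- height P m \<le> k" "k < height P (- m)"
  obtains y where "y \<in> interior P" "m \<bullet> y = of_int k + 1/2"
proof (cases "k < 0")
  case True
  then have "of_int k + 1/2 < (0::real)" "- of_int (height P m) < of_int k + (1/2::real)" using assms by linarith+
  then show ?thesis using interior_point_at_level assms(1) that by blast
next
  case False
  then have "- (of_int k + 1/2) < (0::real)" "- of_int (height P (- m)) < - (of_int k + (1/2::real))"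
    using assms by linarith+
  then obtain y where "y \<in> interior P" "(- m) \<bullet> y = - (of_int k + 1/2)"
    using interior_point_at_level dual_minus[OF assms(1)] by blast
  then show ?thesis using that by simp
qed

text \<open>A ray in direction \<open>- f\<close> from an interior point of the level stays on the
  level and leaves \<open>P\<close> through an edge; since \<open>n\<close> decreases along the ray,
  \<open>n \<bullet> f\<close> is positive.\<close>

lemma edge_at_level:
  assumes m: "primitive M m" and f: "primitive N f" "m \<bullet> f = 0"
    and k: "- height P m \<le> k" "k < height P (- m)"
  obtains n x where "n \<in> edge_normals N P" "n \<bullet> f > 0" "x \<in> support_face P n" "m \<bullet> x = of_int k + 1/2"
proof -
  obtain y where y: "y \<in> interior P" "m \<bullet> y = of_int k + 1/2"
    using interior_point_at_half_level[OF primitive_in(2)[OF m] k] .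
  have "- f \<noteq> 0" using primitive_nz(1)[OF f(1)] by simp
  obtain d where d: "0 < d" "y + d *\<^sub>R (- f) \<in> frontier P"
    using ray_to_frontier[OF P_facts(5) y(1) \<open>- f \<noteq> 0\<close>] by metis
  define x where "x = y + d *\<^sub>R (- f)"
  have "x \<in> rel_frontier P" using d zero_interior by (simp add: x_def rel_frontier_nonempty_interior) (metis empty_iff rel_frontier_nonempty_interior)
  then obtain F where F: "F facet_of P" "x \<in> F" using rel_frontier_of_polyhedron[OF P_facts(3)] by blast
  then obtain n where n: "n \<in> edge_normals N P" "F = support_face P n" using facet_edge_normal by blast
  have "n \<noteq> 0" using n primitive_nz by (auto simp: edge_normals_def)
  have "n \<bullet> x = support P n" using F n by (auto simp: support_face_def)
  also have "\<dots> < n \<bullet> y" using interior_support_less[OF \<open>n \<noteq> 0\<close> y(1)] .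
  finally have "0 < d * (n \<bullet> f)" by (simp add: x_def inner_diff_right)
  then have "n \<bullet> f > 0" using d(1) by (simp add: zero_less_mult_iff)
  moreover have "m \<bullet> x = of_int k + 1/2" using y f by (simp add: x_def inner_diff_right)
  ultimately show ?thesis using that n F by blast
qed

lemma edge_level_range:
  assumes m: "primitive M m" and f: "primitive N f" "m \<bullet> f = 0" and n: "n \<in> edge_normals N P"
  obtains u v a b where "support_face P n = closed_segment u v" "u \<in> verts P" "v \<in> verts P" "u \<noteq> v"
    "m \<bullet> u = of_int a" "m \<bullet> v = of_int b" "a \<le> b"
    "of_int (edge_width N P n) * \<bar>n \<bullet> f\<bar> = of_int (b - a)" "- height P m \<le> a" "b \<le> height P (- m)"
proof -
  have pn: "primitive M n" using n by (auto simp: edge_normals_def)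
  have mM: "m \<in> M" "- m \<in> M" using m primitive_in dual_minus by auto
  \<comment> \<open>\<open>key\<close> treats the ends in the order of increasing \<open>m\<close>;
    the other order follows by exchanging them.\<close>
  note result = that
  have key: thesis if uv: "support_face P n = closed_segment u v" "u \<noteq> v" "u \<in> verts P" "v \<in> verts P"
    "n \<bullet> u = n \<bullet> v" and le: "m \<bullet> u \<le> m \<bullet> v" for u v
  proof -
    have N: "u \<in> N" "v \<in> N" using uv verts_facts(2) primitive_in by auto
    obtain a b where ab: "m \<bullet> u = of_int a" "m \<bullet> v = of_int b"
      using inner_Ints[OF mM(1)] N by (metis Ints_cases)
    obtain d w where d: "primitive N d" "w > 0" "v - u = of_nat w *\<^sub>R d"
      using lattice_multiple_primitive[of "v - u"] lattice_diff N uv(2) by (metis right_minus_eq)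
    have "v = u + of_nat w *\<^sub>R d" using d(3) by (simp add: algebra_simps)
    then have ew: "edge_width N P n = int w"
      using card_lattice_segment[OF N(1) d(1), of w] by (simp add: edge_width_def uv(1))
    have "n \<bullet> (v - u) = 0" using uv by (simp add: inner_diff_right)
    then have "n \<bullet> d = 0" using d by auto
    then have "d = perp n \<or> d = - perp n" using orthogonal_primitive pn d by blast
    moreover have "f = perp m \<or> f = - perp m" using orthogonal_primitive m f by blast
    \<comment> \<open>Up to sign \<open>d\<close> and \<open>f\<close> are the rotations of
      \<open>n\<close> and \<open>m\<close>, so both sides are the absolute determinant of
      \<open>m\<close> and \<open>n\<close>: one lattice step along the edge climbs that many
      levels.\<close>
    ultimately have "\<bar>m \<bullet> d\<bar> = \<bar>n \<bullet> f\<bar>" using inner_perp_swap[of n m] by auto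
    moreover have "m \<bullet> v - m \<bullet> u = w * (m \<bullet> d)"
      using arg_cong[OF d(3), of "(\<bullet>) m"] by (simp add: inner_diff_right)
    ultimately have "of_int (edge_width N P n) * \<bar>n \<bullet> f\<bar> = \<bar>m \<bullet> v - m \<bullet> u\<bar>"
      by (simp add: ew abs_mult)
    then have e: "of_int (edge_width N P n) * \<bar>n \<bullet> f\<bar> = of_int (b - a)" using ab le by simp
    have "- of_int (height P m) \<le> m \<bullet> u" "- of_int (height P (- m)) \<le> (- m) \<bullet> v"
      using support_le verts_facts(1) uv height_eq[OF mM(1)] height_eq[OF mM(2)] by (metis minus_minus)+
    then have "- height P m \<le> a" "b \<le> height P (- m)" using ab by auto
    moreover have "a \<le> b" using le ab by simp
    ultimately show thesis using result[OF uv(1,3,4,2) ab] e by blast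
  qed
  obtain u v where uv: "support_face P n = closed_segment u v" "u \<noteq> v" "u \<in> verts P" "v \<in> verts P"
    "n \<bullet> u = - of_int (height P n)" "n \<bullet> v = - of_int (height P n)" using edge_segment[OF n] by metis
  show ?thesis
  proof (cases "m \<bullet> u \<le> m \<bullet> v")
    case True
    then show ?thesis using key[of u v] uv by simp
  next
    case False
    then show ?thesis using key[of v u] uv by (simp add: closed_segment_commute)
  qed
qed

text \<open>Two points of one level differ by c f. Minimality of \<open>n'\<close> at
  \<open>x'\<close> gives c <= 0 and minimality of \<open>n\<close> at \<open>x\<close> gives c >=
  0, so they coincide; a relatively interior point of an edge determines its normal.\<close>

lemma edge_at_level_unique:
  assumes m: "primitive M m" and f: "primitive N f" "m \<bullet> f = 0"
    and n: "n \<in> edge_normals N P" "n \<bullet> f > 0" and n': "n' \<in> edge_normals N P" "n' \<bullet> f > 0"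
    and x: "x \<in> open_segment u v" "support_face P n = closed_segment u v" "u \<in> verts P" "v \<in> verts P" "u \<noteq> v"
    and x': "x' \<in> support_face P n'" "m \<bullet> x' = m \<bullet> x"
  shows "n' = n"
proof -
  have xf: "x \<in> support_face P n" using x(1,2) by (auto simp: open_segment_def)
  have p: "primitive M n" "primitive M n'" using n n' by (auto simp: edge_normals_def)
  obtain c where c: "x' - x = c *\<^sub>R f"
    using orthogonal_multiple_of_primitive[OF m f, of "x' - x"] x'(2) by (auto simp: inner_diff_right)
  have "n' \<bullet> x' \<le> n' \<bullet> x" using support_le[of x n'] xf x'(1) by (auto simp: support_face_def)
  moreover have "n' \<bullet> x' - n' \<bullet> x = c * (n' \<bullet> f)" using arg_cong[OF c, of "(\<bullet>) n'"] by (simp add: inner_diff_right)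
  ultimately have "c * (n' \<bullet> f) \<le> 0" by linarith
  then have "c \<le> 0" using n'(2) by (simp add: mult_le_0_iff)
  have "n \<bullet> x \<le> n \<bullet> x'" using support_le[of x' n] xf x'(1) by (auto simp: support_face_def)
  moreover have "n \<bullet> x' - n \<bullet> x = c * (n \<bullet> f)" using arg_cong[OF c, of "(\<bullet>) n"] by (simp add: inner_diff_right)
  ultimately have "0 \<le> c * (n \<bullet> f)" by linarith
  then have "0 \<le> c" using n(2) by (simp add: zero_le_mult_iff)
  then have "x' = x" using \<open>c \<le> 0\<close> c by simp
  then have nx: "n' \<bullet> x = support P n'" using x'(1) by (auto simp: support_face_def)
  obtain s where s: "0 < s" "s < 1" "x = (1 - s) *\<^sub>R u + s *\<^sub>R v" using x(1) by (auto simp: in_segment)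
  have ge: "support P n' \<le> n' \<bullet> u" "support P n' \<le> n' \<bullet> v" using support_le verts_facts(1) x by auto
  \<comment> \<open>A minimum attained inside a segment is attained at both of its ends.\<close>
  have "(1 - s) * (n' \<bullet> u - support P n') + s * (n' \<bullet> v - support P n') = 0"
    using nx by (simp add: s(3) inner_add_right algebra_simps)
  moreover have "0 \<le> (1 - s) * (n' \<bullet> u - support P n')" "0 \<le> s * (n' \<bullet> v - support P n')" using ge s by auto
  ultimately have "(1 - s) * (n' \<bullet> u - support P n') = 0" "s * (n' \<bullet> v - support P n') = 0" by linarith+
  then have e': "n' \<bullet> u = support P n'" "n' \<bullet> v = support P n'" using s by auto
  have "u \<in> support_face P n" "v \<in> support_face P n" using x(2) by auto
  then have e: "n \<bullet> u = support P n" "n \<bullet> v = support P n" by (auto simp: support_face_def)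
  show ?thesis
    using normal_unique[OF p(2,1), of u v] e e' x verts_facts(2) primitive_in(1)
      support_neg[of n] support_neg[of n'] p primitive_nz(2) by auto
qed

text \<open>
  The edges on one side of \<open>P\<close> tile the range of \<open>m\<close>: the line at a half-integral level meets
  exactly one of them, in a relatively interior point.
\<close>

lemma edge_level_sum:
  assumes m: "primitive M m" and f: "primitive N f" "m \<bullet> f = 0"
  shows "(\<Sum>n\<in>edge_normals N P. of_int (edge_width N P n) * max (n \<bullet> f) 0) = of_int (height P m + height P (- m))"
proof -
  define E where "E = {n \<in> edge_normals N P. n \<bullet> f > 0}"
  \<comment> \<open>\<open>k\<close> stands for the level k + 1/2 between the integral levels k and
    k + 1.\<close>
  define K where "K = {- height P m..<height P (- m)}"
  have mM: "m \<in> M" "- m \<in> M" "m \<noteq> 0" using m primitive_in dual_minus primitive_nz by auto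
  have finE: "finite E" using finite_edge_normals by (simp add: E_def)
  have "\<forall>n. \<exists>u v a b. n \<in> E \<longrightarrow> support_face P n = closed_segment u v \<and> u \<in> verts P \<and> v \<in> verts P \<and> u \<noteq> v \<and>
    m \<bullet> u = of_int a \<and> m \<bullet> v = of_int b \<and> a \<le> b \<and>
    of_int (edge_width N P n) * \<bar>n \<bullet> f\<bar> = of_int (b - a) \<and> - height P m \<le> a \<and> b \<le> height P (- m)"
  proof
    fix n
    show "\<exists>u v a b. n \<in> E \<longrightarrow> support_face P n = closed_segment u v \<and> u \<in> verts P \<and> v \<in> verts P \<and> u \<noteq> v \<and>
    m \<bullet> u = of_int a \<and> m \<bullet> v = of_int b \<and> a \<le> b \<and>
    of_int (edge_width N P n) * \<bar>n \<bullet> f\<bar> = of_int (b - a) \<and> - height P m \<le> a \<and> b \<le> height P (- m)"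
    proof (cases "n \<in> E")
      case True
      then have "n \<in> edge_normals N P" by (simp add: E_def)
      then show ?thesis using edge_level_range[OF m f] by (metis (no_types, lifting))
    qed simp
  qed
  then obtain U V A B where R: "\<And>n. n \<in> E \<Longrightarrow> support_face P n = closed_segment (U n) (V n) \<and> U n \<in> verts P \<and> V n \<in> verts P \<and> U n \<noteq> V n \<and>
    m \<bullet> U n = of_int (A n) \<and> m \<bullet> V n = of_int (B n) \<and> A n \<le> B n \<and>
    of_int (edge_width N P n) * \<bar>n \<bullet> f\<bar> = of_int (B n - A n) \<and> - height P m \<le> A n \<and> B n \<le> height P (- m)"
    by metis
  have one: "card {n \<in> E. A n \<le> k \<and> k < B n} = 1" if k: "k \<in> K" for k
  proof -
    let ?t = "of_int k + 1/2 :: real"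
    have cross: "\<exists>x \<in> open_segment (U n) (V n). m \<bullet> x = ?t" if n: "n \<in> E" "A n \<le> k" "k < B n" for n
    proof -
      define s where "s = (?t - of_int (A n)) / of_int (B n - A n)"
      have s: "0 < s" "s < 1" "of_int (A n) + s * of_int (B n - A n) = ?t"
        using n by (auto simp: s_def field_simps)
      have "m \<bullet> ((1 - s) *\<^sub>R U n + s *\<^sub>R V n) = (1 - s) * of_int (A n) + s * of_int (B n)"
        using R[OF n(1)] by (simp add: inner_add_right)
      also have "\<dots> = ?t" using s(3) by (simp add: algebra_simps)
      finally have "m \<bullet> ((1 - s) *\<^sub>R U n + s *\<^sub>R V n) = ?t" .
      moreover have "(1 - s) *\<^sub>R U n + s *\<^sub>R V n \<in> open_segment (U n) (V n)"
        using s R[OF n(1)] by (auto simp: in_segment)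
      ultimately show ?thesis by blast
    qed
    obtain n x where n: "n \<in> edge_normals N P" "n \<bullet> f > 0" "x \<in> support_face P n" "m \<bullet> x = ?t"
      using edge_at_level[OF m f, of k] k unfolding K_def atLeastLessThan_iff by metis
    then have nE: "n \<in> E" by (simp add: E_def)
    obtain s where s: "0 \<le> s" "s \<le> 1" "x = (1 - s) *\<^sub>R U n + s *\<^sub>R V n"
      using n(3) R[OF nE] by (auto simp: closed_segment_def)
    have "?t = (1 - s) * of_int (A n) + s * of_int (B n)" using n(4) R[OF nE] by (simp add: s(3) inner_add_right)
    then have t: "?t = of_int (A n) + s * of_int (B n - A n)" by (simp add: algebra_simps)
    moreover have "0 \<le> s * of_int (B n - A n)" "s * of_int (B n - A n) \<le> of_int (B n - A n)"
      using s R[OF nE] by (auto intro: mult_left_le_one_le)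
    ultimately have "of_int (A n) \<le> ?t" "?t \<le> of_int (B n)" by auto
    \<comment> \<open>The ends of the edge are on integral levels, so the half-integral level lies
      strictly between them.\<close>
    then have nk: "A n \<le> k" "k < B n" by linarith+
    have "{n \<in> E. A n \<le> k \<and> k < B n} = {n}"
    proof (intro equalityI subsetI)
      fix n' assume "n' \<in> {n \<in> E. A n \<le> k \<and> k < B n}"
      then have n': "n' \<in> E" "A n' \<le> k" "k < B n'" by auto
      obtain y where y: "y \<in> open_segment (U n') (V n')" "m \<bullet> y = ?t" using cross[OF n'] by blast
      have "n = n'" using edge_at_level_unique[OF m f, of n' n y "U n'" "V n'" x] n' n y R[OF n'(1)] by (auto simp: E_def)
      then show "n' \<in> {n}" by simp
    qed (use nE nk in auto)
    then show ?thesis by simp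
  qed
  have cardK: "card {k \<in> K. A n \<le> k \<and> k < B n} = nat (B n - A n)" if "n \<in> E" for n
  proof -
    have "{k \<in> K. A n \<le> k \<and> k < B n} = {A n..<B n}" using R[OF that] by (auto simp: K_def)
    then show ?thesis by simp
  qed
  \<comment> \<open>Double counting of crossings: an edge crosses \<open>B n - A n\<close> levels,
    and every level is crossed once.\<close>
  have "(\<Sum>n\<in>E. card {k \<in> K. A n \<le> k \<and> k < B n}) = (\<Sum>k\<in>K. 1)"
    by (rule sum_multicount_gen[OF finE]) (use one in \<open>auto simp: K_def\<close>)
  then have c: "(\<Sum>n\<in>E. nat (B n - A n)) = card K" using cardK by simp
  have "(\<Sum>n\<in>edge_normals N P. of_int (edge_width N P n) * max (n \<bullet> f) 0) = (\<Sum>n\<in>E. of_int (edge_width N P n) * max (n \<bullet> f) 0)"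
    using finite_edge_normals by (intro sum.mono_neutral_right) (auto simp: E_def)
  also have "\<dots> = (\<Sum>n\<in>E. of_nat (nat (B n - A n)))"
  proof (rule sum.cong)
    fix n assume n: "n \<in> E"
    then have "max (n \<bullet> f) 0 = \<bar>n \<bullet> f\<bar>" by (simp add: E_def)
    then show "of_int (edge_width N P n) * max (n \<bullet> f) 0 = of_nat (nat (B n - A n))" using R[OF n] by simp
  qed simp
  also have "\<dots> = of_nat (card K)" unfolding c[symmetric] by simp
  also have "\<dots> = of_int (height P m + height P (- m))"
    using height_pos[OF mM(1)] height_pos[OF mM(2)] mM(3) by (simp add: K_def)
  finally show ?thesis .
qed

end

section \<open>The mutated polygon\<close>

text \<open>Used to discard one of the two copies of \<open>Y\<close>. Weak domination settles the
  minimum, whereas the face needs strict domination, since a tie would enlarge it.\<close>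

lemma support_face_dominated:
  assumes V: "finite V" "W \<subseteq> V" "W \<noteq> {}" and dom: "\<And>v. v \<in> V \<Longrightarrow> \<exists>w\<in>W. n \<bullet> w \<le> n \<bullet> v"
  shows "support (convex hull V) n = support (convex hull W) n"
    and "(\<And>v. v \<in> V - W \<Longrightarrow> \<exists>w\<in>W. n \<bullet> w < n \<bullet> v) \<Longrightarrow>
      support_face (convex hull V) n = support_face (convex hull W) n"
proof -
  have fW: "finite W" using V finite_subset by blast
  define h where "h = Min ((\<bullet>) n ` W)"
  have W: "\<And>v. v \<in> W \<Longrightarrow> h \<le> n \<bullet> v" using fW by (simp add: h_def)
  have "h \<in> (\<bullet>) n ` W" unfolding h_def using fW V(3) by (intro Min_in) auto
  then have ex: "\<exists>v\<in>W. n \<bullet> v = h" by auto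
  have V': "\<And>v. v \<in> V \<Longrightarrow> h \<le> n \<bullet> v" using dom W by force
  have exV: "\<exists>v\<in>V. n \<bullet> v = h" using ex V(2) by blast
  note fV = support_face_convex_hull[OF V(1) V' exV] and fW = support_face_convex_hull[OF fW W ex]
  show "support (convex hull V) n = support (convex hull W) n" using fV(1) fW(1) by simp
  assume s: "\<And>v. v \<in> V - W \<Longrightarrow> \<exists>w\<in>W. n \<bullet> w < n \<bullet> v"
  have "{v \<in> V. n \<bullet> v = h} = {v \<in> W. n \<bullet> v = h}"
  proof (intro equalityI subsetI)
    fix v assume v: "v \<in> {v \<in> V. n \<bullet> v = h}"
    then have "v \<in> W" using s[of v] W by fastforce
    then show "v \<in> {v \<in> W. n \<bullet> v = h}" using v by simp
  qed (use V(2) in auto)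
  then show "support_face (convex hull V) n = support_face (convex hull W) n" using fV(2) fW(2) by simp
qed

lemma support_face_image:
  assumes "\<And>x. k \<bullet> T x = n \<bullet> x"
  shows "support (T ` S) k = support S n" "support_face (T ` S) k = T ` support_face S n"
proof -
  show s: "support (T ` S) k = support S n" by (simp add: support_def image_image assms)
  show "support_face (T ` S) k = T ` support_face S n" by (auto simp: support_face_def s assms)
qed

lemma inner_translate:
  fixes k y f :: "'a::real_inner"
  assumes "0 \<le> t"
  shows "0 < k \<bullet> f \<Longrightarrow> y + t *\<^sub>R f = y \<or> k \<bullet> y < k \<bullet> (y + t *\<^sub>R f)"
    and "k \<bullet> f < 0 \<Longrightarrow> y + t *\<^sub>R f = y \<or> k \<bullet> (y + t *\<^sub>R f) < k \<bullet> y"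
  using assms by (cases "t = 0"; simp add: inner_add_right mult_pos_neg)+

text \<open>A Minkowski sum with a segment is covered by the segments joining a point to its extreme
  translate, so the two end copies of \<open>A\<close> suffice.\<close>

lemma strip_in_convex_hull:
  fixes f g :: "'a::real_vector"
  assumes g: "g \<in> convex hull A" and r: "0 \<le> r" "r \<le> k" and Z: "A \<subseteq> Z" "(\<lambda>y. y + k *\<^sub>R f) ` A \<subseteq> Z"
  shows "g + r *\<^sub>R f \<in> convex hull Z"
proof -
  have "(\<lambda>y. y + k *\<^sub>R f) ` A = (+) (k *\<^sub>R f) ` A" by (simp add: add.commute)
  then have "convex hull ((\<lambda>y. y + k *\<^sub>R f) ` A) = (+) (k *\<^sub>R f) ` (convex hull A)"
    by (simp only: convex_hull_translation)
  then have "g + k *\<^sub>R f \<in> convex hull ((\<lambda>y. y + k *\<^sub>R f) ` A)" using g by (auto simp: add.commute)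
  then have 1: "g + k *\<^sub>R f \<in> convex hull Z" using hull_mono[OF Z(2)] by blast
  have 2: "g \<in> convex hull Z" using g hull_mono[OF Z(1)] by blast
  have "g + r *\<^sub>R f \<in> closed_segment (g + 0 *\<^sub>R f) (g + k *\<^sub>R f)"
    using r by (subst closed_segment_on_line) auto
  then show ?thesis using 1 2 closed_segment_subset[OF 2 1 convex_convex_hull] by auto
qed

text \<open>With \<open>c \<bullet> f = 1\<close>, \<open>c\<close> is a lattice coordinate along
  the line, so lattice length is the difference of the extreme values of \<open>c\<close>.\<close>

lemma (in planar_lattice) card_lattice_level_hull:
  assumes A: "A \<subseteq> N" "a \<in> A" "b \<in> A" and m: "primitive M m" and f: "primitive N f" "m \<bullet> f = 0"
    and c: "c \<in> M" "c \<bullet> f = 1" and lev: "\<And>x. x \<in> A \<Longrightarrow> m \<bullet> x = m \<bullet> a \<and> c \<bullet> a \<le> c \<bullet> x \<and> c \<bullet> x \<le> c \<bullet> b"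
  shows "of_int (int (card (convex hull A \<inter> N)) - 1) = c \<bullet> b - c \<bullet> a"
proof -
  have ab: "c \<bullet> b - c \<bullet> a \<in> \<int>" "0 \<le> c \<bullet> b - c \<bullet> a"
    using A inner_Ints[OF c(1)] lev[OF A(3)] by (auto intro!: Ints_diff)
  then obtain w where w: "c \<bullet> b - c \<bullet> a = of_nat w" by (metis Ints_cases of_int_0_le_iff nonneg_int_cases of_int_of_nat_eq)
  have line: "x = a + (c \<bullet> x - c \<bullet> a) *\<^sub>R f" if "x \<in> A" for x
  proof -
    have "m \<bullet> (x - a) = 0" using lev[OF that] by (simp add: inner_diff_right)
    then obtain t where t: "x - a = t *\<^sub>R f" using orthogonal_multiple_of_primitive[OF m f] by blast
    then have "c \<bullet> (x - a) = t" using c by simp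
    then show ?thesis using t by (simp add: inner_diff_right algebra_simps)
  qed
  have seg: "convex hull A = closed_segment a (a + of_nat w *\<^sub>R f)"
  proof
    have "A \<subseteq> closed_segment (a + 0 *\<^sub>R f) (a + of_nat w *\<^sub>R f)"
    proof
      fix x assume x: "x \<in> A"
      show "x \<in> closed_segment (a + 0 *\<^sub>R f) (a + of_nat w *\<^sub>R f)"
        using line[OF x] lev[OF x] by (subst closed_segment_on_line) (auto simp: w[symmetric])
    qed
    then show "convex hull A \<subseteq> closed_segment a (a + of_nat w *\<^sub>R f)" by (intro hull_minimal) auto
    have "b = a + of_nat w *\<^sub>R f" using line[OF A(3)] w by simp
    then show "closed_segment a (a + of_nat w *\<^sub>R f) \<subseteq> convex hull A"
      using A by (metis closed_segment_subset convex_convex_hull hull_inc)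
  qed
  have "int (card (convex hull A \<inter> N)) - 1 = int w"
    unfolding seg using card_lattice_segment[OF _ f(1)] A by blast
  then show ?thesis using w by simp
qed

text \<open>Only the far end moves, by \<open>k\<close> lattice steps. This is the source of the
  change of an edge length by the height.\<close>

lemma (in planar_lattice) card_lattice_strip:
  assumes A: "A \<subseteq> N" "finite A" "A \<noteq> {}" and m: "primitive M m" and f: "primitive N f" "m \<bullet> f = 0"
    and lev: "\<And>x. x \<in> A \<Longrightarrow> m \<bullet> x = h" and k: "0 \<le> k"
  shows "int (card (convex hull (A \<union> (\<lambda>y. y + of_int k *\<^sub>R f) ` A) \<inter> N)) = int (card (convex hull A \<inter> N)) + k"
proof -
  obtain c where c: "c \<in> M" "c \<bullet> f = 1" using f by (auto simp: primitive_iff)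
  have "Min ((\<bullet>) c ` A) \<in> (\<bullet>) c ` A" "Max ((\<bullet>) c ` A) \<in> (\<bullet>) c ` A" using A by auto
  then obtain a b where ab: "a \<in> A" "b \<in> A" "c \<bullet> a = Min ((\<bullet>) c ` A)" "c \<bullet> b = Max ((\<bullet>) c ` A)" by auto
  then have le: "c \<bullet> a \<le> c \<bullet> x \<and> c \<bullet> x \<le> c \<bullet> b" if "x \<in> A" for x using A that by auto
  have 1: "of_int (int (card (convex hull A \<inter> N)) - 1) = c \<bullet> b - c \<bullet> a"
    using ab le lev by (intro card_lattice_level_hull[OF A(1) _ _ m f c]) auto
  let ?A = "A \<union> (\<lambda>y. y + of_int k *\<^sub>R f) ` A"
  have sub: "?A \<subseteq> N" using A f primitive_in by (auto intro!: lattice_add lattice_scale)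
  have "of_int (int (card (convex hull ?A \<inter> N)) - 1) = c \<bullet> (b + of_int k *\<^sub>R f) - c \<bullet> a"
  proof (rule card_lattice_level_hull[OF sub _ _ m f c])
    fix x assume "x \<in> ?A"
    then show "m \<bullet> x = m \<bullet> a \<and> c \<bullet> a \<le> c \<bullet> x \<and> c \<bullet> x \<le> c \<bullet> (b + of_int k *\<^sub>R f)"
      using le lev ab k c f by (fastforce simp: inner_add_right)
  qed (use ab in auto)
  then have "of_int (int (card (convex hull ?A \<inter> N)) - 1) = (of_int (int (card (convex hull A \<inter> N)) - 1 + k) :: real)"
    using 1 c by (simp add: inner_add_right)
  then have "int (card (convex hull ?A \<inter> N)) - 1 = int (card (convex hull A \<inter> N)) - 1 + k"
    by (simp only: of_int_eq_iff)
  then show ?thesis by simp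
qed

text \<open>
  \<open>Y\<close> stands for the lattice points of the remainders \<open>G\<^sub>h\<close> (\<open>h < 0\<close>) and of the slices \<open>P\<^sub>h\<close> (\<open>h \<ge> 0\<close>).
  In terms of \<open>Y\<close> the polygon and its mutation have symmetric descriptions.
\<close>

locale mutation = fano +
  fixes m f :: "real^2" and Y Q :: "(real^2) set"
  assumes m: "primitive (dual_lattice N) m" and f: "primitive N f" and mf: "m \<bullet> f = 0"
    and Y: "finite Y" "Y \<subseteq> N"
    and P_eq: "P = convex hull (Y \<union> (\<lambda>y. y + max (- (m \<bullet> y)) 0 *\<^sub>R f) ` Y)"
    and Q_eq: "Q = convex hull (Y \<union> (\<lambda>y. y + max (m \<bullet> y) 0 *\<^sub>R f) ` Y)"
begin

definition lo :: "real^2 \<Rightarrow> real^2" where "lo y = y + max (- (m \<bullet> y)) 0 *\<^sub>R f"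
definition hi :: "real^2 \<Rightarrow> real^2" where "hi y = y + max (m \<bullet> y) 0 *\<^sub>R f"
text \<open>The linear map relating \<open>lo\<close> to \<open>hi\<close>; its inverse transpose n
  |-> n - (n.f) m is the second branch of \<open>tilt\<close>.\<close>

definition shear :: "real^2 \<Rightarrow> real^2" where "shear x = x + (m \<bullet> x) *\<^sub>R f"

text \<open>The piecewise linear map on \<open>M\<close> that carries the support function of \<open>P\<close> to that of \<open>Q\<close>.\<close>

definition tilt :: "real^2 \<Rightarrow> real^2" where "tilt n = n - min (n \<bullet> f) 0 *\<^sub>R m"

lemma P_hull_lo: "P = convex hull (Y \<union> lo ` Y)" and Q_hull_hi: "Q = convex hull (Y \<union> hi ` Y)"
  using P_eq Q_eq by (simp_all add: lo_def hi_def)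

lemma Y_nonempty: "Y \<noteq> {}"
  using P_eq P_facts(4) by auto

lemma m_in: "m \<in> M" "- m \<in> M" "m \<noteq> 0" and f_in: "f \<in> N" "f \<noteq> 0"
  using m f primitive_in primitive_nz dual_minus by auto

lemma level_lo_hi: "m \<bullet> lo y = m \<bullet> y" "m \<bullet> hi y = m \<bullet> y" "m \<bullet> shear x = m \<bullet> x"
  by (simp_all add: lo_def hi_def shear_def inner_add_right mf)

text \<open>max t 0 = max (-t) 0 + t: two piecewise linear displacements differ by a linear
  one.\<close>

lemma hi_eq_shear_lo: "hi y = shear (lo y)"
proof -
  have "max (m \<bullet> y) 0 = max (- (m \<bullet> y)) 0 + m \<bullet> y" by auto
  then show ?thesis unfolding shear_def level_lo_hi by (simp add: lo_def hi_def scaleR_add_left add.assoc)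
qed

lemma lattice_lo_hi: "y \<in> N \<Longrightarrow> lo y \<in> N" "y \<in> N \<Longrightarrow> hi y \<in> N" "shear x \<in> N \<longleftrightarrow> x \<in> N"
proof -
  have i: "m \<bullet> y \<in> \<int>" if "y \<in> N" for y using inner_Ints m_in that by blast
  show "lo y \<in> N" if "y \<in> N" using i[OF that] f_in that unfolding lo_def by (intro lattice_add lattice_scale) (auto simp: max_def)
  show "hi y \<in> N" if "y \<in> N" using i[OF that] f_in that unfolding hi_def by (intro lattice_add lattice_scale) (auto simp: max_def)
  show "shear x \<in> N \<longleftrightarrow> x \<in> N"
  proof
    assume "x \<in> N" then show "shear x \<in> N" using i f_in by (auto simp: shear_def intro!: lattice_add lattice_scale)
  next
    assume s: "shear x \<in> N"
    then have "m \<bullet> x \<in> \<int>" using i level_lo_hi(3) by metis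
    then have "shear x - (m \<bullet> x) *\<^sub>R f \<in> N" using s f_in by (intro lattice_diff lattice_scale)
    then show "x \<in> N" by (simp add: shear_def)
  qed
qed

lemma inj_shear: "inj shear"
proof (rule injI)
  fix x y assume e: "shear x = shear y"
  then have "m \<bullet> x = m \<bullet> y" by (metis level_lo_hi(3))
  then show "x = y" using e by (simp add: shear_def)
qed

lemma linear_shear: "linear shear"
  by (rule linearI) (simp_all add: shear_def inner_add_right algebra_simps)

lemma tilt_pos: "0 \<le> n \<bullet> f \<Longrightarrow> tilt n = n"
  by (simp add: tilt_def)

lemma tilt_neg_shear: "n \<bullet> f \<le> 0 \<Longrightarrow> tilt n \<bullet> shear x = n \<bullet> x"
  by (simp add: tilt_def shear_def inner_add_right inner_diff_left mf)

lemma tilt_f: "tilt n \<bullet> f = n \<bullet> f"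
  by (simp add: tilt_def inner_diff_left mf)

lemma tilt_inj: "tilt n = tilt n' \<Longrightarrow> n = n'"
proof -
  assume e: "tilt n = tilt n'"
  then have "n \<bullet> f = n' \<bullet> f" by (metis tilt_f)
  then show ?thesis using e by (simp add: tilt_def)
qed

lemma tilt_surj: "\<exists>n. k = tilt n"
proof
  have "(k + min (k \<bullet> f) 0 *\<^sub>R m) \<bullet> f = k \<bullet> f" by (simp add: inner_add_left mf)
  then show "k = tilt (k + min (k \<bullet> f) 0 *\<^sub>R m)" by (simp add: tilt_def)
qed

lemma tilt_primitive: "primitive M (tilt n) \<longleftrightarrow> primitive M n"
proof -
  have 1: "primitive M (n + t *\<^sub>R m)" if n: "primitive M n" and t: "t = n \<bullet> f \<or> t = - (n \<bullet> f)" for n t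
  proof -
    have "primitive M (n + (c * (f \<bullet> n)) *\<^sub>R m)" if "c \<in> \<int>" for c
      using planar_lattice.primitive_shift[OF dual n m_in(1), of f c] that mf f_in(1) by (simp add: dual_dual inner_commute)
    from this[of 1] this[of "-1"] show ?thesis using t by (auto simp: inner_commute)
  qed
  show ?thesis
  proof (cases "n \<bullet> f \<ge> 0")
    case False
    then have t: "tilt n = n + (- (n \<bullet> f)) *\<^sub>R m" by (simp add: tilt_def)
    \<comment> \<open>\<open>tilt\<close> preserves the pairing with \<open>f\<close>, so its
      inverse is a shear of the same form and primitivity passes back.\<close>
    then have "n = tilt n + (n \<bullet> f) *\<^sub>R m" by simp
    then have "n = tilt n + (tilt n \<bullet> f) *\<^sub>R m" by (simp only: tilt_f)
    then show ?thesis using 1[of n "- (n \<bullet> f)"] 1[of "tilt n" "tilt n \<bullet> f"] t by metis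
  qed (simp add: tilt_pos)
qed

lemma finite_YY: "finite (Y \<union> lo ` Y)" "finite (Y \<union> hi ` Y)" "finite Y"
  using Y by auto

text \<open>Moving along \<open>f\<close> does not decrease \<open>n\<close>, so neither
  \<open>lo\<close> nor \<open>hi\<close> produces a lower value than \<open>Y\<close>.\<close>

lemma support_pos:
  assumes "0 \<le> n \<bullet> f"
  shows "support P n = support (convex hull Y) n" "support Q n = support (convex hull Y) n"
proof -
  have "n \<bullet> y \<le> n \<bullet> lo y" "n \<bullet> y \<le> n \<bullet> hi y" for y
    using assms by (auto simp: lo_def hi_def inner_add_right)
  then show "support P n = support (convex hull Y) n" "support Q n = support (convex hull Y) n"
    unfolding P_hull_lo Q_hull_hi using Y_nonempty
    by (intro support_face_dominated(1) finite_YY; force)+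
qed

text \<open>The inequality is strict: at \<open>n \<bullet> f = 0\<close> moved and unmoved points
  tie and the faces of the two polygons differ, see \<open>level_faces\<close>.\<close>

lemma face_pos:
  assumes "0 < n \<bullet> f"
  shows "support_face P n = support_face (convex hull Y) n" "support_face Q n = support_face (convex hull Y) n"
proof -
  have le: "n \<bullet> y \<le> n \<bullet> lo y" "n \<bullet> y \<le> n \<bullet> hi y" for y
    using assms by (auto simp: lo_def hi_def inner_add_right)
  have "lo y = y \<or> n \<bullet> y < n \<bullet> lo y" "hi y = y \<or> n \<bullet> y < n \<bullet> hi y" for y
    unfolding lo_def hi_def by (rule inner_translate(1); use assms in simp)+
  then have st: "lo y \<notin> Y \<Longrightarrow> y \<in> Y \<Longrightarrow> n \<bullet> y < n \<bullet> lo y" "hi y \<notin> Y \<Longrightarrow> y \<in> Y \<Longrightarrow> n \<bullet> y < n \<bullet> hi y" for y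
    by metis+
  show "support_face P n = support_face (convex hull Y) n"
    unfolding P_hull_lo using Y_nonempty le st by (intro support_face_dominated(2) finite_YY) force+
  show "support_face Q n = support_face (convex hull Y) n"
    unfolding Q_hull_hi using Y_nonempty le st by (intro support_face_dominated(2) finite_YY) force+
qed

lemma hull_hi: "convex hull (hi ` Y) = shear ` (convex hull (lo ` Y))"
proof -
  have "hi ` Y = shear ` (lo ` Y)" by (auto simp: hi_eq_shear_lo)
  then show ?thesis using convex_hull_linear_image[OF linear_shear] by simp
qed

text \<open>Now the moved copies are lowest, \<open>lo\<close>
  Y\<open>in\<close>P\<open>and\<close>hi \<open>Y\<close> in \<open>Q\<close>; the shear carries
  one to the other and \<open>tilt\<close> compensates it.\<close>

lemma support_neg_side:
  assumes "n \<bullet> f \<le> 0" shows "support Q (tilt n) = support P n"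
proof -
  have "n \<bullet> lo y \<le> n \<bullet> y" for y
    using assms by (auto simp: lo_def inner_add_right intro: mult_nonneg_nonpos)
  then have 1: "support P n = support (convex hull (lo ` Y)) n"
    unfolding P_hull_lo using Y_nonempty by (intro support_face_dominated(1) finite_YY) force+
  have "tilt n \<bullet> hi y \<le> tilt n \<bullet> y" for y
    using assms by (auto simp: hi_def inner_add_right tilt_f intro: mult_nonneg_nonpos)
  then have 2: "support Q (tilt n) = support (convex hull (hi ` Y)) (tilt n)"
    unfolding Q_hull_hi using Y_nonempty by (intro support_face_dominated(1) finite_YY) force+
  show ?thesis unfolding 1 2 hull_hi using support_face_image(1) tilt_neg_shear[OF assms] by blast
qed

lemma support_tilt: "support Q (tilt n) = support P n"
  using support_neg_side[of n] support_pos[of n] tilt_pos[of n] by (cases "n \<bullet> f \<le> 0") auto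

lemma height_tilt: "height Q (tilt n) = height P n"
  by (simp add: height_def support_tilt)

lemma face_neg:
  assumes "n \<bullet> f < 0" shows "support_face Q (tilt n) = shear ` support_face P n"
proof -
  have "lo y = y \<or> n \<bullet> lo y < n \<bullet> y" for y
    unfolding lo_def by (rule inner_translate(2)) (use assms in auto)
  then have lo: "n \<bullet> lo y \<le> n \<bullet> y" "lo y = y \<or> n \<bullet> lo y < n \<bullet> y" for y by (metis less_eq_real_def)+
  then have "y \<notin> lo ` Y \<Longrightarrow> y \<in> Y \<Longrightarrow> n \<bullet> lo y < n \<bullet> y" for y by (metis imageI)
  then have 1: "support_face P n = support_face (convex hull (lo ` Y)) n"
    unfolding P_hull_lo using Y_nonempty lo(1) by (intro support_face_dominated(2) finite_YY) force+
  have "hi y = y \<or> tilt n \<bullet> hi y < tilt n \<bullet> y" for y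
    unfolding hi_def by (rule inner_translate(2)) (use assms in \<open>auto simp: tilt_f\<close>)
  then have hi: "tilt n \<bullet> hi y \<le> tilt n \<bullet> y" "hi y = y \<or> tilt n \<bullet> hi y < tilt n \<bullet> y" for y by (metis less_eq_real_def)+
  then have "y \<notin> hi ` Y \<Longrightarrow> y \<in> Y \<Longrightarrow> tilt n \<bullet> hi y < tilt n \<bullet> y" for y by (metis imageI)
  then have 2: "support_face Q (tilt n) = support_face (convex hull (hi ` Y)) (tilt n)"
    unfolding Q_hull_hi using Y_nonempty hi(1) by (intro support_face_dominated(2) finite_YY) force+
  show ?thesis unfolding 1 2 hull_hi
    using support_face_image(2)[of "tilt n" shear n] tilt_neg_shear assms by simp
qed

lemma edge_width_tilt:
  assumes "n \<bullet> f \<noteq> 0" shows "edge_width N Q (tilt n) = edge_width N P n"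
proof (cases "n \<bullet> f > 0")
  case True
  then show ?thesis using face_pos[OF True] tilt_pos[of n] by (simp add: edge_width_def)
next
  case False
  then have "support_face Q (tilt n) \<inter> N = shear ` (support_face P n \<inter> N)"
    using face_neg assms lattice_lo_hi(3) by auto
  then have "card (support_face Q (tilt n) \<inter> N) = card (support_face P n \<inter> N)"
    using card_image[OF inj_on_subset[OF inj_shear subset_UNIV]] by metis
  then show ?thesis by (simp add: edge_width_def)
qed

lemma level_faces:
  assumes k: "k = m \<or> k = - m"
  defines "A \<equiv> {y \<in> Y. k \<bullet> y = support P k}"
  shows "support_face P k = convex hull (A \<union> lo ` A)" "support_face Q k = convex hull (A \<union> hi ` A)" "A \<noteq> {}"
    "support Q k = support P k"
proof -
  have lev: "k \<bullet> lo y = k \<bullet> y" "k \<bullet> hi y = k \<bullet> y" for y using k level_lo_hi by auto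
  have k0: "k \<bullet> f = 0" using k mf by auto
  then have Y0: "support P k = support (convex hull Y) k" "support Q k = support (convex hull Y) k"
    using support_pos[of k] by auto
  then show QP: "support Q k = support P k" by simp
  have "Min ((\<bullet>) k ` Y) \<in> (\<bullet>) k ` Y" using Y Y_nonempty by auto
  then obtain y where y: "y \<in> Y" "k \<bullet> y = Min ((\<bullet>) k ` Y)" by auto
  then have "support (convex hull Y) k = k \<bullet> y"
    using Y by (intro support_face_convex_hull(1)) auto
  then have yy: "k \<bullet> y = support P k" "\<And>z. z \<in> Y \<Longrightarrow> support P k \<le> k \<bullet> z" using Y0 y Y by auto
  then show "A \<noteq> {}" using y by (auto simp: A_def)
  have "support_face P k = convex hull {v \<in> Y \<union> lo ` Y. k \<bullet> v = support P k}"
    unfolding P_hull_lo using yy y lev Y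
    by (intro support_face_convex_hull(2)) (auto simp: P_hull_lo[symmetric])
  also have "{v \<in> Y \<union> lo ` Y. k \<bullet> v = support P k} = A \<union> lo ` A" using lev by (auto simp: A_def)
  finally show "support_face P k = convex hull (A \<union> lo ` A)" .
  have "support_face Q k = convex hull {v \<in> Y \<union> hi ` Y. k \<bullet> v = support P k}"
    unfolding Q_hull_hi using yy y lev Y
    by (intro support_face_convex_hull(2)) auto
  also have "{v \<in> Y \<union> hi ` Y. k \<bullet> v = support P k} = A \<union> hi ` A" using lev by (auto simp: A_def)
  finally show "support_face Q k = convex hull (A \<union> hi ` A)" .
qed

text \<open>On the lowest level \<open>hi\<close> is the identity, while \<open>lo\<close> moves by
  the height. The face of \<open>P\<close> is therefore the face of \<open>Q\<close> prolonged by
  \<open>height P m\<close>; at \<open>- m\<close> the roles are exchanged.\<close>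

lemma edge_width_m: "edge_width N Q m = edge_width N P m - height P m"
proof -
  define A where "A = {y \<in> Y. m \<bullet> y = support P m}"
  note F = level_faces[of m, folded A_def, simplified]
  have h: "of_int (height P m) = - support P m" "height P m > 0" using height_eq height_pos m_in by auto
  have lev: "\<And>y. y \<in> A \<Longrightarrow> m \<bullet> y = - of_int (height P m)" using h by (simp add: A_def)
  have lo: "lo ` A = (\<lambda>y. y + of_int (height P m) *\<^sub>R f) ` A"
    using lev h(2) by (intro image_cong) (auto simp: lo_def)
  have "hi ` A = (\<lambda>y. y) ` A" using lev h(2) by (intro image_cong) (auto simp: hi_def)
  then have hi: "A \<union> hi ` A = A" by simp
  have A: "A \<subseteq> N" "finite A" using Y by (auto simp: A_def)
  show ?thesis
    using card_lattice_strip[OF A F(3) m f mf lev less_imp_le[OF h(2)]]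
    by (simp add: edge_width_def F lo hi)
qed

lemma edge_width_minus_m: "edge_width N Q (- m) = edge_width N P (- m) + height P (- m)"
proof -
  define A where "A = {y \<in> Y. (- m) \<bullet> y = support P (- m)}"
  note F = level_faces[of "- m", folded A_def]
  have h: "of_int (height P (- m)) = - support P (- m)" "height P (- m) > 0" using height_eq height_pos m_in by auto
  have lev: "\<And>y. y \<in> A \<Longrightarrow> m \<bullet> y = of_int (height P (- m))" using h by (simp add: A_def)
  have hi: "hi ` A = (\<lambda>y. y + of_int (height P (- m)) *\<^sub>R f) ` A"
    using lev h(2) by (intro image_cong) (auto simp: hi_def)
  have "lo ` A = (\<lambda>y. y) ` A" using lev h(2) by (intro image_cong) (auto simp: lo_def)
  then have lo: "A \<union> lo ` A = A" by simp
  have A: "A \<subseteq> N" "finite A" using Y by (auto simp: A_def)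
  show ?thesis
    using card_lattice_strip[OF A F(3) m f mf lev less_imp_le[OF h(2)]]
    by (simp add: edge_width_def F lo hi)
qed

lemma tilt_m: "tilt m = m" "tilt (- m) = - m"
  by (simp_all add: tilt_def mf)

text \<open>Every functional is a tilt, so the support function of \<open>Q\<close> inherits
  negativity in all nonzero directions; this excludes separating 0 from the interior.\<close>

lemma zero_interior_Q: "0 \<in> interior Q"
proof -
  have Q: "convex Q" "compact Q" "Q \<noteq> {}" using Y_nonempty finite_YY by (auto simp: Q_hull_hi finite_imp_compact_convex_hull)
  have neg: "\<exists>x\<in>Q. k \<bullet> x < 0" if k: "k \<noteq> 0" for k
  proof -
    obtain n where n: "k = tilt n" using tilt_surj by blast
    then have "n \<noteq> 0" using k by (auto simp: tilt_def)
    then have "support Q k < 0" using support_tilt[of n] support_neg n by simp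
    then show ?thesis using support_attained[OF Q(2,3), of k] by metis
  qed
  \<comment> \<open>A planar convex set without interior lies on a line
    \<open>a \<bullet> x = b\<close>, where \<open>a\<close> cannot take both signs.\<close>
  have ne: "interior Q \<noteq> {}"
  proof
    assume "interior Q = {}"
    then obtain a b where ab: "a \<noteq> 0" "Q \<subseteq> {x. a \<bullet> x = b}" using empty_interior_subset_hyperplane[OF Q(1)] by metis
    obtain x y where xy: "x \<in> Q" "a \<bullet> x < 0" "y \<in> Q" "(- a) \<bullet> y < 0" using neg[of a] neg[of "- a"] ab(1) by auto
    then have "a \<bullet> x = b" "a \<bullet> y = b" using ab(2) by auto
    then show False using xy by simp
  qed
  show ?thesis
  proof (rule ccontr)
    assume "0 \<notin> interior Q"
    then obtain a b where ab: "a \<noteq> 0" "\<forall>x\<in>interior Q. a \<bullet> x \<le> b" "\<forall>x\<in>{0}. a \<bullet> x \<ge> b"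
      using separating_hyperplane_sets[of "interior Q" "{0}"] ne convex_interior[OF Q(1)] by auto
    have "closure (interior Q) \<subseteq> {x. a \<bullet> x \<le> b}"
      using ab(2) by (intro closure_minimal closed_halfspace_le) auto
    then have "Q \<subseteq> {x. a \<bullet> x \<le> b}"
      using convex_closure_interior[OF Q(1) ne] closure_subset by blast
    moreover obtain x where "x \<in> Q" "(- a) \<bullet> x < 0" using neg[of "- a"] ab(1) by auto
    moreover have "b \<le> 0" using ab(3) by simp
    ultimately show False by force
  qed
qed

text \<open>A vertex exposed by \<open>k\<close> with \<open>k \<bullet> f \<noteq> 0\<close> is a
  vertex of \<open>P\<close> or the shear of one. The obstacle is an exposing functional that
  vanishes on \<open>f\<close>, where the faces do not correspond.\<close>

lemma verts_Q_primitive: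
  assumes v: "v \<in> verts Q" shows "primitive N v"
proof -
  have poly: "polyhedron Q" unfolding Q_hull_hi using finite_YY by (simp add: polyhedron_convex_hull)
  have vX: "v \<in> Y \<union> hi ` Y" using v extreme_point_of_convex_hull unfolding verts_def Q_hull_hi by blast
  have "{v} face_of Q" using v by (simp add: verts_def face_of_singleton)
  then obtain a b where ab: "Q \<subseteq> {x. a \<bullet> x \<le> b}" "{v} = Q \<inter> {x. a \<bullet> x = b}"
    using exposed_face_of_polyhedron[OF poly, of "{v}"] unfolding exposed_face_of_def by blast
  define V where "V = Y \<union> hi ` Y - {v}"
  have "a \<bullet> x < a \<bullet> v" if "x \<in> V" for x
  proof -
    have "x \<in> Q" "x \<noteq> v" using that by (auto simp: V_def Q_hull_hi hull_inc)
    moreover have "a \<bullet> v = b" using ab(2) by blast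
    moreover have "a \<bullet> x \<noteq> b" using ab(2) calculation(1,2) by blast
    moreover have "a \<bullet> x \<le> b" using ab(1) calculation(1) by blast
    ultimately show ?thesis by simp
  qed
  then have lt: "(- a) \<bullet> v < (- a) \<bullet> x" if "x \<in> V" for x using that by simp
  have "\<exists>k. k \<bullet> f \<noteq> 0 \<and> (\<forall>x\<in>V. k \<bullet> v < k \<bullet> x)"
  proof (cases "a \<bullet> f = 0")
    case False
    then show ?thesis using lt by (intro exI[of _ "- a"]) auto
  next
    \<comment> \<open>Tilting the functional slightly towards \<open>f\<close> keeps the finitely
      many strict inequalities and makes its value on \<open>f\<close> nonzero.\<close>
    case True
    have "\<forall>\<^sub>F \<epsilon> in at_right (0::real). (- a + \<epsilon> *\<^sub>R f) \<bullet> v < (- a + \<epsilon> *\<^sub>R f) \<bullet> x" if x: "x \<in> V" for x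
    proof -
      have "((\<lambda>\<epsilon>. (- a + \<epsilon> *\<^sub>R f) \<bullet> x - (- a + \<epsilon> *\<^sub>R f) \<bullet> v) \<longlongrightarrow> (- a + 0 *\<^sub>R f) \<bullet> x - (- a + 0 *\<^sub>R f) \<bullet> v) (at_right 0)"
        by (intro tendsto_intros)
      moreover have "0 < (- a + 0 *\<^sub>R f) \<bullet> x - (- a + 0 *\<^sub>R f) \<bullet> v" using lt[OF x] by simp
      ultimately have "\<forall>\<^sub>F \<epsilon> in at_right (0::real). 0 < (- a + \<epsilon> *\<^sub>R f) \<bullet> x - (- a + \<epsilon> *\<^sub>R f) \<bullet> v"
        by (rule order_tendstoD(1))
      then show ?thesis by (rule eventually_mono) linarith
    qed
    moreover have "finite V" using finite_YY by (simp add: V_def)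
    ultimately have "\<forall>\<^sub>F \<epsilon> in at_right (0::real). \<forall>x\<in>V. (- a + \<epsilon> *\<^sub>R f) \<bullet> v < (- a + \<epsilon> *\<^sub>R f) \<bullet> x"
      by (simp add: eventually_ball_finite)
    then have "\<forall>\<^sub>F \<epsilon> in at_right (0::real). 0 < \<epsilon> \<and> (\<forall>x\<in>V. (- a + \<epsilon> *\<^sub>R f) \<bullet> v < (- a + \<epsilon> *\<^sub>R f) \<bullet> x)"
      using eventually_at_right_less by eventually_elim auto
    then obtain \<epsilon> :: real where "0 < \<epsilon>" "\<forall>x\<in>V. (- a + \<epsilon> *\<^sub>R f) \<bullet> v < (- a + \<epsilon> *\<^sub>R f) \<bullet> x"
      using eventually_happens trivial_limit_at_right_real by (metis (mono_tags, lifting))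
    then show ?thesis using True f_in(2) by (intro exI[of _ "- a + \<epsilon> *\<^sub>R f"]) (auto simp: inner_add_left inner_diff_left)
  qed
  then obtain k where k: "k \<bullet> f \<noteq> 0" "\<And>x. x \<in> V \<Longrightarrow> k \<bullet> v < k \<bullet> x" by blast
  have le: "k \<bullet> v \<le> k \<bullet> x" if "x \<in> Y \<union> hi ` Y" for x using k(2)[of x] that by (cases "x = v") (auto simp: V_def)
  have "support_face Q k = convex hull {x \<in> Y \<union> hi ` Y. k \<bullet> x = k \<bullet> v}"
    unfolding Q_hull_hi using le vX finite_YY by (intro support_face_convex_hull(2)) auto
  also have "{x \<in> Y \<union> hi ` Y. k \<bullet> x = k \<bullet> v} = {v}"
  proof (intro equalityI subsetI)
    fix x assume x: "x \<in> {x \<in> Y \<union> hi ` Y. k \<bullet> x = k \<bullet> v}"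
    then have "x \<notin> V" using k(2)[of x] by auto
    then show "x \<in> {v}" using x unfolding V_def by blast
  qed (use vX in blast)
  finally have fQ: "support_face Q k = {v}" by simp
  obtain n where n: "k = tilt n" using tilt_surj by blast
  then have nf: "n \<bullet> f \<noteq> 0" using k tilt_f by metis
  obtain z where z: "z \<in> verts P" "n \<bullet> z = support P n" using support_vertex .
  then have zF: "z \<in> support_face P n" and zp: "primitive N z" using verts_facts by (auto simp: support_face_def)
  show ?thesis
  proof (cases "0 < n \<bullet> f")
    case True
    then have "z = v" using face_pos[OF True] fQ n tilt_pos[of n] zF by auto
    then show ?thesis using zp by simp
  next
    case False
    then have "shear z = v" using face_neg[of n] nf fQ n zF by auto
    moreover have "primitive N (z + (1 * (m \<bullet> z)) *\<^sub>R f)"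
      by (rule primitive_shift[OF zp f_in(1) m_in(1) mf]) simp
    ultimately show ?thesis by (simp add: shear_def)
  qed
qed

lemma fano_Q: "fano_polygon N Q"
proof -
  have "lattice_polytope N Q" unfolding lattice_polytope_def Q_hull_hi
    using Y finite_YY lattice_lo_hi by blast
  moreover have "aff_dim Q = 2" using aff_dim_nonempty_interior[of Q] zero_interior_Q by auto
  ultimately show ?thesis using zero_interior_Q verts_Q_primitive by (simp add: fano_polygon_def)
qed

end

section \<open>Unit segments are factors\<close>

lemma dilate_segment:
  assumes "0 \<le> k" shows "dilate k (convex hull {0, f}) = {r *\<^sub>R f | r. 0 \<le> r \<and> r \<le> of_int k}"
proof -
  have "dilate k (convex hull {0, f}) = closed_segment (0 + 0 *\<^sub>R f) (0 + of_int k *\<^sub>R f)"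
    unfolding dilate_def segment_convex_hull
    by (simp add: convex_hull_scaling[symmetric])
  also have "\<dots> = {r *\<^sub>R f | r. 0 \<le> r \<and> r \<le> of_int k}"
    using assms by (subst closed_segment_on_line) auto
  finally show ?thesis .
qed

section \<open>From the definition of combinatorial mutation to the symmetric description; existence
  of remainders\<close>

context fano
begin

lemma slice_subset: "slice N P m h \<subseteq> P \<inter> {x. m \<bullet> x = of_int h}"
  unfolding slice_def using P_facts(2) by (intro hull_minimal convex_Int convex_hyperplane) auto

text \<open>Admits every choice of the remainders, in particular the one made inside
  \<open>polygon_mut\<close>; the set \<open>Y\<close> may depend on the choice, the conclusions
  drawn from it do not.\<close>

lemma mutation_of_remainders:
  assumes m: "primitive M m" and f: "primitive N f" and mf: "m \<bullet> f = 0" and F: "F = convex hull {0, f}"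
    and G: "\<forall>h<0. admissible_remainder N P m F h (G h)"
  shows "\<exists>Y. mutation N b1 b2 c1 c2 P m f Y
    (convex hull ((\<Union>h\<in>{..<0}. G h) \<union> (\<Union>h\<in>{0..}. slice N P m h + dilate h F)))"
proof -
  define R where "R = (\<Union>h\<in>{..<0}. G h) \<union> (\<Union>h\<in>{0..}. slice N P m h + dilate h F)"
  define Y where "Y = N \<inter> ((\<Union>h\<in>{..<0}. G h) \<union> (\<Union>h\<in>{0..}. {x \<in> P. m \<bullet> x = of_int h}))"
  let ?lo = "\<lambda>y. y + max (- (m \<bullet> y)) 0 *\<^sub>R f" and ?hi = "\<lambda>y. y + max (m \<bullet> y) 0 *\<^sub>R f"
  have mM: "m \<in> M" using m primitive_in by blast
  have Gh: "G h \<subseteq> convex hull (G h \<inter> N)" "{x. m \<bullet> x = of_int h} \<inter> verts P \<subseteq> G h + dilate (- h) F"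
    "G h + dilate (- h) F \<subseteq> P \<inter> {x. m \<bullet> x = of_int h}" if "h < 0" for h
  proof -
    have a: "admissible_remainder N P m F h (G h)" using G that by blast
    then obtain V where V: "V \<subseteq> N" "G h = convex hull V" by (auto simp: admissible_remainder_def lattice_polytope_def)
    have "V \<subseteq> G h \<inter> N" using V hull_subset[of V convex] by auto
    then have "convex hull V \<subseteq> convex hull (G h \<inter> N)" by (rule hull_mono)
    then show "G h \<subseteq> convex hull (G h \<inter> N)" using V(2) by simp
    show "{x. m \<bullet> x = of_int h} \<inter> verts P \<subseteq> G h + dilate (- h) F"
      using a that by (simp add: admissible_remainder_def)
    have "G h + dilate (- h) F \<subseteq> slice N P m h"
      using a that by (simp add: admissible_remainder_def)
    then show "G h + dilate (- h) F \<subseteq> P \<inter> {x. m \<bullet> x = of_int h}" using slice_subset by blast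
  qed
  have Gsum: "g + r *\<^sub>R f \<in> P \<and> m \<bullet> g = of_int h" if "h < 0" "g \<in> G h" "0 \<le> r" "r \<le> - of_int h" for g r h
  proof -
    have "r *\<^sub>R f \<in> dilate (- h) F" unfolding F using that by (subst dilate_segment) auto
    then have "g + r *\<^sub>R f \<in> G h + dilate (- h) F" using that(2) by (rule set_plus_intro[rotated])
    then have "g + r *\<^sub>R f \<in> P" "m \<bullet> (g + r *\<^sub>R f) = of_int h" using Gh(3)[OF that(1)] by auto
    then show ?thesis by (simp add: inner_add_right mf)
  qed
  have YP: "Y \<subseteq> P"
  proof
    fix y assume "y \<in> Y"
    then consider h where "h < 0" "y \<in> G h" | "y \<in> P" by (auto simp: Y_def)
    then show "y \<in> P"
    proof cases
      case 1
      then show ?thesis using Gsum[of h y 0] by simp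
    qed
  qed
  have Ylev: "(\<exists>h<0. y \<in> G h \<and> m \<bullet> y = of_int h) \<or> (\<exists>h\<ge>0. y \<in> P \<and> m \<bullet> y = of_int h)" if "y \<in> Y" for y
  proof -
    have "(\<exists>h<0. y \<in> G h) \<or> (\<exists>h\<ge>0. y \<in> P \<and> m \<bullet> y = of_int h)" using that by (auto simp: Y_def)
    then show ?thesis using Gsum[of _ y 0] by fastforce
  qed
  have GY: "G h \<inter> N \<subseteq> Y" if "h < 0" for h using that by (auto simp: Y_def)
  have finY: "finite Y" using finite_bounded_lattice[OF P_facts(5)]
    by (rule rev_finite_subset) (use YP in \<open>auto simp: Y_def\<close>)
  have loP: "?lo y \<in> P" if y: "y \<in> Y" for y
  proof -
    consider h where "h < 0" "y \<in> G h" "m \<bullet> y = of_int h" | "y \<in> P" "m \<bullet> y \<ge> 0" using Ylev[OF y] by auto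
    then show ?thesis
    proof cases
      case 1 then show ?thesis using Gsum[of h y "- of_int h"] by simp
    qed simp
  qed
  have stripG: "g + r *\<^sub>R f \<in> convex hull (Y \<union> ?lo ` Y)"
    if "h < 0" "g \<in> G h" "0 \<le> r" "r \<le> - of_int h" for g r h
  proof (rule strip_in_convex_hull)
    show "g \<in> convex hull (G h \<inter> N)" using Gh(1) that by blast
    show "0 \<le> r" "r \<le> - of_int h" using that by auto
    show "G h \<inter> N \<subseteq> Y \<union> ?lo ` Y" using GY that by blast
    show "(\<lambda>y. y + (- of_int h) *\<^sub>R f) ` (G h \<inter> N) \<subseteq> Y \<union> ?lo ` Y"
    proof
      fix x assume "x \<in> (\<lambda>y. y + (- of_int h) *\<^sub>R f) ` (G h \<inter> N)"
      then obtain y where y: "y \<in> G h \<inter> N" "x = y + (- of_int h) *\<^sub>R f" by blast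
      then have "m \<bullet> y = of_int h" using Gsum[of h y 0] that(1) by simp
      then have "x = ?lo y" using y that by simp
      then show "x \<in> Y \<union> ?lo ` Y" using y GY[OF that(1)] by blast
    qed
  qed
  have P_eq: "P = convex hull (Y \<union> ?lo ` Y)"
  proof
    show "convex hull (Y \<union> ?lo ` Y) \<subseteq> P" using YP loP P_facts(2) by (intro hull_minimal) auto
    \<comment> \<open>Admissibility puts each vertex below level 0 on a strip
      \<open>G h + dilate (- h) F\<close>, which \<open>stripG\<close> covers; the other vertices
      belong to \<open>Y\<close>.\<close>
    have "verts P \<subseteq> convex hull (Y \<union> ?lo ` Y)"
    proof
      fix v assume v: "v \<in> verts P"
      then have vN: "v \<in> N" "v \<in> P" using verts_facts primitive_in by auto
      then obtain h where h: "m \<bullet> v = of_int h" using inner_Ints[OF mM] by (metis Ints_cases)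
      show "v \<in> convex hull (Y \<union> ?lo ` Y)"
      proof (cases "h < 0")
        case True
        then have "v \<in> G h + dilate (- h) F" using Gh(2)[OF True] v h by auto
        then obtain g r where "g \<in> G h" "0 \<le> r" "r \<le> of_int (- h)" "v = g + r *\<^sub>R f"
          unfolding F using True by (subst (asm) dilate_segment) (auto simp: set_plus_def)
        then show ?thesis using stripG[OF True, of g r] by simp
      next
        case False
        then have "v \<in> Y" using vN h by (auto simp: Y_def)
        then show ?thesis by (simp add: hull_inc)
      qed
    qed
    then show "P \<subseteq> convex hull (Y \<union> ?lo ` Y)"
      by (subst verts_facts(4)) (simp add: hull_minimal)
  qed
  have R_eq: "convex hull R = convex hull (Y \<union> ?hi ` Y)"
  proof
    have "R \<subseteq> convex hull (Y \<union> ?hi ` Y)"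
    proof
      fix x assume "x \<in> R"
      then consider h where "h < 0" "x \<in> G h" | h where "h \<ge> 0" "x \<in> slice N P m h + dilate h F" by (auto simp: R_def)
      then show "x \<in> convex hull (Y \<union> ?hi ` Y)"
      proof cases
        case 1
        then have "x \<in> convex hull (G h \<inter> N)" using Gh(1) by blast
        moreover have "G h \<inter> N \<subseteq> Y \<union> ?hi ` Y" using GY[OF 1(1)] by blast
        ultimately show ?thesis using hull_mono[of "G h \<inter> N" "Y \<union> ?hi ` Y" convex] by blast
      next
        case 2
        let ?A = "{x. m \<bullet> x = of_int h} \<inter> P \<inter> N"
        have AY: "?A \<subseteq> Y" using 2(1) by (auto simp: Y_def)
        obtain g r where g: "g \<in> convex hull ?A" "0 \<le> r" "r \<le> of_int h" "x = g + r *\<^sub>R f"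
          using 2(2) unfolding F slice_def by (subst (asm) dilate_segment[OF 2(1)]) (auto simp: set_plus_def)
        have "(\<lambda>y. y + of_int h *\<^sub>R f) ` ?A \<subseteq> Y \<union> ?hi ` Y"
        proof
          fix z assume "z \<in> (\<lambda>y. y + of_int h *\<^sub>R f) ` ?A"
          then obtain y where y: "y \<in> ?A" "z = y + of_int h *\<^sub>R f" by blast
          then have "z = ?hi y" using 2(1) by simp
          then show "z \<in> Y \<union> ?hi ` Y" using y AY by blast
        qed
        then show ?thesis unfolding g(4) using AY by (intro strip_in_convex_hull[OF g(1-3)]) auto
      qed
    qed
    then show "convex hull R \<subseteq> convex hull (Y \<union> ?hi ` Y)" by (intro hull_minimal) auto
    have "Y \<union> ?hi ` Y \<subseteq> R"
    proof -
      have "y \<in> R \<and> ?hi y \<in> R" if y: "y \<in> Y" for y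
      proof -
        consider h where "h < 0" "y \<in> G h" "m \<bullet> y = of_int h" | h where "h \<ge> 0" "y \<in> P" "m \<bullet> y = of_int h"
          using Ylev[OF y] by blast
        then show ?thesis
        proof cases
          case 1
          then show ?thesis by (auto simp: R_def)
        next
          case 2
          have "y \<in> slice N P m h" unfolding slice_def using 2 y by (intro hull_inc) (auto simp: Y_def)
          moreover have "0 *\<^sub>R f \<in> dilate h F" "of_int h *\<^sub>R f \<in> dilate h F"
            unfolding F using 2(1) by (subst dilate_segment; fastforce)+
          ultimately have "y + 0 *\<^sub>R f \<in> slice N P m h + dilate h F" "y + of_int h *\<^sub>R f \<in> slice N P m h + dilate h F"
            using set_plus_intro by blast+
          then have "y + 0 *\<^sub>R f \<in> R" "y + of_int h *\<^sub>R f \<in> R" using 2(1) unfolding R_def by blast+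
          then show ?thesis using 2 by simp
        qed
      qed
      then show ?thesis by blast
    qed
    then show "convex hull (Y \<union> ?hi ` Y) \<subseteq> convex hull R" by (rule hull_mono)
  qed
  have "Y \<subseteq> N" by (simp add: Y_def)
  then have "mutation N b1 b2 c1 c2 P m f Y (convex hull R)"
    by (intro mutation.intro mutation_axioms.intro fano_axioms m f mf finY P_eq R_eq)
  then show ?thesis unfolding R_def by blast
qed

text \<open>Shrinking the lowest edge towards the origin to level \<open>h\<close> leaves a segment
  in \<open>P\<close> of length at least |h|, because the edge is at least as long as its height. A
  vertex on that level cannot be inside this segment, so from it there is room of length |h| in the
  direction of the segment.\<close>

lemma factor_exists:
  assumes m: "primitive M m" and f: "primitive N f" and mf: "m \<bullet> f = 0" and F: "F = convex hull {0, f}"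
    and w: "height P m \<le> edge_width N P m"
  shows "is_factor N P m F"
proof -
  have mM: "m \<in> M" "m \<noteq> 0" using m primitive_in primitive_nz by auto
  have l: "0 < height P m" using height_pos mM by blast
  then have "m \<in> edge_normals N P" using w m by (simp add: edge_normals_def)
  then obtain u v where uv: "support_face P m = closed_segment u v" "u \<noteq> v" "u \<in> verts P" "v \<in> verts P"
    "m \<bullet> u = - of_int (height P m)" "m \<bullet> v = - of_int (height P m)" using edge_segment by metis
  \<comment> \<open>\<open>p\<close> is the end from which \<open>f\<close> points along the
    edge.\<close>
  obtain p W where p: "p \<in> P" "m \<bullet> p = - of_int (height P m)" "p + W *\<^sub>R f \<in> P" "of_int (height P m) \<le> W"
  proof -
    have N: "u \<in> N" "v \<in> N" using uv verts_facts primitive_in by auto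
    obtain d k where d: "primitive N d" "k > 0" "v - u = of_nat k *\<^sub>R d"
      using lattice_multiple_primitive[of "v - u"] lattice_diff N uv(2) by (metis right_minus_eq)
    have vk: "v = u + of_nat k *\<^sub>R d" using d(3) by (simp add: algebra_simps)
    then have "edge_width N P m = int k"
      using card_lattice_segment[OF N(1) d(1), of k] by (simp add: edge_width_def uv(1))
    then have kl: "of_int (height P m) \<le> (of_nat k :: real)" using w by linarith
    have "m \<bullet> (v - u) = 0" using uv by (simp add: inner_diff_right)
    then have "m \<bullet> d = 0" using d by auto
    then have "d = f \<or> d = - f" using orthogonal_primitive[OF m d(1)] orthogonal_primitive[OF m f mf] by auto
    then show thesis
    proof
      assume "d = f" then show thesis using that[of u "of_nat k"] uv verts_facts(1) vk kl by simp
    next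
      assume "d = - f"
      then have "u = v + of_nat k *\<^sub>R f" using vk by simp
      then show thesis using that[of v "of_nat k"] uv verts_facts(1) kl by metis
    qed
  qed
  have adm: "\<exists>G. admissible_remainder N P m F h G" if h: "h < 0" for h
  proof -
    \<comment> \<open>The lattice points from which a segment of length |h| in direction
      \<open>f\<close> fits into \<open>P\<close>; any remainder has its lattice points
      here.\<close>
    define A where "A = {y \<in> P \<inter> N. m \<bullet> y = of_int h \<and> y + (- of_int h) *\<^sub>R f \<in> P}"
    have finA: "finite A" using finite_bounded_lattice[OF P_facts(5)]
      by (rule rev_finite_subset) (auto simp: A_def)
    have dil: "dilate \<bar>h\<bar> F = {r *\<^sub>R f | r. 0 \<le> r \<and> r \<le> of_int (- h)}"
      unfolding F using h by (subst dilate_segment) auto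
    have "lattice_polytope N (convex hull A)" unfolding lattice_polytope_def using finA by (auto simp: A_def)
    moreover have "convex hull A + dilate \<bar>h\<bar> F \<subseteq> slice N P m h"
    proof
      fix x assume "x \<in> convex hull A + dilate \<bar>h\<bar> F"
      then obtain g r where g: "g \<in> convex hull A" "0 \<le> r" "r \<le> of_int (- h)" "x = g + r *\<^sub>R f"
        unfolding dil by (auto simp: set_plus_def)
      have "f \<in> N" using f primitive_in by blast
      then show "x \<in> slice N P m h"
        unfolding slice_def g(4)
        by (intro strip_in_convex_hull[OF g(1-3)])
           (auto simp: A_def inner_diff_right mf intro!: lattice_diff lattice_scale)
    qed
    moreover have "{x. m \<bullet> x = of_int h} \<inter> verts P \<subseteq> convex hull A + dilate \<bar>h\<bar> F"
    proof
      fix x assume "x \<in> {x. m \<bullet> x = of_int h} \<inter> verts P"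
      then have x: "m \<bullet> x = of_int h" "x extreme_point_of P" "x \<in> P" "x \<in> N"
        using verts_facts primitive_in by (auto simp: verts_def)
      \<comment> \<open>The scaling that takes the lowest level to level \<open>h\<close>.\<close>
      define c :: real where "c = - of_int h / of_int (height P m)"
      have "- of_int (height P m) \<le> m \<bullet> x" using support_le[OF x(3), of m] height_eq[OF mM(1)] by linarith
      then have c: "0 < c" "c \<le> 1" "c * of_int (height P m) = - of_int h"
        using h l x(1) by (auto simp: c_def field_simps)
      define a where "a = c *\<^sub>R p"
      have cP: "c *\<^sub>R y \<in> P" if "y \<in> P" for y
        using convexD_alt[OF P_facts(2) zero_in that, of c] c by simp
      have aP: "a \<in> P" "a + (c * W) *\<^sub>R f \<in> P" using cP[OF p(1)] cP[OF p(3)] by (simp_all add: a_def scaleR_add_right)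
      have cW: "- of_int h \<le> c * W" using p(4) c by (metis mult_left_mono less_imp_le)
      have "m \<bullet> a = of_int h" using p(2) c(3) by (simp add: a_def)
      then have "m \<bullet> (x - a) = 0" using x(1) by (simp add: inner_diff_right)
      then obtain s where "x - a = s *\<^sub>R f" using orthogonal_multiple_of_primitive[OF m f mf] by blast
      then have s: "x = a + s *\<^sub>R f" by (simp add: algebra_simps)
      have line: "a + r *\<^sub>R f \<in> P" if "a + i *\<^sub>R f \<in> P" "a + j *\<^sub>R f \<in> P" "i \<le> r" "r \<le> j" for r i j
      proof -
        have "a + r *\<^sub>R f \<in> closed_segment (a + i *\<^sub>R f) (a + j *\<^sub>R f)"
          using that by (subst closed_segment_on_line) auto
        then show ?thesis using closed_segment_subset[OF that(1,2) P_facts(2)] by blast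
      qed
      have fN: "f \<in> N" using f primitive_in by blast
      have a0: "a + 0 *\<^sub>R f \<in> P" using aP by simp
      have xs: "a + s *\<^sub>R f \<in> P" using x s by simp
      \<comment> \<open>Position of the vertex relative to the shrunken edge: before it, the vertex
        itself starts a fitting segment; beyond it, the vertex ends one; strictly inside contradicts
        extremality.\<close>
      consider "s \<le> 0" | "0 < s" "s < c * W" | "c * W \<le> s" by linarith
      then show "x \<in> convex hull A + dilate \<bar>h\<bar> F"
      proof cases
        case 1
        have "a + (s - of_int h) *\<^sub>R f \<in> P"
          by (rule line[OF xs aP(2)]) (use 1 cW h in auto)
        then have "x \<in> A" using x s by (simp add: A_def algebra_simps)
        then have "x + 0 *\<^sub>R f \<in> convex hull A + dilate \<bar>h\<bar> F" unfolding dil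
          using h by (intro set_plus_intro hull_inc) fastforce+
        then show ?thesis by simp
      next
        case 2
        have "c * W \<noteq> 0" using 2 by linarith
        then have "x = (1 - s / (c * W)) *\<^sub>R a + (s / (c * W)) *\<^sub>R (a + (c * W) *\<^sub>R f)"
          using s by (simp add: scaleR_diff_left scaleR_add_right)
        moreover have "a \<noteq> a + (c * W) *\<^sub>R f" using 2 primitive_nz(1)[OF f] by auto
        moreover have "0 < s / (c * W)" "s / (c * W) < 1" using 2 by auto
        ultimately have "x \<in> open_segment a (a + (c * W) *\<^sub>R f)" unfolding in_segment by blast
        then show ?thesis using x(2) aP by (auto simp: extreme_point_of_def)
      next
        case 3
        have "a + (s + of_int h) *\<^sub>R f \<in> P"
          by (rule line[OF a0 xs]) (use 3 cW h in auto)
        then have "x + of_int h *\<^sub>R f \<in> P" using s by (simp add: algebra_simps)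
        then have "x + of_int h *\<^sub>R f \<in> A"
          using x fN by (auto simp: A_def inner_add_right mf intro!: lattice_add lattice_scale)
        then have "(x + of_int h *\<^sub>R f) + (- of_int h) *\<^sub>R f \<in> convex hull A + dilate \<bar>h\<bar> F" unfolding dil
          using h by (intro set_plus_intro hull_inc) fastforce+
        then show ?thesis by simp
      qed
    qed
    ultimately show ?thesis unfolding admissible_remainder_def by blast
  qed
  have "lattice_polytope N F" unfolding lattice_polytope_def F
    using f primitive_in(1) by (intro exI[of _ "{0, f}"]) auto
  moreover have "F \<subseteq> {x. m \<bullet> x = 0}" unfolding F
    using mf by (intro hull_minimal convex_hyperplane) auto
  ultimately show ?thesis using adm by (simp add: is_factor_def)
qed

end

section \<open>Mutation of the quiver\<close>

text \<open>Turns equal counts into the vertex bijection of an isomorphism, since arrows and labels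
  depend only on the type of a cone.\<close>

lemma fibrewise_bijection:
  assumes "finite A" "finite A'" and eq: "\<And>t. card {x \<in> A. p x = t} = card {y \<in> A'. q y = t}"
  shows "\<exists>\<phi>. bij_betw \<phi> A A' \<and> (\<forall>x\<in>A. q (\<phi> x) = p x)"
proof -
  have "\<exists>g. bij_betw g {x \<in> A. p x = t} {y \<in> A'. q y = t}" for t
    using assms by (intro finite_same_card_bij) auto
  then obtain g where g: "\<And>t. bij_betw (g t) {x \<in> A. p x = t} {y \<in> A'. q y = t}" by metis
  define \<phi> where "\<phi> x = g (p x) x" for x
  have im: "\<phi> x \<in> A' \<and> q (\<phi> x) = p x" if "x \<in> A" for x
    using bij_betwE[OF g[of "p x"]] that by (auto simp: \<phi>_def)
  have "inj_on \<phi> A"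
  proof (rule inj_onI)
    fix x y assume xy: "x \<in> A" "y \<in> A" "\<phi> x = \<phi> y"
    then have "p x = p y" using im by metis
    then show "x = y" using xy bij_betw_imp_inj_on[OF g[of "p y"]] by (auto simp: \<phi>_def inj_on_def)
  qed
  moreover have "A' \<subseteq> \<phi> ` A"
  proof
    fix y assume "y \<in> A'"
    then have "y \<in> g (q y) ` {x \<in> A. p x = q y}" using bij_betw_imp_surj_on[OF g[of "q y"]] by auto
    then obtain x where "x \<in> A" "p x = q y" "y = g (q y) x" by auto
    then have "y = \<phi> x" "x \<in> A" by (simp_all add: \<phi>_def)
    then show "y \<in> \<phi> ` A" by blast
  qed
  ultimately have "bij_betw \<phi> A A'" using im by (auto simp: bij_betw_def)
  then show ?thesis using im by blast
qed

text \<open>The truncated differences in the two directions recombine to the signed difference, so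
  cancelling 2-cycles is invisible here.\<close>

lemma signed_arrows_mut:
  "signed_arrows (dquiver_mut m Q) t h = int (premutation_arrows m Q t h) - int (premutation_arrows m Q h t)"
  by (simp add: signed_arrows_def dquiver_mut_def)

lemma (in planar_lattice) dual_det_eq:
  assumes B: "B = {(of_int p *\<^sub>R b1 + of_int q *\<^sub>R b2, of_int r *\<^sub>R b1 + of_int s *\<^sub>R b2) | p q r s :: int.
               p * s - q * r = 1}" and "k \<in> M" "n \<in> M"
  shows "of_int (dual_det B k n) = n \<bullet> perp k"
proof -
  have val: "(k \<bullet> x) * (n \<bullet> y) - (k \<bullet> y) * (n \<bullet> x) = n \<bullet> perp k" if xy: "(x, y) \<in> B" for x y
  proof -
    obtain p q r s :: int where pq: "x = of_int p *\<^sub>R b1 + of_int q *\<^sub>R b2" "y = of_int r *\<^sub>R b1 + of_int s *\<^sub>R b2"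
      "p * s - q * r = 1" using xy B by blast
    have "of_int p * of_int s - of_int q * of_int r = (1 :: real)" using pq(3) by (metis of_int_1 of_int_diff of_int_mult)
    \<comment> \<open>Changing the basis multiplies the determinant by p s - q r = 1.\<close>
    moreover have "(k \<bullet> x) * (n \<bullet> y) - (k \<bullet> y) * (n \<bullet> x) = (of_int p * of_int s - of_int q * of_int r) * (n \<bullet> perp k)"
      by (simp add: pq inner_perp inner_add_right algebra_simps)
    ultimately show ?thesis by simp
  qed
  have B0: "(b1, b2) \<in> B"
    unfolding B by (intro CollectI exI[of _ 1] exI[of _ 0]) simp
  have "n \<bullet> perp k \<in> \<int>" using inner_Ints[of k b1] inner_Ints[of k b2] inner_Ints[of n b1] inner_Ints[of n b2] assms
    by (auto simp: inner_perp)
  then obtain d where d: "n \<bullet> perp k = of_int d" by (auto elim: Ints_cases)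
  have "dual_det B k n = d" unfolding dual_det_def
  proof (rule the_equality)
    show "\<forall>(x, y)\<in>B. of_int d = (k \<bullet> x) * (n \<bullet> y) - (k \<bullet> y) * (n \<bullet> x)" using val d by auto
  next
    fix e assume "\<forall>(x, y)\<in>B. of_int e = (k \<bullet> x) * (n \<bullet> y) - (k \<bullet> y) * (n \<bullet> x)"
    then show "e = d" using val[OF B0] d B0 by auto
  qed
  then show ?thesis using d by simp
qed

text \<open>Of the orientation only the value of \<open>dual_det\<close> is retained. This
  hypothesis does not mention \<open>P\<close>, so it passes unchanged to the mutated
  polygon.\<close>

locale oriented_fano = fano +
  fixes B :: "((real^2) \<times> (real^2)) set"
  assumes orientation: "\<And>k n. k \<in> dual_lattice N \<Longrightarrow> n \<in> dual_lattice N \<Longrightarrow> of_int (dual_det B k n) = n \<bullet> perp k"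
begin

lemma nat_dual_det: "k \<in> M \<Longrightarrow> n \<in> M \<Longrightarrow> of_int (int (nat (dual_det B k n))) = max (n \<bullet> perp k) (0::real)"
  using orientation[of k n] by (cases "dual_det B k n \<ge> 0") auto

lemma edge_normal_in: "n \<in> edge_normals N P \<Longrightarrow> n \<in> M"
  using primitive_in by (auto simp: edge_normals_def)

text \<open>Outgoing arrows see the edges with positive pairing against \<open>perp m\<close>,
  incoming ones those on the opposite side of \<open>P\<close>. \<open>edge_level_sum\<close> gives
  the lattice width for both, so the quiver is balanced at this vertex.\<close>

lemma diameter_fan_quiver:
  assumes \<Sigma>: "standard_refinement N P \<Sigma>" and \<sigma>: "\<sigma> \<in> \<Sigma>"
  shows "diameter (fan_quiver N B \<Sigma>) \<sigma> = height P (inner_normal N \<sigma>) + height P (- inner_normal N \<sigma>)"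
proof -
  define m where "m = inner_normal N \<sigma>"
  note R = standard_refinement_types[OF \<Sigma>]
  have m: "primitive M m" "m \<in> M" using R(2)[OF \<sigma>] edge_normal_in by (auto simp: m_def edge_normals_def)
  have p: "primitive N (perp m)" "primitive N (- perp m)" using perp_primitive[OF m(1)] primitive_minus by auto
  have "out_weight (fan_quiver N B \<Sigma>) \<sigma> = (\<Sum>\<tau>\<in>\<Sigma>. width N \<tau> * int (nat (dual_det B m (inner_normal N \<tau>))))"
    by (simp add: out_weight_def fan_quiver_def m_def)
  also have "\<dots> = (\<Sum>n\<in>edge_normals N P. edge_width N P n * int (nat (dual_det B m n)))"
    by (rule R(4)[of "\<lambda>n. int (nat (dual_det B m n))"])
  finally have "of_int (out_weight (fan_quiver N B \<Sigma>) \<sigma>) =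
      (\<Sum>n\<in>edge_normals N P. of_int (edge_width N P n) * of_int (int (nat (dual_det B m n))) :: real)"
    by simp
  also have "\<dots> = (\<Sum>n\<in>edge_normals N P. of_int (edge_width N P n) * max (n \<bullet> perp m) 0)"
    using nat_dual_det[OF m(2) edge_normal_in] by (intro sum.cong) (simp_all only: refl)
  also have "\<dots> = of_int (height P m + height P (- m))" by (rule edge_level_sum[OF m(1) p(1)]) simp
  finally have out: "out_weight (fan_quiver N B \<Sigma>) \<sigma> = height P m + height P (- m)" by (simp only: of_int_eq_iff)
  have "in_weight (fan_quiver N B \<Sigma>) \<sigma> = (\<Sum>\<tau>\<in>\<Sigma>. width N \<tau> * int (nat (dual_det B (inner_normal N \<tau>) m)))"
    by (simp add: in_weight_def fan_quiver_def m_def)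
  also have "\<dots> = (\<Sum>n\<in>edge_normals N P. edge_width N P n * int (nat (dual_det B n m)))"
    by (rule R(4)[of "\<lambda>n. int (nat (dual_det B n m))"])
  finally have "of_int (in_weight (fan_quiver N B \<Sigma>) \<sigma>) =
      (\<Sum>n\<in>edge_normals N P. of_int (edge_width N P n) * of_int (int (nat (dual_det B n m))) :: real)"
    by simp
  also have "\<dots> = (\<Sum>n\<in>edge_normals N P. of_int (edge_width N P n) * max (n \<bullet> (- perp m)) 0)"
  proof (rule sum.cong)
    fix n assume "n \<in> edge_normals N P"
    then show "of_int (edge_width N P n) * of_int (int (nat (dual_det B n m))) = of_int (edge_width N P n) * max (n \<bullet> (- perp m)) 0"
      using nat_dual_det[OF edge_normal_in m(2)] inner_perp_swap[of m n] by (simp only: inner_minus_right)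
  qed simp
  also have "\<dots> = of_int (height P m + height P (- m))" by (rule edge_level_sum[OF m(1) p(2)]) simp
  finally have "in_weight (fan_quiver N B \<Sigma>) \<sigma> = height P m + height P (- m)" by (simp only: of_int_eq_iff)
  then show ?thesis unfolding diameter_def m_def[symmetric] using out by (intro the_equality) auto
qed

lemma fan_quiver_simps [simp]:
  "vertices (fan_quiver N B \<Sigma>) = \<Sigma>"
  "arrows (fan_quiver N B \<Sigma>) = (\<lambda>\<sigma> \<tau>. nat (dual_det B (inner_normal N \<sigma>) (inner_normal N \<tau>)))"
  "label (fan_quiver N B \<Sigma>) = (\<lambda>\<sigma>. (width N \<sigma>, local_index N \<sigma>))"
  by (simp_all add: fan_quiver_def)

lemma dual_det_minus: "k \<in> M \<Longrightarrow> n \<in> M \<Longrightarrow> dual_det B n k = - dual_det B k n"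
  using orientation[of k n] orientation[of n k] inner_perp_swap[of k n]
  by (metis of_int_eq_iff of_int_minus)

end

section \<open>Comparison of the mutated quiver with the quiver of the mutated polygon\<close>

locale oriented_mutation = mutation N b1 b2 c1 c2 P m f Y Q + oriented_fano N b1 b2 c1 c2 P B
  for N b1 b2 c1 c2 P m f Y Q B
begin

lemma oriented_Q: "oriented_fano N b1 b2 c1 c2 Q B"
  using fano_Q orientation by unfold_locales auto

text \<open>Fibrewise over the normal \<open>k = tilt n\<close>: at \<open>m\<close> the length
  drops by the height and \<sigma> leaves, at \<open>- m\<close> it grows by the height and \<sigma>
  arrives, elsewhere nothing changes.\<close>

lemma mutated_types:
  assumes \<Sigma>: "standard_refinement N P \<Sigma>" and \<Sigma>': "standard_refinement N Q \<Sigma>'"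
    and \<sigma>: "\<sigma> \<in> \<Sigma>" "inner_normal N \<sigma> = m" "width N \<sigma> = local_index N \<sigma>"
  shows "card {\<tau> \<in> \<Sigma>. (if \<tau> = \<sigma> then (- m, height P (- m)) else (tilt (inner_normal N \<tau>), width N \<tau>)) = t} =
    card {\<tau> \<in> \<Sigma>'. (inner_normal N \<tau>, width N \<tau>) = t}" (is "card ?L = card ?R")
proof -
  interpret Q: oriented_fano N b1 b2 c1 c2 Q B by (rule oriented_Q)
  note RP = standard_refinement_types[OF \<Sigma>] and RQ = Q.standard_refinement_types[OF \<Sigma>']
  obtain k w where t: "t = (k, w)" by fastforce
  have pm: "primitive M (- m)" using dual_primitive_minus m by blast
  have ws: "width N \<sigma> = height P m" using RP(2)[OF \<sigma>(1)] \<sigma> by simp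
  have h: "0 < height P m" "0 < height P (- m)" using height_pos m_in by auto
  show ?thesis
  proof (cases "primitive M k")
    case False
    have "inner_normal N \<tau> \<noteq> k" if "\<tau> \<in> \<Sigma>'" for \<tau>
      using RQ(2)[OF that] False by (auto simp: edge_normals_def)
    then have R: "?R = {}" by (auto simp: t)
    have "tilt (inner_normal N \<tau>) \<noteq> k" if "\<tau> \<in> \<Sigma>" for \<tau>
      using RP(2)[OF that] False tilt_primitive by (auto simp: edge_normals_def)
    then have L: "?L = {}" using pm False by (auto simp: t split: if_splits)
    show ?thesis by (simp only: L R)
  next
    case True
    obtain n where n: "k = tilt n" using tilt_surj by blast
    then have pn: "primitive M n" using True tilt_primitive by simp
    have R: "card ?R = width_multiplicity (edge_width N Q (tilt n)) (height P n) w"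
      using RQ(3)[OF True, of w] by (simp add: t n height_tilt)
    define A where "A = {\<tau> \<in> \<Sigma>. inner_normal N \<tau> = n \<and> width N \<tau> = w}"
    have A: "card A = width_multiplicity (edge_width N P n) (height P n) w" unfolding A_def by (rule RP(3)[OF pn])
    have finA: "finite A" using RP(1) by (simp add: A_def)
    have e: "tilt (inner_normal N \<tau>) = tilt n \<longleftrightarrow> inner_normal N \<tau> = n" for \<tau> using tilt_inj by auto
    have e': "- m = tilt n \<longleftrightarrow> n = - m" by (metis tilt_inj tilt_m(2))
    have L: "?L = (A - {\<sigma>}) \<union> (if n = - m \<and> w = height P (- m) then {\<sigma>} else {})"
    proof (rule set_eqI)
      show "x \<in> ?L \<longleftrightarrow> x \<in> (A - {\<sigma>}) \<union> (if n = - m \<and> w = height P (- m) then {\<sigma>} else {})" for x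
        by (cases "x = \<sigma>") (simp_all add: t n A_def e e' \<sigma>(1) eq_commute[of _ w])
    qed
    have mm: "m \<noteq> - m" using m_in(3) by (simp add: eq_neg_iff_add_eq_0 flip: scaleR_2)
    consider "n = m" | "n = - m" | "n \<noteq> m" "n \<noteq> - m" by blast
    then show ?thesis
    proof cases
      case 1
      then have L1: "?L = A - {\<sigma>}" using L mm by simp
      \<comment> \<open>\<sigma> is itself counted, so the quotient is positive and the edge is at
        least as long as its height.\<close>
      have "card {\<tau> \<in> \<Sigma>. inner_normal N \<tau> = m \<and> width N \<tau> = height P m} \<noteq> 0"
        using \<sigma> ws RP(1) by auto
      then have "nat (edge_width N P m div height P m) \<noteq> 0" using RP(3)[OF m] by (simp add: width_multiplicity_def)
      then have "height P m \<le> edge_width N P m"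
        using edge_width_nonneg[of m] by (metis div_pos_pos_trivial h(1) nat_0 not_le order_le_less)
      then have "card A = width_multiplicity (edge_width N Q (tilt n)) (height P n) w + (if w = height P m then 1 else 0)"
        unfolding A 1 tilt_m edge_width_m using width_multiplicity_diff h(1) by blast
      moreover have "\<sigma> \<in> A \<longleftrightarrow> w = height P m" using \<sigma> ws 1 by (auto simp: A_def)
      ultimately show ?thesis unfolding L1 R using finA by (auto simp: card_Diff_singleton_if)
    next
      case 2
      then have "\<sigma> \<notin> A" using \<sigma>(2) mm by (auto simp: A_def)
      then have "card ?L = card A + (if w = height P (- m) then 1 else 0)"
        unfolding L using 2 finA by auto
      also have "\<dots> = width_multiplicity (edge_width N P (- m) + height P (- m)) (height P (- m)) w"
        using width_multiplicity_diff[OF h(2), of "edge_width N P (- m) + height P (- m)" w] edge_width_nonneg[of "- m"]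
        by (simp add: A 2)
      finally show ?thesis unfolding R 2 tilt_m edge_width_minus_m .
    next
      case 3
      then have "n \<bullet> f \<noteq> 0" using dual_orthogonal_primitive[OF m pn f mf] by auto
      moreover have "\<sigma> \<notin> A" using \<sigma>(2) 3 by (auto simp: A_def)
      ultimately show ?thesis unfolding L R using 3 A edge_width_tilt by simp
    qed
  qed
qed

lemma dual_det_tilt:
  assumes "k \<in> M" "n \<in> M"
  shows "dual_det B (tilt k) (tilt n) = dual_det B k n
      + int (nat (dual_det B k m)) * int (nat (dual_det B m n)) - int (nat (dual_det B n m)) * int (nat (dual_det B m k))"
proof -
  have tM: "tilt n \<in> M" if "n \<in> M" for n
  proof -
    have "n \<bullet> f \<in> \<int>" using inner_Ints that f_in by blast
    then have "min (n \<bullet> f) 0 \<in> \<int>" by (auto simp: min_def)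
    then show ?thesis unfolding tilt_def using that m_in by (intro dual_diff dual_scale)
  qed
  obtain \<epsilon> :: real where \<epsilon>: "f = \<epsilon> *\<^sub>R perp m" "\<epsilon> = 1 \<or> \<epsilon> = -1"
    using orthogonal_primitive[OF m f mf] by (metis scaleR_one scaleR_minus1_left)
  define x y where "x = k \<bullet> perp m" and "y = n \<bullet> perp m"
  have lin: "v \<bullet> perp (a - s *\<^sub>R b) = v \<bullet> perp a - s * (v \<bullet> perp b)" for v a b :: "real^2" and s
    by (simp add: inner_perp inner_diff_left algebra_simps)
  have "tilt n \<bullet> perp (tilt k) = n \<bullet> perp k - min (\<epsilon> * x) 0 * y + min (\<epsilon> * y) 0 * x"
    unfolding tilt_def lin using inner_perp_swap[of m k]
    by (simp add: inner_diff_left \<epsilon>(1) x_def y_def algebra_simps)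
  \<comment> \<open>After splitting x and y into positive and negative parts, the products of parts
    of equal sign cancel. The result is the same for both signs of \<epsilon>, that is, for both
    generators \<open>f\<close>.\<close>
  also have "\<dots> = n \<bullet> perp k + max (- x) 0 * max y 0 - max (- y) 0 * max x 0"
    using \<epsilon>(2) by (auto simp: min_def max_def)
  also have "\<dots> = n \<bullet> perp k + max (m \<bullet> perp k) 0 * max (n \<bullet> perp m) 0 - max (m \<bullet> perp n) 0 * max (k \<bullet> perp m) 0"
    using inner_perp_swap[of m k] inner_perp_swap[of m n] by (simp add: x_def y_def)
  finally have "of_int (dual_det B (tilt k) (tilt n)) = (of_int (dual_det B k n
      + int (nat (dual_det B k m)) * int (nat (dual_det B m n)) - int (nat (dual_det B n m)) * int (nat (dual_det B m k))) :: real)"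
    unfolding of_int_add of_int_diff of_int_mult using nat_dual_det m_in assms orientation tM by simp
  then show ?thesis by (simp only: of_int_eq_iff)
qed

lemma mutation_iso:
  assumes \<Sigma>: "standard_refinement N P \<Sigma>" and \<Sigma>': "standard_refinement N Q \<Sigma>'"
    and \<sigma>: "\<sigma> \<in> \<Sigma>" "inner_normal N \<sigma> = m" "width N \<sigma> = local_index N \<sigma>"
  shows "dquiver_iso (dquiver_mut \<sigma> (fan_quiver N B \<Sigma>)) (fan_quiver N B \<Sigma>')"
proof -
  interpret Q: oriented_fano N b1 b2 c1 c2 Q B by (rule oriented_Q)
  note RP = standard_refinement_types[OF \<Sigma>] and RQ = Q.standard_refinement_types[OF \<Sigma>']
  \<comment> \<open>The type (normal, width) that the image cone must have. Only \<sigma> itself is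
    sent to \<open>- m\<close>; other cones with normal \<open>m\<close> keep it.\<close>
  define ty where "ty \<tau> = (if \<tau> = \<sigma> then (- m, height P (- m)) else (tilt (inner_normal N \<tau>), width N \<tau>))" for \<tau>
  obtain \<phi> where \<phi>: "bij_betw \<phi> \<Sigma> \<Sigma>'" "\<And>\<tau>. \<tau> \<in> \<Sigma> \<Longrightarrow> (inner_normal N (\<phi> \<tau>), width N (\<phi> \<tau>)) = ty \<tau>"
    using fibrewise_bijection[OF RP(1) RQ(1), of ty "\<lambda>\<tau>. (inner_normal N \<tau>, width N \<tau>)"]
      mutated_types[OF assms] unfolding ty_def by blast
  have nM: "inner_normal N \<tau> \<in> M" if "\<tau> \<in> \<Sigma>" for \<tau> using RP(2)[OF that] edge_normal_in by blast
  \<comment> \<open>\<open>tilt n\<close> differs from \<open>n\<close> by a multiple of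
    \<open>m\<close>, which the determinant with \<open>m\<close> ignores; the sign of
    \<open>- m\<close> reverses the arrows at \<sigma>.\<close>
  have dm: "dual_det B (- m) (tilt n) = dual_det B n m" "dual_det B (tilt n) (- m) = dual_det B m n"
    if n: "n \<in> M" for n
  proof -
    have "min (n \<bullet> f) 0 \<in> \<int>" using inner_Ints[OF n f_in(1)] by (auto simp: min_def)
    then have tM: "tilt n \<in> M" unfolding tilt_def using n m_in by (intro dual_diff dual_scale)
    have e: "tilt n \<bullet> perp (- m) = m \<bullet> perp n" "(- m) \<bullet> perp (tilt n) = n \<bullet> perp m"
      by (simp_all add: tilt_def inner_perp inner_diff_left algebra_simps)
    show "dual_det B (- m) (tilt n) = dual_det B n m"
      using orientation[OF m_in(2) tM] orientation[OF n m_in(1)] e(1) by (metis of_int_eq_iff)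
    show "dual_det B (tilt n) (- m) = dual_det B m n"
      using orientation[OF tM m_in(2)] orientation[OF m_in(1) n] e(2) by (metis of_int_eq_iff)
  qed
  have d0: "dual_det B n n = 0" if "n \<in> M" for n using dual_det_minus[OF that that] by simp
  have arrows: "signed_arrows (fan_quiver N B \<Sigma>') (\<phi> a) (\<phi> b) = signed_arrows (dquiver_mut \<sigma> (fan_quiver N B \<Sigma>)) a b"
    if ab: "a \<in> \<Sigma>" "b \<in> \<Sigma>" for a b
  proof -
    let ?a = "inner_normal N a" and ?b = "inner_normal N b"
    have ty': "inner_normal N (\<phi> a) = fst (ty a)" "inner_normal N (\<phi> b) = fst (ty b)"
      using \<phi>(2)[OF ab(1)] \<phi>(2)[OF ab(2)] by (metis fst_conv)+
    have img: "inner_normal N (\<phi> c) \<in> M" if c: "c \<in> \<Sigma>" for c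
    proof -
      have "\<phi> c \<in> \<Sigma>'" using bij_betwE[OF \<phi>(1)] c by blast
      then show ?thesis using RQ(2) Q.edge_normal_in by blast
    qed
    have l: "signed_arrows (fan_quiver N B \<Sigma>') (\<phi> a) (\<phi> b) = dual_det B (fst (ty a)) (fst (ty b))"
      using dual_det_minus[OF img[OF ab(1)] img[OF ab(2)]] by (simp add: signed_arrows_def ty')
    have anti: "dual_det B ?b ?a = - dual_det B ?a ?b" using dual_det_minus nM ab by blast
    show ?thesis
    proof (cases "a = \<sigma> \<or> b = \<sigma>")
      case False
      then have "dual_det B (fst (ty a)) (fst (ty b)) = dual_det B ?a ?b
        + int (nat (dual_det B ?a m)) * int (nat (dual_det B m ?b)) - int (nat (dual_det B ?b m)) * int (nat (dual_det B m ?a))"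
        using dual_det_tilt nM ab by (simp add: ty_def)
      then show ?thesis unfolding l signed_arrows_mut using False anti
        by (simp add: premutation_arrows_def \<sigma>(2))
    next
      case True
      have "dual_det B (fst (ty a)) (fst (ty b)) = dual_det B ?b ?a"
      proof (cases "a = \<sigma>"; cases "b = \<sigma>")
        assume "a = \<sigma>" "b = \<sigma>"
        then show ?thesis using d0[OF m_in(2)] d0[OF m_in(1)] \<sigma>(2) by (simp add: ty_def)
      next
        assume "a = \<sigma>" "b \<noteq> \<sigma>" then show ?thesis using dm(1)[OF nM[OF ab(2)]] \<sigma>(2) by (simp add: ty_def)
      next
        assume "a \<noteq> \<sigma>" "b = \<sigma>" then show ?thesis using dm(2)[OF nM[OF ab(1)]] \<sigma>(2) by (simp add: ty_def)
      qed (use True in simp)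
      then show ?thesis unfolding l signed_arrows_mut using True anti
        by (auto simp: premutation_arrows_def)
    qed
  qed
  have labels: "label (fan_quiver N B \<Sigma>') (\<phi> a) = label (dquiver_mut \<sigma> (fan_quiver N B \<Sigma>)) a" if a: "a \<in> \<Sigma>" for a
  proof -
    have "\<phi> a \<in> \<Sigma>'" using bij_betwE[OF \<phi>(1)] a by blast
    then have li: "local_index N (\<phi> a) = height Q (inner_normal N (\<phi> a))" using RQ(2) by blast
    have wi: "inner_normal N (\<phi> a) = fst (ty a)" "width N (\<phi> a) = snd (ty a)" using \<phi>(2)[OF a] by (metis fst_conv snd_conv)+
    show ?thesis
    proof (cases "a = \<sigma>")
      case True
      \<comment> \<open>The width and index of \<sigma> both equal \<open>height P m\<close>;
        subtracting them from the diameter leaves \<open>height P (- m)\<close> in both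
        places.\<close>
      have "height Q (- m) = height P (- m)" using height_tilt[of "- m"] tilt_m by simp
      then show ?thesis using True wi li diameter_fan_quiver[OF \<Sigma> \<sigma>(1)] RP(2)[OF \<sigma>(1)] \<sigma>
        by (simp add: ty_def dquiver_mut_def)
    next
      case False
      then show ?thesis using wi li RP(2)[OF a] by (simp add: ty_def dquiver_mut_def height_tilt)
    qed
  qed
  have "vertices (dquiver_mut \<sigma> (fan_quiver N B \<Sigma>)) = \<Sigma>" by (simp add: dquiver_mut_def)
  then show ?thesis unfolding dquiver_iso_def using \<phi>(1) arrows labels
    by (intro exI[of _ \<phi>]) (simp del: fan_quiver_simps(2,3))
qed

end

context oriented_fano
begin

lemma quiv_refinement: "\<exists>\<Sigma>. standard_refinement N P \<Sigma> \<and> quiv N B P = fan_quiver N B \<Sigma>"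
  unfolding quiv_def using someI_ex[OF standard_refinement_exists] by blast

lemma quiv_label_le: "\<tau> \<in> vertices (quiv N B P) \<Longrightarrow> fst (label (quiv N B P) \<tau>) \<le> snd (label (quiv N B P) \<tau>)"
  using quiv_refinement standard_refinement_types(2) by fastforce

lemma quiv_mutation:
  assumes \<sigma>: "primitive_T_vertex (quiv N B P) \<sigma>" and F: "unit_length_segment N (inner_normal N \<sigma>) F"
  shows "is_factor N P (inner_normal N \<sigma>) F \<and> fano_polygon N (polygon_mut N (inner_normal N \<sigma>) F P) \<and>
    dquiver_iso (dquiver_mut \<sigma> (quiv N B P)) (quiv N B (polygon_mut N (inner_normal N \<sigma>) F P))"
proof -
  obtain \<Sigma> where \<Sigma>: "standard_refinement N P \<Sigma>" "quiv N B P = fan_quiver N B \<Sigma>" using quiv_refinement by blast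
  define m where "m = inner_normal N \<sigma>"
  have s: "\<sigma> \<in> \<Sigma>" "width N \<sigma> = local_index N \<sigma>" using \<sigma> by (auto simp: \<Sigma> primitive_T_vertex_def)
  note R = standard_refinement_types[OF \<Sigma>(1)]
  have m: "primitive M m" using R(2)[OF s(1)] by (auto simp: m_def edge_normals_def)
  have h: "0 < height P m" using height_pos m primitive_in primitive_nz by blast
  have "width N \<sigma> = height P m" using R(2)[OF s(1)] s by (simp add: m_def)
  \<comment> \<open>\<sigma> itself is counted, so the edge is at least as long as its height, which
    is the condition in \<open>factor_exists\<close>.\<close>
  then have "card {\<tau> \<in> \<Sigma>. inner_normal N \<tau> = m \<and> width N \<tau> = height P m} \<noteq> 0"
    using s R(1) by (auto simp: m_def)
  then have "nat (edge_width N P m div height P m) \<noteq> 0" using R(3)[OF m] by (simp add: width_multiplicity_def)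
  then have le: "height P m \<le> edge_width N P m"
    using edge_width_nonneg[of m] by (metis div_pos_pos_trivial h nat_0 not_le order_le_less)
  obtain f where f: "primitive N f" "m \<bullet> f = 0" "F = convex hull {0, f}"
    using F by (auto simp: unit_length_segment_def m_def)
  have fac: "is_factor N P m F" by (rule factor_exists[OF m f le])
  \<comment> \<open>The same choice term as in \<open>polygon_mut\<close>, so that unfolding
    identifies the two.\<close>
  define G where "G = (SOME G. \<forall>h<0. admissible_remainder N P m F h (G h))"
  have "\<exists>G. \<forall>h<0. admissible_remainder N P m F h (G h)" using fac unfolding is_factor_def by metis
  then have "\<forall>h<0. admissible_remainder N P m F h (G h)" unfolding G_def by (rule someI_ex)
  then obtain Y where "mutation N b1 b2 c1 c2 P m f Y (polygon_mut N m F P)"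
    using mutation_of_remainders[OF m f] unfolding polygon_mut_def G_def Let_def by blast
  then interpret mutation N b1 b2 c1 c2 P m f Y "polygon_mut N m F P" .
  interpret oriented_mutation N b1 b2 c1 c2 P m f Y "polygon_mut N m F P" B ..
  interpret Q: oriented_fano N b1 b2 c1 c2 "polygon_mut N m F P" B by (rule oriented_Q)
  obtain \<Sigma>' where \<Sigma>': "standard_refinement N (polygon_mut N m F P) \<Sigma>'"
    "quiv N B (polygon_mut N m F P) = fan_quiver N B \<Sigma>'" using Q.quiv_refinement by blast
  have "dquiver_iso (dquiver_mut \<sigma> (quiv N B P)) (quiv N B (polygon_mut N m F P))"
    unfolding \<Sigma> \<Sigma>'(2) by (rule mutation_iso[OF \<Sigma>(1) \<Sigma>'(1) s(1) m_def[symmetric] s(2)])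
  then show ?thesis using fac fano_Q by (simp add: m_def)
qed

end

lemma oriented_fano_exists:
  assumes "oriented_lattice N B" "fano_polygon N P"
  shows "\<exists>b1 b2 c1 c2. oriented_fano N b1 b2 c1 c2 P B"
proof -
  obtain b1 b2 where b: "lattice_basis N b1 b2"
    and B: "B = {(of_int p *\<^sub>R b1 + of_int q *\<^sub>R b2, of_int r *\<^sub>R b1 + of_int s *\<^sub>R b2) | p q r s :: int. p * s - q * r = 1}"
    using assms(1) by (auto simp: oriented_lattice_def)
  obtain c1 c2 where c: "planar_lattice N b1 b2 c1 c2" using lattice_basis_imp_planar_lattice[OF b] by blast
  interpret planar_lattice N b1 b2 c1 c2 by (rule c)
  have "oriented_fano N b1 b2 c1 c2 P B"
    using assms(2) dual_det_eq[OF B] by unfold_locales auto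
  then show ?thesis by blast
qed

theorem proposition4p6:
  fixes N :: "(real^2) set" and B :: "((real^2) \<times> (real^2)) set"
    and P :: "(real^2) set" and \<sigma> :: "(real^2) set"
  assumes "oriented_lattice N B"
    and "fano_polygon N P"
    and "\<sigma> \<in> vertices (quiv N B P)"
  shows "(polygonal (dquiver_mut \<sigma> (quiv N B P)) \<longleftrightarrow> primitive_T_vertex (quiv N B P) \<sigma>) \<and>
    (primitive_T_vertex (quiv N B P) \<sigma> \<longrightarrow>
      (\<forall>F. unit_length_segment N (inner_normal N \<sigma>) F \<longrightarrow>
         is_factor N P (inner_normal N \<sigma>) F \<and>
         fano_polygon N (polygon_mut N (inner_normal N \<sigma>) F P) \<and>
         dquiver_iso (dquiver_mut \<sigma> (quiv N B P))
           (quiv N B (polygon_mut N (inner_normal N \<sigma>) F P))))"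
proof -
  obtain b1 b2 c1 c2 where "oriented_fano N b1 b2 c1 c2 P B" using oriented_fano_exists[OF assms(1,2)] by blast
  then interpret oriented_fano N b1 b2 c1 c2 P B .
  let ?Q = "quiv N B P"
  have T: "primitive_T_vertex ?Q \<sigma>" if pol: "polygonal (dquiver_mut \<sigma> ?Q)"
  proof (rule ccontr)
    assume "\<not> primitive_T_vertex ?Q \<sigma>"
    then have lt: "fst (label ?Q \<sigma>) < snd (label ?Q \<sigma>)"
      using quiv_label_le[OF assms(3)] assms(3) by (simp add: primitive_T_vertex_def)
    \<comment> \<open>The witness may live on another lattice, so the bound on labels is interpreted
      there.\<close>
    obtain N' B' P' where *: "oriented_lattice N' B'" "fano_polygon N' P'" "dquiver_iso (dquiver_mut \<sigma> ?Q) (quiv N' B' P')"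
      using pol unfolding polygonal_def by blast
    obtain b1' b2' c1' c2' where "oriented_fano N' b1' b2' c1' c2' P' B'" using oriented_fano_exists[OF *(1,2)] by blast
    then interpret P': oriented_fano N' b1' b2' c1' c2' P' B' .
    obtain \<phi> where \<phi>: "bij_betw \<phi> (vertices (dquiver_mut \<sigma> ?Q)) (vertices (quiv N' B' P'))"
      "\<forall>a\<in>vertices (dquiver_mut \<sigma> ?Q). label (quiv N' B' P') (\<phi> a) = label (dquiver_mut \<sigma> ?Q) a"
      using *(3) unfolding dquiver_iso_def by blast
    have v: "\<sigma> \<in> vertices (dquiver_mut \<sigma> ?Q)" using assms(3) by (simp add: dquiver_mut_def)
    then have "\<phi> \<sigma> \<in> vertices (quiv N' B' P')" using bij_betwE[OF \<phi>(1)] by blast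
    then have "fst (label (dquiver_mut \<sigma> ?Q) \<sigma>) \<le> snd (label (dquiver_mut \<sigma> ?Q) \<sigma>)"
      using P'.quiv_label_le \<phi>(2) v by metis
    \<comment> \<open>With D the diameter at \<sigma>, D - w \<le> D - l contradicts w < l for any
      value of D.\<close>
    then show False using lt by (simp add: dquiver_mut_def)
  qed
  have "polygonal (dquiver_mut \<sigma> ?Q)" if t: "primitive_T_vertex ?Q \<sigma>"
  proof -
    obtain \<Sigma> where \<Sigma>: "standard_refinement N P \<Sigma>" "?Q = fan_quiver N B \<Sigma>" using quiv_refinement by blast
    then have "primitive M (inner_normal N \<sigma>)"
      using standard_refinement_types(2)[OF \<Sigma>(1), of \<sigma>] assms(3) by (auto simp: edge_normals_def)
    \<comment> \<open>Polygonality needs an actual mutated polygon, and \<open>perp\<close> supplies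
      one unit segment to form it.\<close>
    then have "unit_length_segment N (inner_normal N \<sigma>) (convex hull {0, perp (inner_normal N \<sigma>)})"
      unfolding unit_length_segment_def using perp_primitive inner_perp_self by blast
    then show ?thesis using quiv_mutation[OF t] assms(1) unfolding polygonal_def by blast
  qed
  then show ?thesis using T quiv_mutation by blast
qed

end
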